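(* Let $K$ be a locally compact hypergroup with a left Haar measure $\omega$. Suppose $K$ has the Liouville property, i.e. there exists a probability measure $\sigma$ on $K$ such that $H^\infty_\sigma(K)=\mathbb{C}1$. Then $K$ is amenable.
   Context: $K$ is a locally compact hypergroup (Jewett/Bloom–Heyer sense) with involution $x\mapsto\check x$ and left Haar measure $\omega$ (nonzero positive Radon measure with $\delta_x*\omega=\omega$ for all $x$); $L^p(K)$ are taken with respect to $\omega$. For a Borel function $f$, $f(x*y)=\int_K f\,d(\delta_x*\delta_y)$, and for $\mu\in M(K)$, $(\mu*f)(x)=\int_K f(\check y*x)\,d\mu(y)$. $H^\infty_\sigma(K)=\{f\in L^\infty(K):\sigma*f=f\}$, and $1$ is the constant function one. For Borel functions $g,f$, $(g*f)(x)=\int_K g(y)f(\check y*x)\,d\omega(y)$. $K$ is called amenable if there is $m\in L^\infty(K)^*$ with $\|m\|=m(1)=1$ and $m(g*f)=\left(\int_K g\,d\omega\right)m(f)$ for all $f\in L^\infty(K)$ and $g\in L^1(K)$. *)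

theory Defs
  imports "HOL-Probability.Probability"
begin

section \<open>Locally compact hypergroups (Jewett / Bloom--Heyer)\<close>

text \<open>The hypergroup K is the type 'a (a Hausdorff, locally compact space).
  The convolution of point measures delta_x * delta_y is given by cv x y
  (a Borel measure), e is the identity and iv the involution x |-> x-check.\<close>

definition msupp :: "'a::topological_space measure \<Rightarrow> 'a set" where
  "msupp \<mu> = {z. \<forall>U. open U \<and> z \<in> U \<longrightarrow> emeasure \<mu> U > 0}"

definition Cc :: "('a::topological_space \<Rightarrow> real) set" where
  "Cc = {f. continuous_on UNIV f \<and> (\<exists>C. compact C \<and> (\<forall>x. x \<notin> C \<longrightarrow> f x = 0))}"

definition radon_measure :: "'a::t2_space measure \<Rightarrow> bool" where
  "radon_measure \<mu> \<longleftrightarrow> sets \<mu> = sets borel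
     \<and> (\<forall>C. compact C \<longrightarrow> emeasure \<mu> C < \<infinity>)
     \<and> (\<forall>A\<in>sets borel. emeasure \<mu> A = (INF U\<in>{U. open U \<and> A \<subseteq> U}. emeasure \<mu> U))
     \<and> (\<forall>U. open U \<longrightarrow> emeasure \<mu> U = (SUP C\<in>{C. compact C \<and> C \<subseteq> U}. emeasure \<mu> C))"

definition hypergroup :: "('a::t2_space \<Rightarrow> 'a \<Rightarrow> 'a measure) \<Rightarrow> 'a \<Rightarrow> ('a \<Rightarrow> 'a) \<Rightarrow> bool" where
  "hypergroup cv e iv \<longleftrightarrow>
     locally_compact_space (euclidean :: 'a topology)
     \<comment> \<open>delta_x * delta_y is a Radon probability measure with compact support\<close>
     \<and> (\<forall>x y. prob_space (cv x y) \<and> radon_measure (cv x y) \<and> compact (msupp (cv x y)))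
     \<comment> \<open>(x,y) |-> delta_x * delta_y is continuous into M^1(K) (weak/cone topology)\<close>
     \<and> (\<forall>f\<in>Cc. continuous_on UNIV (\<lambda>p. integral\<^sup>L (cv (fst p) (snd p)) f))
     \<comment> \<open>(x,y) |-> supp(delta_x * delta_y) is continuous for the Michael topology\<close>
     \<and> (\<forall>V. open V \<longrightarrow> open {p. msupp (cv (fst p) (snd p)) \<subseteq> V})
     \<and> (\<forall>U. open U \<longrightarrow> open {p. msupp (cv (fst p) (snd p)) \<inter> U \<noteq> {}})
     \<comment> \<open>associativity: (delta_x * delta_y) * delta_z = delta_x * (delta_y * delta_z)\<close>
     \<and> (\<forall>x y z. \<forall>f\<in>Cc.
          (\<integral>u. (\<integral>w. f w \<partial>cv u z) \<partial>cv x y) = (\<integral>v. (\<integral>w. f w \<partial>cv x v) \<partial>cv y z))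
     \<comment> \<open>identity\<close>
     \<and> (\<forall>x. cv e x = return borel x \<and> cv x e = return borel x)
     \<comment> \<open>involution\<close>
     \<and> continuous_on UNIV iv \<and> (\<forall>x. iv (iv x) = x)
     \<and> (\<forall>x y. cv (iv y) (iv x) = distr (cv x y) borel iv)
     \<and> (\<forall>x y. e \<in> msupp (cv x y) \<longleftrightarrow> x = iv y)"

definition left_haar :: "('a::t2_space \<Rightarrow> 'a \<Rightarrow> 'a measure) \<Rightarrow> 'a measure \<Rightarrow> bool" where
  "left_haar cv \<omega> \<longleftrightarrow> radon_measure \<omega> \<and> emeasure \<omega> UNIV \<noteq> 0
     \<and> (\<forall>x. \<forall>f\<in>Cc. (\<integral>y. (\<integral>w. f w \<partial>cv x y) \<partial>\<omega>) = (\<integral>w. f w \<partial>\<omega>))"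

definition hfun :: "('a \<Rightarrow> 'a \<Rightarrow> 'a measure) \<Rightarrow> ('a \<Rightarrow> complex) \<Rightarrow> 'a \<Rightarrow> 'a \<Rightarrow> complex" where
  "hfun cv f x y = (\<integral>w. f w \<partial>cv x y)"

definition locally_null :: "'a::topological_space measure \<Rightarrow> 'a set \<Rightarrow> bool" where
  "locally_null \<omega> N \<longleftrightarrow> N \<in> sets borel \<and> (\<forall>C. compact C \<longrightarrow> emeasure \<omega> (N \<inter> C) = 0)"

text \<open>equality locally almost everywhere (equality in L^infinity)\<close>
definition loc_ae_eq :: "'a::topological_space measure \<Rightarrow> ('a \<Rightarrow> complex) \<Rightarrow> ('a \<Rightarrow> complex) \<Rightarrow> bool" where
  "loc_ae_eq \<omega> f g \<longleftrightarrow> (\<exists>N. locally_null \<omega> N \<and> {x. f x \<noteq> g x} \<subseteq> N)"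

definition Linf :: "'a::topological_space measure \<Rightarrow> ('a \<Rightarrow> complex) set" where
  "Linf \<omega> = {f. f \<in> borel_measurable borel \<and>
                (\<exists>c. \<exists>N. locally_null \<omega> N \<and> {x. norm (f x) > c} \<subseteq> N)}"

definition ess_norm :: "'a::topological_space measure \<Rightarrow> ('a \<Rightarrow> complex) \<Rightarrow> real" where
  "ess_norm \<omega> f = Inf {c. c \<ge> 0 \<and> (\<exists>N. locally_null \<omega> N \<and> {x. norm (f x) > c} \<subseteq> N)}"

definition mconv :: "('a \<Rightarrow> 'a \<Rightarrow> 'a measure) \<Rightarrow> ('a \<Rightarrow> 'a) \<Rightarrow> 'a measure \<Rightarrow> ('a \<Rightarrow> complex) \<Rightarrow> 'a \<Rightarrow> complex" where
  "mconv cv iv \<mu> f x = (\<integral>y. hfun cv f (iv y) x \<partial>\<mu>)"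

definition fconv :: "('a \<Rightarrow> 'a \<Rightarrow> 'a measure) \<Rightarrow> ('a \<Rightarrow> 'a) \<Rightarrow> 'a measure \<Rightarrow> ('a \<Rightarrow> complex) \<Rightarrow> ('a \<Rightarrow> complex) \<Rightarrow> 'a \<Rightarrow> complex" where
  "fconv cv iv \<omega> g f x = (\<integral>y. g y * hfun cv f (iv y) x \<partial>\<omega>)"

definition Hinf_sigma :: "('a \<Rightarrow> 'a \<Rightarrow> 'a measure) \<Rightarrow> ('a \<Rightarrow> 'a) \<Rightarrow> 'a::topological_space measure \<Rightarrow> 'a measure \<Rightarrow> ('a \<Rightarrow> complex) set" where
  "Hinf_sigma cv iv \<omega> \<sigma> = {f\<in>Linf \<omega>. loc_ae_eq \<omega> (mconv cv iv \<sigma> f) f}"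

text \<open>Amenability: a functional m in L^infinity(K)^* with norm m = m(1) = 1 and
  m(g * f) = (integral g) m(f).  A bounded functional on L^infinity is represented as a
  linear map on (Borel) L^infinity functions bounded by the essential sup norm.\<close>
definition amenable :: "('a \<Rightarrow> 'a \<Rightarrow> 'a measure) \<Rightarrow> ('a \<Rightarrow> 'a) \<Rightarrow> 'a::topological_space measure \<Rightarrow> bool" where
  "amenable cv iv \<omega> \<longleftrightarrow> (\<exists>m :: ('a \<Rightarrow> complex) \<Rightarrow> complex.
      (\<forall>f\<in>Linf \<omega>. \<forall>g\<in>Linf \<omega>. \<forall>a b. m (\<lambda>x. a * f x + b * g x) = a * m f + b * m g)
    \<and> (\<forall>f\<in>Linf \<omega>. norm (m f) \<le> ess_norm \<omega> f)
    \<and> m (\<lambda>_. 1) = 1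
    \<and> (\<forall>f\<in>Linf \<omega>. \<forall>g. integrable \<omega> g \<longrightarrow> m (fconv cv iv \<omega> g f) = (\<integral>y. g y \<partial>\<omega>) * m f))"

end

theory Submission
  imports Defs
begin

text \<open>For a bounded Borel function \<open>f\<close> on \<open>K\<close> put \<open>F x = f (iv x)\<close>, and let \<open>F\<^sub>n\<close> be the Cesaro means of the
  functions \<open>\<sigma>\<^sup>k * F\<close>. For a probability density \<open>g \<in> C\<^sub>c\<close> let \<open>\<Lambda> g\<close> be the limit of \<open>\<integral> g F\<^sub>n d\<omega>\<close> along a
  filter, refining \<open>n \<rightarrow> \<infinity>\<close>, along which all these sequences converge (Tychonoff).
  The functions \<open>u\<^sub>n x = \<integral> F\<^sub>n (x * y) g y d\<omega>(y)\<close> are equicontinuous, and their limit \<open>u x = \<Lambda> (\<delta>\<^sub>x * g)\<close> is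
  bounded, continuous and \<open>\<sigma>\<close>-harmonic because right translations commute with the left convolution by \<open>\<sigma>\<close>.
  By the Liouville property \<open>u\<close> is constant, so \<open>\<Lambda> (h * g)\<close> does not depend on \<open>h\<close>; letting \<open>g\<close> run through
  an approximate unit, \<open>\<Lambda> h\<close> does not depend on the density \<open>h\<close> at all. Call this number \<open>m f\<close>.
  Since \<open>\<integral> h ((g * f) \<circ> iv)\<^sub>n d\<omega> = \<integral> (h * g) F\<^sub>n d\<omega>\<close>, the mean \<open>m\<close> satisfies \<open>m (g * f) = m f\<close> for densities
  \<open>g \<in> C\<^sub>c\<close>, and the general case follows from the density of \<open>C\<^sub>c\<close> in \<open>L\<^sup>1\<close>.

  The adjoint relation \<open>\<integral> f (x * y) g y d\<omega>(y) = \<integral> f y g (iv x * y) d\<omega>(y)\<close> is obtained by evaluating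
  \<open>\<integral>\<integral> f z g y k (iv z * x * y) d\<omega>(y) d\<omega>(z)\<close> in two ways for symmetric densities \<open>k\<close> concentrating at the unit.\<close>

section \<open>Radon probability measures on locally compact spaces\<close>

text \<open>Amenability asks for invariance under left convolutions, but the harmonic functions of
  the hypothesis are stable under right ones. Composing with \<open>iv\<close> exchanges the two
  sides, which is why \<open>F\<close> and not \<open>f\<close> enters the averages. The price is
  that \<open>\<omega>\<close> is only left invariant: it has to be shown separately that
  \<open>iv\<close> preserves locally null sets and that translated densities are again densities.
  Cesaro means are taken because the iterates of the walk alone need not become asymptotically
  invariant (periodicity), whereas an average of \<open>n + 1\<close> of them moves by at most
  \<open>2 * B / (n + 1)\<close>. The obstacle that shapes most of the text is that no countability
  is assumed of \<open>K\<close>: Borel sets of \<open>K \<times> K\<close> may fall outside the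
  product sigma-algebra, null and locally null sets differ, and limits run along filters. Finite
  covers of compact sets, tightness, and tests against functions in \<open>Cc\<close> therefore take
  the place of product measures and dominated convergence.\<close>

definition urysohn_family :: "'a::topological_space set \<Rightarrow> ('a \<Rightarrow> real) set" where
  "urysohn_family U = {f\<in>Cc. (\<forall>x. 0 \<le> f x \<and> f x \<le> 1) \<and> (\<exists>D. compact D \<and> D \<subseteq> U \<and> (\<forall>x. x \<notin> D \<longrightarrow> f x = 0))}"

text \<open>Regularity is tested on open sets only: a finite Borel measure is determined by them,
  and in this form regularity passes to mixtures over kernels and to measures with a
  density.\<close>

definition finite_radon :: "'a::t2_space measure \<Rightarrow> bool" where
  "finite_radon \<mu> \<longleftrightarrow> finite_measure \<mu> \<and> sets \<mu> = sets borel
     \<and> (\<forall>U. open U \<longrightarrow> (\<forall>r < measure \<mu> U. \<exists>C. compact C \<and> C \<subseteq> U \<and> r < measure \<mu> C))"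

definition radon_prob :: "'a::t2_space measure \<Rightarrow> bool" where
  "radon_prob \<mu> \<longleftrightarrow> prob_space \<mu> \<and> finite_radon \<mu>"

text \<open>The parameter space is an arbitrary topological space, so that a jointly continuous
  kernel in two variables is a kernel on a product type.\<close>

definition radon_kernel :: "('b::topological_space \<Rightarrow> 'a::t2_space measure) \<Rightarrow> bool" where
  "radon_kernel \<kappa> \<longleftrightarrow> (\<forall>x. radon_prob (\<kappa> x)) \<and> (\<forall>f\<in>Cc. continuous_on UNIV (\<lambda>x. \<integral>w. f w \<partial>\<kappa> x))"

lemma radon_probD:
  assumes "radon_prob \<mu>"
  shows "prob_space \<mu>" "finite_radon \<mu>" "finite_measure \<mu>" "sets \<mu> = sets borel" "space \<mu> = UNIV"
    "measure \<mu> UNIV = 1"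
proof -
  show 1: "prob_space \<mu>" "finite_radon \<mu>" "finite_measure \<mu>" and s: "sets \<mu> = sets borel"
    using assms by (auto simp: radon_prob_def finite_radon_def)
  show 2: "space \<mu> = UNIV" using sets_eq_imp_space_eq[OF s] by simp
  show "measure \<mu> UNIV = 1" using prob_space.prob_space[OF 1(1)] 2 by simp
qed

lemma radon_prob_tight:
  assumes "radon_prob \<mu>" "0 < (\<epsilon>::real)"
  obtains C where "compact C" "measure \<mu> (- C) < \<epsilon>"
proof -
  note D = radon_probD[OF assms(1)]
  have "\<forall>r < measure \<mu> UNIV. \<exists>C. compact C \<and> C \<subseteq> UNIV \<and> r < measure \<mu> C"
    using D(2) unfolding finite_radon_def by auto
  from this[rule_format, of "1 - \<epsilon>"] obtain C where C: "compact C" "1 - \<epsilon> < measure \<mu> C"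
    using assms(2) D(6) by auto
  have "C \<in> sets \<mu>" using C(1) D(4) borel_compact by auto
  from finite_measure.finite_measure_compl[OF D(3) this] have "measure \<mu> (- C) = 1 - measure \<mu> C"
    using D(5,6) by (simp add: Compl_eq_Diff_UNIV)
  with C that show ?thesis by auto
qed

lemma Cc_continuous: "f \<in> Cc \<Longrightarrow> continuous_on UNIV f" by (simp add: Cc_def)

lemma Cc_measurable: "f \<in> Cc \<Longrightarrow> f \<in> borel_measurable borel"
  by (intro borel_measurable_continuous_onI Cc_continuous)

lemma Cc_bounded:
  fixes f :: "'a::t2_space \<Rightarrow> real"
  assumes "f \<in> Cc" obtains B where "B > 0" "\<And>x. \<bar>f x\<bar> \<le> B"
proof -
  from assms obtain C where C: "compact C" "\<And>x. x \<notin> C \<Longrightarrow> f x = 0" and f: "continuous_on UNIV f"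
    by (auto simp: Cc_def)
  have "compact (f ` C)" by (intro compact_continuous_image C continuous_on_subset[OF f]) auto
  then have "bounded (f ` C)" by (rule compact_imp_bounded)
  then obtain B where "B > 0" "\<And>x. x \<in> C \<Longrightarrow> \<bar>f x\<bar> \<le> B" by (auto simp: bounded_pos)
  with C(2) that[of B] show ?thesis by (metis abs_zero less_eq_real_def)
qed

lemma Cc_max:
  assumes "f \<in> Cc" "g \<in> Cc" shows "(\<lambda>x. max (f x) (g x)) \<in> Cc"
proof -
  from assms obtain C D where "compact C" "\<And>x. x \<notin> C \<Longrightarrow> f x = 0" "compact D" "\<And>x. x \<notin> D \<Longrightarrow> g x = 0"
    by (auto simp: Cc_def)
  then have "compact (C \<union> D) \<and> (\<forall>x. x \<notin> C \<union> D \<longrightarrow> max (f x) (g x) = 0)" by auto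
  then show ?thesis using assms by (auto simp: Cc_def intro!: continuous_intros)
qed

lemma Cc_scale:
  assumes "f \<in> Cc" shows "(\<lambda>x. c * f x) \<in> Cc"
  using assms by (auto simp: Cc_def intro!: continuous_intros)

lemma Cc_add:
  assumes "f \<in> Cc" "g \<in> Cc" shows "(\<lambda>x. f x + g x) \<in> Cc"
proof -
  from assms obtain C D where "compact C" "\<And>x. x \<notin> C \<Longrightarrow> f x = 0" "compact D" "\<And>x. x \<notin> D \<Longrightarrow> g x = 0"
    by (auto simp: Cc_def)
  then have "compact (C \<union> D) \<and> (\<forall>x. x \<notin> C \<union> D \<longrightarrow> f x + g x = 0)" by auto
  then show ?thesis using assms by (auto simp: Cc_def intro!: continuous_intros)
qed

lemma zero_in_urysohn_family: "(\<lambda>_. 0) \<in> urysohn_family U"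
  by (auto simp: urysohn_family_def Cc_def intro: exI[of _ "{}"])

lemma urysohn_family_max:
  assumes "f \<in> urysohn_family U" "g \<in> urysohn_family U"
  shows "(\<lambda>x. max (f x) (g x)) \<in> urysohn_family U"
proof -
  from assms obtain C D where "compact C" "C \<subseteq> U" "\<And>x. x \<notin> C \<Longrightarrow> f x = 0" "compact D" "D \<subseteq> U" "\<And>x. x \<notin> D \<Longrightarrow> g x = 0"
    by (auto simp: urysohn_family_def)
  then have "compact (C \<union> D) \<and> C \<union> D \<subseteq> U \<and> (\<forall>x. x \<notin> C \<union> D \<longrightarrow> max (f x) (g x) = 0)" by auto
  then have "\<exists>D. compact D \<and> D \<subseteq> U \<and> (\<forall>x. x \<notin> D \<longrightarrow> max (f x) (g x) = 0)" by blast
  then show ?thesis using assms Cc_max[of f g] by (auto simp: urysohn_family_def le_max_iff_disj)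
qed

lemma integrable_bounded:
  fixes f :: "'a::t2_space \<Rightarrow> 'b::{banach, second_countable_topology}"
  assumes "finite_measure \<mu>" "sets \<mu> = sets borel" "f \<in> borel_measurable borel" "\<And>x. norm (f x) \<le> B"
  shows "integrable \<mu> f"
  using assms by (intro finite_measure.integrable_const_bound[where B=B]) (auto cong: measurable_cong_sets)

lemma radon_prob_integrable:
  fixes f :: "'a::t2_space \<Rightarrow> 'b::{banach, second_countable_topology}"
  assumes "radon_prob \<mu>" "f \<in> borel_measurable borel" "\<And>x. norm (f x) \<le> B"
  shows "integrable \<mu> f"
  using assms radon_probD[OF assms(1)] by (intro integrable_bounded[where B=B]) auto

lemma radon_prob_norm_integral_le:
  fixes f :: "'a::t2_space \<Rightarrow> 'b::{banach, second_countable_topology}"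
  assumes "radon_prob \<mu>" "f \<in> borel_measurable borel" "\<And>x. norm (f x) \<le> B"
  shows "norm (\<integral>x. f x \<partial>\<mu>) \<le> B"
proof -
  note D = radon_probD[OF assms(1)]
  interpret prob_space \<mu> by (rule D)
  have "integrable \<mu> f" by (rule radon_prob_integrable[OF assms])
  then have "norm (\<integral>x. f x \<partial>\<mu>) \<le> (\<integral>x. norm (f x) \<partial>\<mu>)" by simp
  also have "\<dots> \<le> B" using \<open>integrable \<mu> f\<close> assms(3) by (intro integral_le_const) auto
  finally show ?thesis .
qed

text \<open>Dominated convergence is not available along general filters; this estimate replaces it for
  bounded functions that are close on a compact set of almost full measure.\<close>
lemma radon_prob_integral_close:
  fixes f g :: "'a::t2_space \<Rightarrow> 'b::{banach, second_countable_topology}"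
  assumes mu: "radon_prob \<mu>" and f: "f \<in> borel_measurable borel" and g: "g \<in> borel_measurable borel"
    and B: "\<And>x. norm (f x) \<le> B" "\<And>x. norm (g x) \<le> B"
    and C: "compact C" "measure \<mu> (- C) \<le> \<delta>"
    and close: "\<And>x. x \<in> C \<Longrightarrow> norm (f x - g x) \<le> \<epsilon>" and "0 \<le> \<epsilon>"
  shows "norm ((\<integral>x. f x \<partial>\<mu>) - (\<integral>x. g x \<partial>\<mu>)) \<le> \<epsilon> + 2 * B * \<delta>"
proof -
  note D = radon_probD[OF mu]
  interpret prob_space \<mu> by (rule D)
  have B0: "0 \<le> B" using B(1)[of undefined] norm_ge_zero order_trans by blast
  have Cs: "- C \<in> sets \<mu>" using D(4) C(1) by (simp add: borel_compact borel_comp)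
  have if': "integrable \<mu> f" and ig: "integrable \<mu> g"
    using radon_prob_integrable[OF mu f] radon_prob_integrable[OF mu g] B by auto
  have int_ind: "integrable \<mu> (\<lambda>x. 2 * B * indicator (- C) x)"
    using Cs by (intro integrable_mult_right integrable_real_indicator) (auto simp: emeasure_eq_measure)
  then have int_bd: "integrable \<mu> (\<lambda>x. \<epsilon> + 2 * B * indicator (- C) x)"
    by (intro Bochner_Integration.integrable_add integrable_const)
  have "norm ((\<integral>x. f x \<partial>\<mu>) - (\<integral>x. g x \<partial>\<mu>)) = norm (\<integral>x. f x - g x \<partial>\<mu>)"
    using if' ig by simp
  also have "\<dots> \<le> (\<integral>x. norm (f x - g x) \<partial>\<mu>)" by (rule integral_norm_bound)
  also have "\<dots> \<le> (\<integral>x. \<epsilon> + 2 * B * indicator (- C) x \<partial>\<mu>)"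
  proof (rule integral_mono)
    show "integrable \<mu> (\<lambda>x. norm (f x - g x))" using if' ig by simp
    show "integrable \<mu> (\<lambda>x. \<epsilon> + 2 * B * indicator (- C) x)" by (rule int_bd)
    fix x show "norm (f x - g x) \<le> \<epsilon> + 2 * B * indicator (- C) x"
    proof (cases "x \<in> C")
      case False
      have "norm (f x - g x) \<le> norm (f x) + norm (g x)" by (rule norm_triangle_ineq4)
      then show ?thesis using False B(1)[of x] B(2)[of x] \<open>0 \<le> \<epsilon>\<close> by simp
    qed (use close in simp)
  qed
  also have "\<dots> = \<epsilon> + 2 * B * measure \<mu> (- C)"
    using Cs prob_space by (subst Bochner_Integration.integral_add[OF integrable_const int_ind]) simp
  also have "\<dots> \<le> \<epsilon> + 2 * B * \<delta>" using C(2) B0 by (simp add: mult_left_mono)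
  finally show ?thesis .
qed

lemma radon_measure_imp_radon_prob:
  assumes "radon_measure \<mu>" "prob_space \<mu>"
  shows "radon_prob \<mu>"
proof -
  interpret prob_space \<mu> by fact
  have s: "sets \<mu> = sets borel" using assms by (simp add: radon_measure_def)
  have "\<exists>C. compact C \<and> C \<subseteq> U \<and> r < measure \<mu> C" if U: "open U" and r: "r < measure \<mu> U" for U r
  proof (cases "r < 0")
    case True then show ?thesis by (intro exI[of _ "{}"]) auto
  next
    case False
    have "emeasure \<mu> U = (SUP C\<in>{C. compact C \<and> C \<subseteq> U}. emeasure \<mu> C)"
      using assms(1) U by (auto simp: radon_measure_def)
    moreover have "ennreal r < emeasure \<mu> U" using r False by (simp add: emeasure_eq_measure ennreal_less_iff)
    ultimately obtain C where "compact C" "C \<subseteq> U" "ennreal r < emeasure \<mu> C" by (auto simp: less_SUP_iff)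
    then show ?thesis using False by (auto simp: emeasure_eq_measure ennreal_less_iff)
  qed
  then show ?thesis using assms s finite_measure_axioms by (auto simp: radon_prob_def finite_radon_def)
qed

section \<open>Joint continuity and Fubini for Radon probabilities\<close>

lemma continuous_uniform_on_compact:
  fixes H :: "'a::topological_space \<Rightarrow> 'c::topological_space \<Rightarrow> 'b::metric_space"
  assumes H: "continuous_on UNIV (\<lambda>p. H (fst p) (snd p))" and D: "compact D" and "0 < \<epsilon>"
  obtains A where "open A" "x0 \<in> A" "\<And>x y. x \<in> A \<Longrightarrow> y \<in> D \<Longrightarrow> dist (H x y) (H x0 y) < \<epsilon>"
proof -
  \<comment> \<open>\<open>?W\<close> is open and contains \<open>{x0} \<times> D\<close>; the tube
    lemma then gives one neighbourhood of \<open>x0\<close> for all of \<open>D\<close>, in place of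
    uniform continuity.\<close>
  let ?W = "{p. dist (H (fst p) (snd p)) (H x0 (snd p)) < \<epsilon>}"
  have "continuous_on UNIV (\<lambda>p. (x0, snd p) :: 'a \<times> 'c)"
    by (intro continuous_on_Pair continuous_on_const continuous_on_snd continuous_on_id)
  from continuous_on_compose2[OF H this]
  have "continuous_on UNIV (\<lambda>p::'a\<times>'c. H x0 (snd p))" by simp
  then have "open ?W" by (intro open_Collect_less continuous_on_dist H continuous_on_const)
  then have "openin (prod_topology euclidean euclidean) ?W" by simp
  moreover have "{x0} \<times> D \<subseteq> ?W" using \<open>0 < \<epsilon>\<close> by auto
  ultimately have "\<exists>U V. openin euclidean U \<and> openin euclidean V \<and> x0 \<in> U \<and> D \<subseteq> V \<and> U \<times> V \<subseteq> ?W"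
    using D by (intro tube_lemma_right) simp_all
  then obtain U V where UV: "open U" "x0 \<in> U" "D \<subseteq> V" "U \<times> V \<subseteq> ?W" by auto
  show ?thesis
  proof (rule that[OF UV(1,2)])
    fix x y assume "x \<in> U" "y \<in> D"
    then have "(x, y) \<in> ?W" using UV by blast
    then show "dist (H x y) (H x0 y) < \<epsilon>" by simp
  qed
qed
lemma continuous_on_sections:
  fixes H :: "'a::topological_space \<Rightarrow> 'c::topological_space \<Rightarrow> 'b::topological_space"
  assumes H: "continuous_on UNIV (\<lambda>p. H (fst p) (snd p))"
  shows "continuous_on UNIV (\<lambda>x. H x y)" "continuous_on UNIV (\<lambda>y. H x y)"
    "continuous_on UNIV (\<lambda>p. H (snd p) (fst p))"
proof -
  have "continuous_on UNIV (\<lambda>x. (x, y))" by (intro continuous_on_Pair continuous_on_const continuous_on_id)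
  from continuous_on_compose2[OF H this] show "continuous_on UNIV (\<lambda>x. H x y)" by simp
  have "continuous_on UNIV (\<lambda>y. (x, y))" by (intro continuous_on_Pair continuous_on_const continuous_on_id)
  from continuous_on_compose2[OF H this] show "continuous_on UNIV (\<lambda>y. H x y)" by simp
  have "continuous_on UNIV (\<lambda>p. (snd p, fst p) :: 'a \<times> 'c)"
    by (intro continuous_on_Pair continuous_on_snd continuous_on_fst continuous_on_id)
  from continuous_on_compose2[OF H this] show "continuous_on UNIV (\<lambda>p. H (snd p) (fst p))" by simp
qed

lemma continuous_on_UNIV_approx:
  fixes f :: "'a::topological_space \<Rightarrow> 'b::metric_space"
  assumes "\<And>x \<epsilon>. 0 < \<epsilon> \<Longrightarrow> \<exists>A. open A \<and> x \<in> A \<and> (\<forall>y\<in>A. dist (f y) (f x) < \<epsilon>)"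
  shows "continuous_on UNIV f"
  unfolding continuous_on_def tendsto_iff
proof (intro ballI allI impI)
  fix x :: 'a and \<epsilon> :: real assume "0 < \<epsilon>"
  from assms[OF this, of x] obtain A where "open A" "x \<in> A" "\<forall>y\<in>A. dist (f y) (f x) < \<epsilon>" by blast
  then show "\<forall>\<^sub>F y in at x. dist (f y) (f x) < \<epsilon>" unfolding eventually_at_topological by blast
qed

lemma continuous_on_integral:
  fixes H :: "'a::topological_space \<Rightarrow> 'c::t2_space \<Rightarrow> 'b::{banach, second_countable_topology}"
  assumes nu: "radon_prob \<nu>" and H: "continuous_on UNIV (\<lambda>p. H (fst p) (snd p))" and B: "\<And>x y. norm (H x y) \<le> B"
  shows "continuous_on UNIV (\<lambda>x. \<integral>y. H x y \<partial>\<nu>)"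
proof (rule continuous_on_UNIV_approx)
  fix x0 :: 'a and \<epsilon> :: real assume "0 < \<epsilon>"
  have B0: "0 \<le> B" using B[of undefined undefined] norm_ge_zero order_trans by blast
  \<comment> \<open>The tail off \<open>D\<close> costs \<open>2 * B * \<delta>\<close>, which is
    less than \<open>\<epsilon> / 2\<close>; \<open>B + 1\<close> covers the case
    \<open>B = 0\<close>.\<close>
  define \<delta> where "\<delta> = \<epsilon> / (4 * (B + 1))"
  have \<delta>: "0 < \<delta>" "2 * B * \<delta> < \<epsilon> / 2 + \<epsilon>/4" using \<open>0 < \<epsilon>\<close> B0 by (auto simp: \<delta>_def field_simps intro: add_pos_nonneg)
  obtain D where D: "compact D" "measure \<nu> (- D) < \<delta>" using radon_prob_tight[OF nu \<delta>(1)] .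
  obtain A where A: "open A" "x0 \<in> A" "\<And>x y. x \<in> A \<Longrightarrow> y \<in> D \<Longrightarrow> dist (H x y) (H x0 y) < \<epsilon> / 4"
    using continuous_uniform_on_compact[OF H D(1), of "\<epsilon>/4"] \<open>0 < \<epsilon>\<close> by auto
  have m: "(\<lambda>y. H x y) \<in> borel_measurable borel" for x
    using continuous_on_sections(2)[OF H] by (rule borel_measurable_continuous_onI)
  have "dist (\<integral>y. H x y \<partial>\<nu>) (\<integral>y. H x0 y \<partial>\<nu>) < \<epsilon>" if "x \<in> A" for x
  proof -
    have "norm ((\<integral>y. H x y \<partial>\<nu>) - (\<integral>y. H x0 y \<partial>\<nu>)) \<le> \<epsilon>/4 + 2 * B * \<delta>"
      using D A(3)[OF that] \<open>0 < \<epsilon>\<close> by (intro radon_prob_integral_close[OF nu m m B B D(1)]) (auto simp: dist_norm less_imp_le)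
    then show ?thesis using \<delta> by (simp add: dist_norm)
  qed
  with A show "\<exists>A. open A \<and> x0 \<in> A \<and> (\<forall>x\<in>A. dist (\<integral>y. H x y \<partial>\<nu>) (\<integral>y. H x0 y \<partial>\<nu>) < \<epsilon>)" by blast
qed

lemma compact_cover:
  assumes "compact C" "\<And>x. x \<in> C \<Longrightarrow> open (A x)" "\<And>x. x \<in> C \<Longrightarrow> x \<in> A x"
  obtains X where "X \<subseteq> C" "finite X" "C \<subseteq> (\<Union>x\<in>X. A x)"
proof -
  have c: "C \<subseteq> (\<Union>x\<in>C. A x)" using assms(3) by blast
  show ?thesis by (rule compactE_image[OF assms(1,2) c]) (assumption, rule that)
qed

text \<open>Without a countable base, local nullity does not add up over the whole space; on a
  compact set a finite subcover makes finite subadditivity sufficient.\<close>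

lemma emeasure_null_on_compact:
  assumes s: "sets \<mu> = sets borel" and C: "compact C" and N: "N \<in> sets borel"
    and U: "\<And>x. x \<in> C \<Longrightarrow> \<exists>U. open U \<and> x \<in> U \<and> emeasure \<mu> (N \<inter> U) = 0"
  shows "emeasure \<mu> (N \<inter> C) = 0"
proof -
  obtain U where U: "\<And>x. x \<in> C \<Longrightarrow> open (U x)" "\<And>x. x \<in> C \<Longrightarrow> x \<in> U x"
    "\<And>x. x \<in> C \<Longrightarrow> emeasure \<mu> (N \<inter> U x) = 0" using U by metis
  obtain X where X: "X \<subseteq> C" "finite X" "C \<subseteq> (\<Union>x\<in>X. U x)" using compact_cover[OF C U(1,2)] .
  have s': "N \<inter> U x \<in> sets \<mu>" if "x \<in> X" for x using N U(1) X(1) that by (auto simp: s)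
  have "emeasure \<mu> (N \<inter> C) \<le> emeasure \<mu> (\<Union>x\<in>X. N \<inter> U x)"
    using X s' by (intro emeasure_mono sets.finite_UN) auto
  also have "\<dots> \<le> (\<Sum>x\<in>X. emeasure \<mu> (N \<inter> U x))"
    using X s' by (intro emeasure_subadditive_finite) auto
  also have "\<dots> = 0" using U(3) X(1) by (intro sum.neutral) auto
  finally show ?thesis by simp
qed

text \<open>A Borel choice of the centre of a covering set that contains the given point. Replacing
  \<open>x\<close> by \<open>r x\<close> turns an integrand into one with finitely many sections,
  for which exchanging integrals is mere linearity.\<close>

lemma finite_range_selection:
  fixes A :: "'a \<Rightarrow> 'a::topological_space set"
  assumes "finite X" "\<And>x. x \<in> X \<Longrightarrow> open (A x)"
  obtains r where "r \<in> borel \<rightarrow>\<^sub>M count_space UNIV" "finite (range r)" "\<And>x. x \<in> (\<Union>z\<in>X. A z) \<Longrightarrow> x \<in> A (r x)"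
proof -
  have "\<exists>r. r \<in> borel \<rightarrow>\<^sub>M count_space UNIV \<and> finite (range r) \<and> (\<forall>x \<in> (\<Union>z\<in>X. A z). x \<in> A (r x))"
    using assms
  proof (induction X rule: finite_induct)
    case empty
    show ?case by (intro exI[of _ "\<lambda>_. undefined"]) auto
  next
    case (insert a X)
    then obtain r where r: "r \<in> borel \<rightarrow>\<^sub>M count_space UNIV" "finite (range r)" "\<forall>x \<in> (\<Union>z\<in>X. A z). x \<in> A (r x)"
      by auto
    have "{x \<in> space borel. x \<in> A a} \<in> sets borel" using insert by simp
    then have "(\<lambda>x. if x \<in> A a then a else r x) \<in> borel \<rightarrow>\<^sub>M count_space UNIV"
      using r(1) by (intro measurable_If) auto
    moreover have "range (\<lambda>x. if x \<in> A a then a else r x) \<subseteq> insert a (range r)" by auto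
    then have "finite (range (\<lambda>x. if x \<in> A a then a else r x))" using r(2) finite_subset by blast
    ultimately show ?case using r(3) by (intro exI[of _ "\<lambda>x. if x \<in> A a then a else r x"]) auto
  qed
  then show ?thesis using that by blast
qed

lemma integral_finite_range:
  fixes \<phi> :: "'a::t2_space \<Rightarrow> real" and \<mu> :: "'a measure"
  assumes mu: "radon_prob \<mu>" and r: "r \<in> borel \<rightarrow>\<^sub>M count_space UNIV" and fin: "finite (range r)"
  shows "(\<integral>x. \<phi> (r x) \<partial>\<mu>) = (\<Sum>z\<in>range r. \<phi> z * measure \<mu> (r -` {z}))"
proof -
  note D = radon_probD[OF mu]
  interpret prob_space \<mu> by (rule D)
  have s: "r -` {z} \<in> sets \<mu>" for z
    using measurable_sets[OF r, of "{z}"] D(4) by simp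
  have "(\<integral>x. \<phi> (r x) \<partial>\<mu>) = (\<integral>x. (\<Sum>z\<in>range r. \<phi> z * indicator (r -` {z}) x) \<partial>\<mu>)"
  proof (rule Bochner_Integration.integral_cong)
    fix x
    have "(\<Sum>z\<in>range r. \<phi> z * indicator (r -` {z}) x) = (\<Sum>z\<in>range r. if z = r x then \<phi> z else 0)"
      by (intro sum.cong) (auto simp: indicator_def)
    then show "\<phi> (r x) = (\<Sum>z\<in>range r. \<phi> z * indicator (r -` {z}) x)" using fin by simp
  qed simp
  also have "\<dots> = (\<Sum>z\<in>range r. \<phi> z * measure \<mu> (r -` {z}))"
    using s by (subst Bochner_Integration.integral_sum) (auto simp: emeasure_eq_measure)
  finally show ?thesis .
qed

text \<open>The Borel sets of the product may be larger than the product sigma-algebra, so the product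
  measure is avoided: on large compact sets the integrand is uniformly close to a function with
  finitely many distinct sections.\<close>
lemma radon_prob_Fubini:
  fixes H :: "'a::t2_space \<Rightarrow> 'c::t2_space \<Rightarrow> real"
  assumes mu: "radon_prob \<mu>" and nu: "radon_prob \<nu>"
    and H: "continuous_on UNIV (\<lambda>p. H (fst p) (snd p))" and B: "\<And>x y. \<bar>H x y\<bar> \<le> B"
  shows "(\<integral>x. (\<integral>y. H x y \<partial>\<nu>) \<partial>\<mu>) = (\<integral>y. (\<integral>x. H x y \<partial>\<mu>) \<partial>\<nu>)"
proof -
  let ?L = "\<integral>x. (\<integral>y. H x y \<partial>\<nu>) \<partial>\<mu>" and ?R = "\<integral>y. (\<integral>x. H x y \<partial>\<mu>) \<partial>\<nu>"
  have B0: "0 \<le> B" using B[of undefined undefined] by linarith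
  \<comment> \<open>Each iterated integral changes by at most
    \<open>(\<epsilon> + 2 * B * \<epsilon>) + 2 * B * \<epsilon>\<close> when \<open>x\<close> is
    replaced by \<open>r x\<close>: closeness on the compact sets plus one tail for each variable.
    Two such errors add up to the bound.\<close>
  have approx: "\<bar>?L - ?R\<bar> \<le> \<epsilon> * (2 + 8 * B)" if \<epsilon>: "0 < \<epsilon>" for \<epsilon>
  proof -
    obtain C where C: "compact C" "measure \<mu> (- C) < \<epsilon>" using radon_prob_tight[OF mu \<epsilon>] .
    obtain D where D: "compact D" "measure \<nu> (- D) < \<epsilon>" using radon_prob_tight[OF nu \<epsilon>] .
    have "\<exists>A. open A \<and> x0 \<in> A \<and> (\<forall>x\<in>A. \<forall>y\<in>D. dist (H x y) (H x0 y) < \<epsilon>)" for x0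
      using continuous_uniform_on_compact[OF H D(1) \<epsilon>, of x0] by metis
    then obtain A where A: "\<And>x0. open (A x0)" "\<And>x0. x0 \<in> A x0"
      "\<And>x0 x y. x \<in> A x0 \<Longrightarrow> y \<in> D \<Longrightarrow> dist (H x y) (H x0 y) < \<epsilon>" by metis
    obtain X where X: "X \<subseteq> C" "finite X" "C \<subseteq> (\<Union>x\<in>X. A x)" using compact_cover[OF C(1) A(1,2)] .
    obtain r where r: "r \<in> borel \<rightarrow>\<^sub>M count_space UNIV" "finite (range r)" "\<And>x. x \<in> (\<Union>z\<in>X. A z) \<Longrightarrow> x \<in> A (r x)"
      by (rule finite_range_selection[OF X(2), of A, OF A(1)]) blast
    have close: "norm (H x y - H (r x) y) \<le> \<epsilon>" if "x \<in> C" "y \<in> D" for x y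
    proof -
      have "x \<in> A (r x)" using r(3) X(3) that by blast
      then show ?thesis using A(3)[of x "r x" y] that by (simp add: dist_real_def)
    qed
    have mr: "(\<lambda>x. \<phi> (r x)) \<in> borel_measurable borel" for \<phi> :: "'a \<Rightarrow> real"
      by (rule measurable_compose[OF r(1)]) simp
    have mx: "(\<lambda>x. H x y) \<in> borel_measurable borel" for y
      using continuous_on_sections(1)[OF H] by (rule borel_measurable_continuous_onI)
    have my: "(\<lambda>y. H x y) \<in> borel_measurable borel" for x
      using continuous_on_sections(2)[OF H] by (rule borel_measurable_continuous_onI)
    have B': "norm (H x y) \<le> B" for x y using B by simp
    have mI: "(\<lambda>x. \<integral>y. H x y \<partial>\<nu>) \<in> borel_measurable borel"
      by (intro borel_measurable_continuous_onI continuous_on_integral[OF nu H B'])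
    have mJ: "(\<lambda>y. \<integral>x. H x y \<partial>\<mu>) \<in> borel_measurable borel"
      by (intro borel_measurable_continuous_onI continuous_on_integral[OF mu _ B'] continuous_on_sections(3)[OF H])
    have sum_eq: "(\<integral>x. H (r x) y \<partial>\<mu>) = (\<Sum>z\<in>range r. H z y * measure \<mu> (r -` {z}))" for y
      by (rule integral_finite_range[OF mu r(1,2)])
    have mJr: "(\<lambda>y. \<integral>x. H (r x) y \<partial>\<mu>) \<in> borel_measurable borel"
      unfolding sum_eq using my by (intro borel_measurable_sum borel_measurable_times) auto
    have iH: "integrable \<nu> (H z)" for z using my B' by (rule radon_prob_integrable[OF nu])
    have Gswap: "(\<integral>x. (\<integral>y. H (r x) y \<partial>\<nu>) \<partial>\<mu>) = (\<integral>y. (\<integral>x. H (r x) y \<partial>\<mu>) \<partial>\<nu>)"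
      unfolding sum_eq using iH integral_finite_range[OF mu r(1,2), of "\<lambda>z. \<integral>y. H z y \<partial>\<nu>"]
      by (subst Bochner_Integration.integral_sum) auto
    have bd1: "norm (\<integral>y. H x y \<partial>\<nu>) \<le> B" for x by (rule radon_prob_norm_integral_le[OF nu my B'])
    have bd2: "norm (\<integral>x. H x y \<partial>\<mu>) \<le> B" for y by (rule radon_prob_norm_integral_le[OF mu mx B'])
    have bd3: "norm (\<integral>x. H (r x) y \<partial>\<mu>) \<le> B" for y by (rule radon_prob_norm_integral_le[OF mu mr B'])
    have c1: "norm ((\<integral>y. H x y \<partial>\<nu>) - (\<integral>y. H (r x) y \<partial>\<nu>)) \<le> \<epsilon> + 2 * B * \<epsilon>" if "x \<in> C" for x
      using close[OF that] D \<open>0 < \<epsilon>\<close> by (intro radon_prob_integral_close[OF nu my my B' B' D(1)]) auto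
    have c2: "norm ((\<integral>x. H x y \<partial>\<mu>) - (\<integral>x. H (r x) y \<partial>\<mu>)) \<le> \<epsilon> + 2 * B * \<epsilon>" if "y \<in> D" for y
      using close[OF _ that] C \<open>0 < \<epsilon>\<close> by (intro radon_prob_integral_close[OF mu mx mr B' B' C(1)]) auto
    have "norm (?L - (\<integral>x. (\<integral>y. H (r x) y \<partial>\<nu>) \<partial>\<mu>)) \<le> (\<epsilon> + 2 * B * \<epsilon>) + 2 * B * \<epsilon>"
      using c1 C \<open>0 < \<epsilon>\<close> B0 by (intro radon_prob_integral_close[OF mu mI mr bd1 bd1 C(1)]) auto
    moreover have "norm (?R - (\<integral>y. (\<integral>x. H (r x) y \<partial>\<mu>) \<partial>\<nu>)) \<le> (\<epsilon> + 2 * B * \<epsilon>) + 2 * B * \<epsilon>"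
      using c2 D \<open>0 < \<epsilon>\<close> B0 by (intro radon_prob_integral_close[OF nu mJ mJr bd2 bd3 D(1)]) auto
    ultimately show ?thesis unfolding Gswap by (simp add: algebra_simps)
  qed
  have "\<bar>?L - ?R\<bar> \<le> 0"
  proof (rule field_le_epsilon)
    fix \<epsilon> :: real assume "0 < \<epsilon>"
    moreover have "0 < 2 + 8 * B" using B0 by linarith
    ultimately have "0 < \<epsilon> / (2 + 8 * B)" "\<epsilon> / (2 + 8 * B) * (2 + 8 * B) = \<epsilon>" by simp_all
    then show "\<bar>?L - ?R\<bar> \<le> 0 + \<epsilon>" using approx by (metis add_0)
  qed
  then show ?thesis by simp
qed

section \<open>Urysohn functions and uniqueness of Radon measures\<close>

lemma sigma_sets_open: "sets (borel :: 'a::topological_space measure) = sigma_sets UNIV {S. open S}"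
  by (simp add: borel_def)

lemma Int_stable_open: "Int_stable {S. open S}"
  by (auto simp: Int_stable_def)

lemma urysohn_family_integral_le:
  assumes mu: "finite_radon \<mu>" and U: "open U" and f: "f \<in> urysohn_family U"
  shows "(\<integral>x. f x \<partial>\<mu>) \<le> measure \<mu> U"
proof -
  interpret finite_measure \<mu> using mu by (simp add: finite_radon_def)
  have s: "sets \<mu> = sets borel" using mu by (simp add: finite_radon_def)
  have fb: "f \<in> Cc" "\<And>x. 0 \<le> f x" "\<And>x. f x \<le> 1" "\<And>x. x \<notin> U \<Longrightarrow> f x = 0"
    using f by (auto simp: urysohn_family_def)
  have "integrable \<mu> f" using fb by (intro integrable_bounded[OF finite_measure_axioms s, where B=1] Cc_measurable) auto
  then have "(\<integral>x. f x \<partial>\<mu>) \<le> (\<integral>x. indicator U x \<partial>\<mu>)"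
    using fb U s by (intro integral_mono integrable_real_indicator) (auto simp: indicator_def emeasure_eq_measure)
  then show ?thesis using U s by simp
qed

text \<open>The parameter only carries the type, which is assumed to be locally compact.\<close>
locale locally_compact_type =
  fixes T :: "'a::t2_space itself"
  assumes lc: "locally_compact_space (euclidean :: 'a topology)"
begin

lemma Hausdorff_euclidean: "Hausdorff_space (euclidean :: 'a topology)"
  unfolding Hausdorff_space_def using hausdorff by (fastforce simp: disjnt_def)

lemma compact_neighbourhood:
  assumes "open U" "x \<in> (U :: 'a set)"
  obtains O' D where "open O'" "compact D" "x \<in> O'" "O' \<subseteq> D" "D \<subseteq> U"
proof -
  have "neighbourhood_base_of (compactin euclidean) (euclidean :: 'a topology)"
    using lc locally_compact_space_neighbourhood_base[of "euclidean :: 'a topology"] Hausdorff_euclidean by simp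
  then have "\<exists>O' D. open O' \<and> compact D \<and> x \<in> O' \<and> O' \<subseteq> D \<and> D \<subseteq> U"
    unfolding neighbourhood_base_of using assms by simp
  then show ?thesis using that by blast
qed

text \<open>Complete regularity alone does not control the support. A finite union of compact
  neighbourhoods inside \<open>U\<close> is inserted between \<open>C\<close> and \<open>U\<close>,
  and the function is made to vanish off its open part.\<close>

lemma urysohn_Cc:
  assumes C: "compact C" and U: "open U" and "C \<subseteq> (U :: 'a set)"
  obtains f where "f \<in> urysohn_family U" "\<And>x. x \<in> C \<Longrightarrow> f x = 1"
proof -
  have "\<exists>O' D. open O' \<and> compact D \<and> x \<in> O' \<and> O' \<subseteq> D \<and> D \<subseteq> U" if "x \<in> C" for x
    using compact_neighbourhood[OF U] that \<open>C \<subseteq> U\<close> by (metis subsetD)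
  then obtain W D where WD: "\<And>x. x \<in> C \<Longrightarrow> open (W x) \<and> compact (D x) \<and> x \<in> W x \<and> W x \<subseteq> D x \<and> D x \<subseteq> U"
    by metis
  obtain X where X: "X \<subseteq> C" "finite X" "C \<subseteq> (\<Union>x\<in>X. W x)" using compact_cover[OF C, of W] WD by blast
  let ?W = "\<Union>x\<in>X. W x" and ?D = "\<Union>x\<in>X. D x"
  have W: "open ?W" "?W \<subseteq> ?D" "?D \<subseteq> U" and D: "compact ?D" using X WD by (auto intro!: compact_UN) blast+
  have "completely_regular_space (euclidean :: 'a topology)"
    using lc by (intro locally_compact_regular_imp_completely_regular_space locally_compact_Hausdorff_imp_regular_space disjI2 Hausdorff_euclidean)
  then obtain f where f: "continuous_map euclidean (subtopology euclidean {0..1::real}) f" "f ` (- ?W) \<subseteq> {0}" "f ` C \<subseteq> {1}"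
  proof (rule Urysohn_completely_regular_compact_closed[of 0 1 "euclidean :: 'a topology" C "- ?W", rotated])
    show "compactin euclidean C" "disjnt C (- ?W)" using C X(3) by (auto simp: disjnt_def)
    show "closedin euclidean (- ?W)" using W(1) closed_closedin by (metis closed_Compl)
  qed auto
  have c: "continuous_on UNIV f" and r: "\<And>x. 0 \<le> f x \<and> f x \<le> 1"
    using f(1) by (auto simp: continuous_map_in_subtopology)
  have z: "\<And>x. x \<notin> ?D \<Longrightarrow> f x = 0" using f(2) W(2) by blast
  have "f \<in> urysohn_family U"
    unfolding urysohn_family_def Cc_def using c r z D W(3) by blast
  then show ?thesis using that f(3) by blast
qed

text \<open>This says that \<open>measure \<mu> U\<close> is the supremum of the integrals over the
  family. The form with a strict bound \<open>r\<close> yields lower semicontinuity of kernels and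
  uniqueness of measures directly.\<close>

lemma less_measure_urysohn_family:
  fixes \<mu> :: "'a measure"
  assumes mu: "finite_radon \<mu>" and U: "open U"
  shows "r < measure \<mu> U \<longleftrightarrow> (\<exists>f\<in>urysohn_family U. r < (\<integral>x. f x \<partial>\<mu>))"
proof
  assume "r < measure \<mu> U"
  then obtain C where C: "compact C" "C \<subseteq> U" "r < measure \<mu> C"
    using mu U unfolding finite_radon_def by blast
  obtain f where f: "f \<in> urysohn_family U" "\<And>x. x \<in> C \<Longrightarrow> f x = 1" using urysohn_Cc[OF C(1) U C(2)] by blast
  interpret finite_measure \<mu> using mu by (simp add: finite_radon_def)
  have s: "sets \<mu> = sets borel" using mu by (simp add: finite_radon_def)
  have fb: "f \<in> Cc" "\<And>x. 0 \<le> f x" "\<And>x. f x \<le> 1" using f by (auto simp: urysohn_family_def)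
  have "integrable \<mu> f" using fb by (intro integrable_bounded[OF finite_measure_axioms s, where B=1] Cc_measurable) auto
  then have "(\<integral>x. indicator C x \<partial>\<mu>) \<le> (\<integral>x. f x \<partial>\<mu>)"
    using fb f C(1) s by (intro integral_mono integrable_real_indicator)
      (auto simp: indicator_def borel_compact emeasure_eq_measure)
  then have "measure \<mu> C \<le> (\<integral>x. f x \<partial>\<mu>)" using C(1) s by (simp add: borel_compact)
  with f C(3) show "\<exists>f\<in>urysohn_family U. r < (\<integral>x. f x \<partial>\<mu>)" by force
next
  assume "\<exists>f\<in>urysohn_family U. r < (\<integral>x. f x \<partial>\<mu>)"
  then show "r < measure \<mu> U" using urysohn_family_integral_le[OF mu U] by force
qed

text \<open>Uniqueness in the Riesz representation: the values on open sets are suprema of test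
  integrals, and open sets are a generator stable under intersection. Nonnegative test functions are
  what can later be normalised to densities.\<close>

lemma finite_radon_eqI:
  fixes \<mu> \<nu> :: "'a measure"
  assumes mu: "finite_radon \<mu>" and nu: "finite_radon \<nu>"
    and eq: "\<And>f. f \<in> Cc \<Longrightarrow> (\<And>x. 0 \<le> f x) \<Longrightarrow> (\<integral>x. f x \<partial>\<mu>) = (\<integral>x. f x \<partial>\<nu>)"
  shows "\<mu> = \<nu>"
proof -
  interpret m: finite_measure \<mu> using mu by (simp add: finite_radon_def)
  interpret n: finite_measure \<nu> using nu by (simp add: finite_radon_def)
  have "measure \<mu> U = measure \<nu> U" if U: "open U" for U
  proof -
    have "r < measure \<mu> U \<longleftrightarrow> r < measure \<nu> U" for r
      unfolding less_measure_urysohn_family[OF mu U] less_measure_urysohn_family[OF nu U]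
      using eq by (auto simp: urysohn_family_def)
    then show ?thesis by (metis less_irrefl linorder_neqE)
  qed
  then show ?thesis using mu nu
    by (intro measure_eqI_generator_eq[OF Int_stable_open, of UNIV _ _ "\<lambda>_. UNIV"])
      (auto simp: finite_radon_def sigma_sets_open m.emeasure_eq_measure n.emeasure_eq_measure)
qed

lemma radon_prob_eqI:
  fixes \<mu> \<nu> :: "'a measure"
  assumes "radon_prob \<mu>" "radon_prob \<nu>"
    and "\<And>f. f \<in> Cc \<Longrightarrow> (\<And>x. 0 \<le> f x) \<Longrightarrow> (\<integral>x. f x \<partial>\<mu>) = (\<integral>x. f x \<partial>\<nu>)"
  shows "\<mu> = \<nu>"
  using assms by (intro finite_radon_eqI) (auto simp: radon_prob_def)

lemma radon_kernel_lsc: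
  fixes \<kappa> :: "'b::topological_space \<Rightarrow> 'a measure"
  assumes k: "radon_kernel \<kappa>" and U: "open U"
  shows "open {x. r < measure (\<kappa> x) U}"
proof -
  have "{x. r < measure (\<kappa> x) U} = (\<Union>f\<in>urysohn_family U. {x. r < (\<integral>w. f w \<partial>\<kappa> x)})"
    using less_measure_urysohn_family[OF _ U] k by (auto simp: radon_kernel_def radon_prob_def)
  moreover have "open {x. r < (\<integral>w. f w \<partial>\<kappa> x)}" if "f \<in> urysohn_family U" for f
    using k that by (intro open_Collect_less continuous_on_const) (auto simp: radon_kernel_def urysohn_family_def)
  ultimately show ?thesis by auto
qed

lemma radon_kernel_measurable:
  fixes \<kappa> :: "'b::topological_space \<Rightarrow> 'a measure"
  assumes k: "radon_kernel \<kappa>"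
  shows "\<kappa> \<in> borel \<rightarrow>\<^sub>M subprob_algebra borel"
proof -
  have rp: "radon_prob (\<kappa> x)" for x using k by (simp add: radon_kernel_def)
  have *: "(\<lambda>x. emeasure (\<kappa> x) U) \<in> borel_measurable borel" if U: "open U" for U
  proof -
    have "(\<lambda>x. measure (\<kappa> x) U) \<in> borel_measurable borel"
      unfolding borel_measurable_iff_greater using radon_kernel_lsc[OF k U] by simp
    then have "(\<lambda>x. ennreal (measure (\<kappa> x) U)) \<in> borel_measurable borel" by simp
    then show ?thesis using rp by (simp add: finite_measure.emeasure_eq_measure radon_probD)
  qed
  show ?thesis
    using rp * by (intro measurable_subprob_algebra_generated[OF sigma_sets_open Int_stable_open])
      (auto simp: radon_probD prob_space_imp_subprob_space)
qed

end

section \<open>Mixtures of kernels\<close>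

lemma integral_bind_real:
  fixes f :: "'a::t2_space \<Rightarrow> real" and \<mu> :: "'b::t2_space measure"
  assumes mu: "radon_prob \<mu>" and k: "\<kappa> \<in> borel \<rightarrow>\<^sub>M subprob_algebra borel"
    and f: "f \<in> borel_measurable borel" and B: "\<And>x. \<bar>f x\<bar> \<le> B"
  shows "(\<integral>w. f w \<partial>(\<mu> \<bind> \<kappa>)) = (\<integral>x. (\<integral>w. f w \<partial>\<kappa> x) \<partial>\<mu>)"
proof -
  note D = radon_probD[OF mu]
  have k': "\<kappa> \<in> \<mu> \<rightarrow>\<^sub>M subprob_algebra borel" using k D(4) by (simp cong: measurable_cong_sets)
  have b: "\<mu> \<bind> \<kappa> = join (distr \<mu> (subprob_algebra borel) \<kappa>)"
    by (rule bind_nonempty''[OF k']) (simp add: D)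
  have "AE M' in distr \<mu> (subprob_algebra borel) \<kappa>. emeasure M' (space M') \<le> ennreal 1"
    by (rule AE_I2) (auto simp: space_subprob_algebra intro: subprob_space.emeasure_space_le_1)
  moreover have "finite_measure (distr \<mu> (subprob_algebra borel) \<kappa>)"
    by (rule finite_measure.finite_measure_distr[OF D(3) k'])
  ultimately have "(\<integral>w. f w \<partial>(\<mu> \<bind> \<kappa>)) = (\<integral>M'. (\<integral>w. f w \<partial>M') \<partial>distr \<mu> (subprob_algebra borel) \<kappa>)"
    unfolding b using f B by (intro integral_join[where N=borel and B=B and B'=1]) auto
  also have "\<dots> = (\<integral>x. (\<integral>w. f w \<partial>\<kappa> x) \<partial>\<mu>)"
    using f by (intro integral_distr k' integral_measurable_subprob_algebra)
  finally show ?thesis .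
qed

lemma kernel_integral_measurable:
  fixes f :: "'a::t2_space \<Rightarrow> 'c::{banach, second_countable_topology}"
  assumes "\<kappa> \<in> borel \<rightarrow>\<^sub>M subprob_algebra borel" "f \<in> borel_measurable borel"
  shows "(\<lambda>x. \<integral>w. f w \<partial>\<kappa> x) \<in> borel_measurable borel"
  using measurable_compose[OF assms(1) integral_measurable_subprob_algebra[OF assms(2)]] .

text \<open>A number is recovered up to an error of one from the number of integer levels strictly
  below it, which is \<open>\<lceil>t\<rceil> - 1\<close> for positive \<open>t\<close>. This is the
  counting behind the layer-cake sum; strictness keeps the level sets open.\<close>

lemma card_less_bounds:
  assumes "0 \<le> t" "t \<le> real n"
  shows "t - 1 \<le> real (card {j\<in>{1..n}. real j < t})" "real (card {j\<in>{1..n}. real j < t}) \<le> t"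
proof -
  have eq: "{j\<in>{1..n}. real j < t} = {1..<nat \<lceil>t\<rceil>}"
    using assms by (auto simp: less_ceiling_iff zless_nat_eq_int_zless)
  have "t \<le> real (nat \<lceil>t\<rceil>)" "real (nat \<lceil>t\<rceil>) < t + 1" using assms by linarith+
  then show "t - 1 \<le> real (card {j\<in>{1..n}. real j < t})" "real (card {j\<in>{1..n}. real j < t}) \<le> t"
    unfolding eq using assms by (auto simp: nat_less_real_le of_nat_diff_real max_def)
qed

context locally_compact_type begin

lemma radon_kernelD:
  fixes \<kappa> :: "'b::topological_space \<Rightarrow> 'a measure"
  assumes "radon_kernel \<kappa>"
  shows "radon_prob (\<kappa> x)" "f \<in> Cc \<Longrightarrow> continuous_on UNIV (\<lambda>x. \<integral>w. f w \<partial>\<kappa> x)"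
  using assms by (auto simp: radon_kernel_def)

lemma integral_bind:
  fixes f :: "'a \<Rightarrow> complex" and \<mu> :: "'b::t2_space measure"
  assumes mu: "radon_prob \<mu>" and k: "radon_kernel \<kappa>"
    and f: "f \<in> borel_measurable borel" and B: "\<And>x. norm (f x) \<le> B"
  shows "(\<integral>w. f w \<partial>(\<mu> \<bind> \<kappa>)) = (\<integral>x. (\<integral>w. f w \<partial>\<kappa> x) \<partial>\<mu>)"
proof -
  note D = radon_probD[OF mu]
  have km: "\<kappa> \<in> borel \<rightarrow>\<^sub>M subprob_algebra borel" using k by (rule radon_kernel_measurable)
  have k': "\<kappa> \<in> \<mu> \<rightarrow>\<^sub>M subprob_algebra borel" using km D(4) by (simp cong: measurable_cong_sets)
  have "prob_space (\<mu> \<bind> \<kappa>)"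
    using radon_kernelD(1)[OF k] by (intro prob_space.prob_space_bind[OF D(1) _ k']) (auto simp: radon_probD)
  then have i1: "integrable (\<mu> \<bind> \<kappa>) f"
    using D f B by (intro integrable_bounded[where B=B])
      (auto simp: sets_bind_measurable[OF k'] intro: prob_space.finite_measure)
  have i2: "integrable (\<kappa> x) f" for x by (rule radon_prob_integrable[OF radon_kernelD(1)[OF k] f B])
  have i3: "integrable \<mu> (\<lambda>x. \<integral>w. f w \<partial>\<kappa> x)"
    by (rule radon_prob_integrable[OF mu kernel_integral_measurable[OF km f]
          radon_prob_norm_integral_le[OF radon_kernelD(1)[OF k] f B]])
  have m: "(\<lambda>w. Re (f w)) \<in> borel_measurable borel" "(\<lambda>w. Im (f w)) \<in> borel_measurable borel"
    using f by measurable
  have "\<bar>Re (f w)\<bar> \<le> B" "\<bar>Im (f w)\<bar> \<le> B" for w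
    using B[of w] abs_Re_le_cmod[of "f w"] abs_Im_le_cmod[of "f w"] by linarith+
  note e = integral_bind_real[OF mu km m(1) this(1)] integral_bind_real[OF mu km m(2) this(2)]
  show ?thesis
    using e i1 i2 i3 by (simp add: complex_eq_iff flip: integral_Re integral_Im)
qed

lemma integral_bind_Cc:
  fixes f :: "'a \<Rightarrow> real" and \<mu> :: "'b::t2_space measure"
  assumes mu: "radon_prob \<mu>" and k: "radon_kernel \<kappa>" and f: "f \<in> Cc"
  shows "(\<integral>w. f w \<partial>(\<mu> \<bind> \<kappa>)) = (\<integral>x. (\<integral>w. f w \<partial>\<kappa> x) \<partial>\<mu>)"
proof -
  obtain B where "\<And>x. \<bar>f x\<bar> \<le> B" using Cc_bounded[OF f] by blast
  then show ?thesis by (rule integral_bind_real[OF mu radon_kernel_measurable[OF k] Cc_measurable[OF f]])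
qed

lemma urysohn_family_finite_upper:
  assumes "finite F" "F \<subseteq> urysohn_family (U :: 'a set)"
  obtains g where "g \<in> urysohn_family U" "\<And>f x. f \<in> F \<Longrightarrow> f x \<le> g x"
proof -
  have "\<exists>g\<in>urysohn_family U. \<forall>f\<in>F. \<forall>x. f x \<le> g x"
    using assms
  proof (induction F rule: finite_induct)
    case empty
    then show ?case using zero_in_urysohn_family by blast
  next
    case (insert h F)
    then obtain g where "g \<in> urysohn_family U" "\<forall>f\<in>F. \<forall>x. f x \<le> g x" by auto
    then show ?case using insert urysohn_family_max[of h U g]
      by (intro bexI[of _ "\<lambda>x. max (h x) (g x)"]) (auto simp: le_max_iff_disj)
  qed
  then show ?thesis using that by blast
qed

text \<open>Layer cake: the measure of an open set under the kernel is a directed supremum of continuous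
  functions, and directed suprema commute with Radon integrals.\<close>
lemma bind_inner_regular:
  fixes \<mu> :: "'b::t2_space measure" and \<kappa> :: "'b \<Rightarrow> 'a measure"
  assumes mu: "radon_prob \<mu>" and k: "radon_kernel \<kappa>" and U: "open U"
    and r: "r < (\<integral>x. measure (\<kappa> x) U \<partial>\<mu>)"
  shows "\<exists>g\<in>urysohn_family U. r < (\<integral>x. (\<integral>w. g w \<partial>\<kappa> x) \<partial>\<mu>)"
proof -
  note D = radon_probD[OF mu]
  interpret prob_space \<mu> by (rule D)
  note kD = radon_probD[OF radon_kernelD(1)[OF k]]
  define h where "h x = measure (\<kappa> x) U" for x
  have h01: "0 \<le> h x" "h x \<le> 1" for x using prob_space.prob_le_1[OF kD(1)] by (auto simp: h_def)
  \<comment> \<open>Half of the gap: one share pays for the rounding error \<open>1 / n\<close>, the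
    other for passing from the level sets \<open>V j\<close> to compact subsets
    \<open>C j\<close>.\<close>
  define \<delta> where "\<delta> = ((\<integral>x. h x \<partial>\<mu>) - r) / 2"
  have \<delta>: "0 < \<delta>" using r by (simp add: \<delta>_def h_def)
  obtain n :: nat where n: "inverse (real n) < \<delta>" "0 < n"
    using reals_Archimedean[OF \<delta>] by (metis zero_less_Suc)
  define V where "V j = {x. real j < real n * h x}" for j
  have V: "open (V j)" for j
  proof -
    have "V j = {x. real j / real n < measure (\<kappa> x) U}" using n(2) by (auto simp: V_def h_def field_simps)
    then show ?thesis using radon_kernel_lsc[OF k U] by simp
  qed
  have Vs: "V j \<in> events" for j using V D(4) by simp
  have "\<exists>C. compact C \<and> C \<subseteq> V j \<and> measure \<mu> (V j) - \<delta> < measure \<mu> C" for j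
    using D(2) V[of j] \<delta> unfolding finite_radon_def by (metis diff_less_eq less_add_same_cancel1)
  then obtain C where C: "\<And>j. compact (C j)" "\<And>j. C j \<subseteq> V j" "\<And>j. measure \<mu> (V j) - \<delta> < measure \<mu> (C j)"
    by metis
  have Cs: "C j \<in> events" for j using C(1) D(4) by (simp add: borel_compact)
  have "\<exists>F. finite F \<and> F \<subseteq> urysohn_family U \<and> (\<forall>x\<in>C j. \<exists>f\<in>F. real j < real n * (\<integral>w. f w \<partial>\<kappa> x))" for j
  proof -
    let ?O = "\<lambda>f. {x. real j < real n * (\<integral>w. f w \<partial>\<kappa> x)}"
    have "\<And>f. f \<in> urysohn_family U \<Longrightarrow> open (?O f)"
      using k by (intro open_Collect_less continuous_on_mult continuous_on_const) (auto simp: radon_kernel_def urysohn_family_def)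
    moreover have "C j \<subseteq> (\<Union>f\<in>urysohn_family U. ?O f)"
    proof
      fix x assume "x \<in> C j"
      then have "real j / real n < measure (\<kappa> x) U" using C(2) n(2) by (auto simp: V_def h_def field_simps)
      then obtain f where "f \<in> urysohn_family U" "real j / real n < (\<integral>w. f w \<partial>\<kappa> x)"
        using less_measure_urysohn_family[OF kD(2) U] by blast
      then show "x \<in> (\<Union>f\<in>urysohn_family U. ?O f)" using n(2) by (auto simp: field_simps)
    qed
    ultimately obtain G where "G \<subseteq> urysohn_family U" "finite G" "C j \<subseteq> (\<Union>f\<in>G. ?O f)"
      by (rule compactE_image[OF C(1)])
    then show ?thesis by (intro exI[of _ G] conjI ballI) auto
  qed
  then obtain F where F: "\<And>j. finite (F j)" "\<And>j. F j \<subseteq> urysohn_family U"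
    "\<And>j x. x \<in> C j \<Longrightarrow> \<exists>f\<in>F j. real j < real n * (\<integral>w. f w \<partial>\<kappa> x)" by metis
  \<comment> \<open>One member of the family that dominates the finitely many functions chosen at
    all levels; its kernel integral exceeds level \<open>j\<close> on the whole of
    \<open>C j\<close>.\<close>
  obtain g where g: "g \<in> urysohn_family U" "\<And>f x. f \<in> (\<Union>j\<in>{1..n}. F j) \<Longrightarrow> f x \<le> g x"
    using urysohn_family_finite_upper[of "\<Union>j\<in>{1..n}. F j" U] F(1,2) by blast
  define \<phi> where "\<phi> x = (\<integral>w. g w \<partial>\<kappa> x)" for x
  have int: "integrable (\<kappa> x) f" if "f \<in> urysohn_family U" for f x
    using that by (intro radon_prob_integrable[OF radon_kernelD(1)[OF k], where B=1] Cc_measurable) (auto simp: urysohn_family_def)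
  have phi_le_h: "\<phi> x \<le> h x" for x unfolding \<phi>_def h_def by (rule urysohn_family_integral_le[OF kD(2) U g(1)])
  have phi0: "0 \<le> \<phi> x" for x using g(1) unfolding \<phi>_def by (intro Bochner_Integration.integral_nonneg) (auto simp: urysohn_family_def)
  have C_phi: "real j < real n * \<phi> x" if xj: "x \<in> C j" "j \<in> {1..n}" for x j
  proof -
    obtain f where f: "f \<in> F j" "real j < real n * (\<integral>w. f w \<partial>\<kappa> x)" using F(3)[OF xj(1)] by blast
    have "f \<in> (\<Union>j\<in>{1..n}. F j)" using f(1) xj(2) by (rule UN_I[rotated])
    note fg = g(2)[OF this]
    have "(\<integral>w. f w \<partial>\<kappa> x) \<le> \<phi> x" unfolding \<phi>_def
      using f(1) F(2) g(1) fg by (intro integral_mono int) auto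
    then show ?thesis using f(2) n(2) by (smt (verit) mult_left_mono of_nat_0_le_iff)
  qed
  have mh: "h \<in> borel_measurable borel"
    unfolding h_def borel_measurable_iff_greater using radon_kernel_lsc[OF k U] by simp
  have mphi: "\<phi> \<in> borel_measurable borel"
    unfolding \<phi>_def using g(1) by (intro kernel_integral_measurable[OF radon_kernel_measurable[OF k]] Cc_measurable) (auto simp: urysohn_family_def)
  have ih: "integrable \<mu> h" using mh h01 by (intro radon_prob_integrable[OF mu, where B=1]) auto
  have phi1: "\<phi> x \<le> 1" for x using phi_le_h[of x] h01(2)[of x] by linarith
  have iphi: "integrable \<mu> \<phi>" using mphi phi0 phi1
    by (intro radon_prob_integrable[OF mu, where B=1]) auto
  have ind: "integrable \<mu> (indicat_real A)" if "A \<in> events" for A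
    using that by (intro integrable_real_indicator) (auto simp: emeasure_eq_measure)
  have count: "(\<Sum>j\<in>{1..n}. indicat_real {x. P j x} x) = real (card {j\<in>{1..n}. P j x})" for P and x :: 'b
    by (simp add: indicator_def of_bool_def sum.If_cases Int_def)
  \<comment> \<open>The levels of \<open>n * h\<close> are counted with the upper estimate and those
    of \<open>n * \<phi>\<close> with the lower one, so rounding costs 1 in total, that is
    \<open>1 / n\<close> after division.\<close>
  have "real n * (\<integral>x. h x \<partial>\<mu>) \<le> (\<integral>x. 1 + (\<Sum>j\<in>{1..n}. indicator (V j) x) \<partial>\<mu>)"
    unfolding integral_mult_right_zero[symmetric]
  proof (rule integral_mono)
    fix x
    show "real n * h x \<le> 1 + (\<Sum>j\<in>{1..n}. indicator (V j) x)"
      using card_less_bounds(1)[of "real n * h x" n] h01[of x] n(2) unfolding V_def count by (simp add: mult_left_le)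
  qed (use ih ind Vs in \<open>auto intro!: Bochner_Integration.integrable_add Bochner_Integration.integrable_sum\<close>)
  also have "\<dots> = 1 + (\<Sum>j\<in>{1..n}. measure \<mu> (V j))"
    using Vs ind by (subst Bochner_Integration.integral_add)
      (auto intro!: Bochner_Integration.integrable_sum simp: Bochner_Integration.integral_sum prob_space)
  also have "\<dots> \<le> 1 + (\<Sum>j\<in>{1..n}. measure \<mu> (C j) + \<delta>)"
    using C(3) by (intro add_mono sum_mono) (auto simp: less_imp_le diff_less_eq)
  also have "\<dots> = 1 + n * \<delta> + (\<integral>x. (\<Sum>j\<in>{1..n}. indicator (C j) x) \<partial>\<mu>)"
    using Cs ind by (simp add: Bochner_Integration.integral_sum sum.distrib)
  also have "\<dots> \<le> 1 + n * \<delta> + (\<integral>x. real n * \<phi> x \<partial>\<mu>)"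
  proof (rule add_left_mono, rule integral_mono)
    fix x
    have "(\<Sum>j\<in>{1..n}. indicator (C j) x) \<le> (\<Sum>j\<in>{1..n}. indicat_real {x. real j < real n * \<phi> x} x)"
      using C_phi by (intro sum_mono) (auto simp: indicator_def)
    also have "\<dots> \<le> real n * \<phi> x"
      using card_less_bounds(2)[of "real n * \<phi> x" n] phi0[of x] phi_le_h[of x] h01[of x] n(2) unfolding count
      by (simp add: mult_left_le)
    finally show "(\<Sum>j\<in>{1..n}. indicator (C j) x) \<le> real n * \<phi> x" .
  qed (use iphi ind Cs in \<open>auto intro!: Bochner_Integration.integrable_sum\<close>)
  finally have "real n * (\<integral>x. h x \<partial>\<mu>) \<le> 1 + n * \<delta> + real n * (\<integral>x. \<phi> x \<partial>\<mu>)" by simp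
  then have "(\<integral>x. h x \<partial>\<mu>) \<le> inverse (real n) + \<delta> + (\<integral>x. \<phi> x \<partial>\<mu>)"
    using n(2) by (simp add: field_simps)
  then have "r < (\<integral>x. \<phi> x \<partial>\<mu>)" using n(1) by (simp add: \<delta>_def field_simps)
  then show ?thesis using g(1) unfolding \<phi>_def by blast
qed

lemma radon_prob_bind:
  fixes \<mu> :: "'b::t2_space measure" and \<kappa> :: "'b \<Rightarrow> 'a measure"
  assumes mu: "radon_prob \<mu>" and k: "radon_kernel \<kappa>"
  shows "radon_prob (\<mu> \<bind> \<kappa>)"
proof -
  note D = radon_probD[OF mu]
  note kD = radon_probD[OF radon_kernelD(1)[OF k]]
  have km: "\<kappa> \<in> borel \<rightarrow>\<^sub>M subprob_algebra borel" using k by (rule radon_kernel_measurable)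
  have k': "\<kappa> \<in> \<mu> \<rightarrow>\<^sub>M subprob_algebra borel" using km D(4) by (simp cong: measurable_cong_sets)
  have ps: "prob_space (\<mu> \<bind> \<kappa>)"
    using kD by (intro prob_space.prob_space_bind[OF D(1) _ k']) auto
  have s: "sets (\<mu> \<bind> \<kappa>) = sets borel" using D(5) by (simp add: sets_bind_measurable[OF k'])
  interpret prob_space "\<mu> \<bind> \<kappa>" by (rule ps)
  have "\<exists>C. compact C \<and> C \<subseteq> U \<and> r < prob C" if U: "open U" and r: "r < prob U" for U r
  proof -
    have "prob U = (\<integral>x. (\<integral>w. indicator U w \<partial>\<kappa> x) \<partial>\<mu>)"
      using integral_bind_real[OF mu km, of "indicator U" 1] U s by simp
    also have "\<dots> = (\<integral>x. measure (\<kappa> x) U \<partial>\<mu>)" using U kD by simp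
    finally obtain g where g: "g \<in> urysohn_family U" "r < (\<integral>x. (\<integral>w. g w \<partial>\<kappa> x) \<partial>\<mu>)"
      using bind_inner_regular[OF mu k U] r by auto
    then have r': "r < (\<integral>w. g w \<partial>(\<mu> \<bind> \<kappa>))"
      using integral_bind_Cc[OF mu k, of g] by (simp add: urysohn_family_def)
    \<comment> \<open>The compact set built into \<open>urysohn_family\<close> turns a large
      integral of \<open>g\<close> into large mass on a compact subset of \<open>U\<close>.\<close>
    obtain C where C: "compact C" "C \<subseteq> U" "\<And>x. x \<notin> C \<Longrightarrow> g x = 0" and g': "g \<in> Cc" "\<And>x. 0 \<le> g x" "\<And>x. g x \<le> 1"
      using g(1) by (auto simp: urysohn_family_def)
    have "(\<integral>w. g w \<partial>(\<mu> \<bind> \<kappa>)) \<le> (\<integral>w. indicator C w \<partial>(\<mu> \<bind> \<kappa>))"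
      using g' C s by (intro integral_mono integrable_real_indicator integrable_bounded[OF finite_measure_axioms s Cc_measurable, where B=1])
        (auto simp: indicator_def emeasure_eq_measure borel_compact)
    then have "r < prob C" using r' C(1) s by (simp add: borel_compact)
    then show ?thesis using C by blast
  qed
  then show ?thesis using ps s finite_measure_axioms by (auto simp: radon_prob_def finite_radon_def)
qed

lemma radon_kernel_comp:
  fixes \<kappa> :: "'b::topological_space \<Rightarrow> 'a measure" and h :: "'c::topological_space \<Rightarrow> 'b"
  assumes k: "radon_kernel \<kappa>" and h: "continuous_on UNIV h"
  shows "radon_kernel (\<lambda>x. \<kappa> (h x))"
  using k continuous_on_compose2[OF _ h] by (auto simp: radon_kernel_def)

lemma radon_kernel_sections:
  fixes c :: "'b::topological_space \<Rightarrow> 'c::topological_space \<Rightarrow> 'a measure"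
  assumes "radon_kernel (\<lambda>p. c (fst p) (snd p))"
  shows "radon_kernel (c x)" "radon_kernel (\<lambda>x. c x y)" "radon_kernel (\<lambda>p. c (snd p) (fst p))"
proof -
  have "continuous_on UNIV (\<lambda>y. (x, y) :: 'b \<times> 'c)" "continuous_on UNIV (\<lambda>x. (x, y) :: 'b \<times> 'c)"
    "continuous_on UNIV (\<lambda>p. (snd p, fst p) :: 'b \<times> 'c)"
    by (intro continuous_on_Pair continuous_on_const continuous_on_id continuous_on_fst continuous_on_snd)+
  note this[THEN radon_kernel_comp[OF assms]]
  then show "radon_kernel (c x)" "radon_kernel (\<lambda>x. c x y)" "radon_kernel (\<lambda>p. c (snd p) (fst p))"
    by simp_all
qed

lemma radon_kernel_bind:
  fixes c :: "'b::topological_space \<Rightarrow> 'c::t2_space \<Rightarrow> 'a measure"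
  assumes c: "radon_kernel (\<lambda>p. c (fst p) (snd p))" and t: "radon_prob \<tau>"
  shows "radon_kernel (\<lambda>x. \<tau> \<bind> c x)"
  unfolding radon_kernel_def
proof (intro conjI allI ballI)
  note ck = radon_kernel_sections(1)[OF c]
  show "radon_prob (\<tau> \<bind> c x)" for x by (rule radon_prob_bind[OF t ck])
  fix f :: "'a \<Rightarrow> real" assume f: "f \<in> Cc"
  obtain B where B: "\<And>x. \<bar>f x\<bar> \<le> B" using Cc_bounded[OF f] by blast
  have "continuous_on UNIV (\<lambda>x. \<integral>y. (\<integral>w. f w \<partial>c x y) \<partial>\<tau>)"
    using radon_kernelD(1)[OF c, of "(_, _)"] B
    by (intro continuous_on_integral[OF t, where B=B] radon_kernelD(2)[OF c f] radon_prob_norm_integral_le Cc_measurable[OF f]) auto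
  then show "continuous_on UNIV (\<lambda>x. \<integral>w. f w \<partial>(\<tau> \<bind> c x))"
    by (simp add: integral_bind_Cc[OF t ck f])
qed

text \<open>Fubini for test functions, lifted to measures by uniqueness. It allows two independent
  factors of a convolution to be integrated in either order.\<close>

lemma bind_commute:
  fixes c :: "'b::t2_space \<Rightarrow> 'c::t2_space \<Rightarrow> 'a measure"
  assumes c: "radon_kernel (\<lambda>p. c (fst p) (snd p))" and t: "radon_prob \<tau>" and n: "radon_prob \<nu>"
  shows "\<nu> \<bind> (\<lambda>x. \<tau> \<bind> (\<lambda>y. c x y)) = \<tau> \<bind> (\<lambda>y. \<nu> \<bind> (\<lambda>x. c x y))"
proof (rule radon_prob_eqI)
  have k1: "radon_kernel (\<lambda>x. \<tau> \<bind> c x)" by (rule radon_kernel_bind[OF c t])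
  have k2: "radon_kernel (\<lambda>y. \<nu> \<bind> (\<lambda>x. c x y))"
    by (rule radon_kernel_bind[OF _ n]) (rule radon_kernel_sections(3)[OF c])
  show "radon_prob (\<nu> \<bind> (\<lambda>x. \<tau> \<bind> (\<lambda>y. c x y)))" by (rule radon_prob_bind[OF n k1])
  show "radon_prob (\<tau> \<bind> (\<lambda>y. \<nu> \<bind> (\<lambda>x. c x y)))" by (rule radon_prob_bind[OF t k2])
  fix f :: "'a \<Rightarrow> real" assume f: "f \<in> Cc"
  obtain B where B: "\<And>x. \<bar>f x\<bar> \<le> B" using Cc_bounded[OF f] by blast
  have "(\<integral>x. (\<integral>y. (\<integral>w. f w \<partial>c x y) \<partial>\<tau>) \<partial>\<nu>) = (\<integral>y. (\<integral>x. (\<integral>w. f w \<partial>c x y) \<partial>\<nu>) \<partial>\<tau>)"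
    using radon_prob_norm_integral_le[OF radon_kernelD(1)[OF c, of "(_, _)"] Cc_measurable[OF f], of B] B
    by (intro radon_prob_Fubini[OF n t, where B=B] radon_kernelD(2)[OF c f]) auto
  then show "(\<integral>w. f w \<partial>(\<nu> \<bind> (\<lambda>x. \<tau> \<bind> (\<lambda>y. c x y)))) = (\<integral>w. f w \<partial>(\<tau> \<bind> (\<lambda>y. \<nu> \<bind> (\<lambda>x. c x y))))"
    by (simp add: integral_bind_Cc[OF n k1 f] integral_bind_Cc[OF t k2 f]
        integral_bind_Cc[OF t radon_kernel_sections(1)[OF c] f] integral_bind_Cc[OF n radon_kernel_sections(2)[OF c] f])
qed

lemma bind_assoc_radon:
  fixes \<mu> :: "'b::t2_space measure" and \<kappa> :: "'b \<Rightarrow> 'c::t2_space measure" and \<eta> :: "'c \<Rightarrow> 'a measure"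
  assumes "radon_prob \<mu>" "\<kappa> \<in> borel \<rightarrow>\<^sub>M subprob_algebra borel" "radon_kernel \<eta>"
  shows "(\<mu> \<bind> \<kappa>) \<bind> \<eta> = \<mu> \<bind> (\<lambda>x. \<kappa> x \<bind> \<eta>)"
  using assms radon_probD[OF assms(1)] radon_kernel_measurable[OF assms(3)]
  by (intro bind_assoc[where N=borel and R=borel]) (auto cong: measurable_cong_sets)

end

section \<open>Supports and translations\<close>

text \<open>The complement of the support is a possibly uncountable union of null open sets. Inner
  regularity reduces the claim to compact sets, where finitely many of them suffice.\<close>

lemma msupp_null_open:
  assumes mu: "radon_prob \<mu>" and V: "open V" "V \<inter> msupp \<mu> = {}"
  shows "measure \<mu> V = 0"
proof (rule ccontr)
  note D = radon_probD[OF mu]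
  interpret prob_space \<mu> by (rule D)
  assume "measure \<mu> V \<noteq> 0"
  then have "0 < measure \<mu> V" by (simp add: zero_less_measure_iff)
  then obtain C where C: "compact C" "C \<subseteq> V" "0 < measure \<mu> C"
    using D(2) V(1) unfolding finite_radon_def by blast
  have "\<exists>U. open U \<and> x \<in> U \<and> emeasure \<mu> (UNIV \<inter> U) = 0" if "x \<in> C" for x
  proof -
    have "x \<notin> msupp \<mu>" using that C(2) V(2) by blast
    then show ?thesis by (auto simp: msupp_def)
  qed
  then have "emeasure \<mu> (UNIV \<inter> C) = 0" by (intro emeasure_null_on_compact[OF D(4) C(1)]) auto
  then show False using C(3) by (simp add: emeasure_eq_measure)
qed

lemma closed_msupp: "closed (msupp \<mu>)"
proof -
  have "- msupp \<mu> = \<Union>{U. open U \<and> emeasure \<mu> U = 0}" by (auto simp: msupp_def)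
  then have "open (- msupp \<mu>)" by auto
  then show ?thesis by (simp add: closed_def)
qed

lemma AE_msupp:
  assumes mu: "radon_prob \<mu>" shows "AE x in \<mu>. x \<in> msupp \<mu>"
proof -
  note D = radon_probD[OF mu]
  interpret prob_space \<mu> by (rule D)
  have o: "open (- msupp \<mu>)" using closed_msupp by (simp add: closed_def)
  then have "emeasure \<mu> (- msupp \<mu>) = 0" using msupp_null_open[OF mu o] by (simp add: emeasure_eq_measure)
  then show ?thesis using o D(4) by (intro AE_I[of _ _ "- msupp \<mu>"]) auto
qed

lemma msupp_nonempty:
  assumes mu: "radon_prob \<mu>" shows "msupp \<mu> \<noteq> {}"
proof
  note D = radon_probD[OF mu]
  interpret prob_space \<mu> by (rule D)
  assume "msupp \<mu> = {}"
  then have "AE x in \<mu>. False" using AE_msupp[OF mu] by simp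
  then show False by simp
qed

lemma integral_pos_msupp:
  fixes f :: "'a::t2_space \<Rightarrow> real"
  assumes mu: "radon_prob \<mu>" and f: "continuous_on UNIV f" "\<And>x. 0 \<le> f x" "\<And>x. f x \<le> B"
    and z: "z \<in> msupp \<mu>" "0 < f z"
  shows "0 < (\<integral>x. f x \<partial>\<mu>)"
proof -
  note D = radon_probD[OF mu]
  interpret prob_space \<mu> by (rule D)
  let ?U = "{x. f z / 2 < f x}"
  have U: "open ?U" using f(1) by (intro open_Collect_less continuous_on_const)
  then have "0 < measure \<mu> ?U" using z unfolding msupp_def by (auto simp: emeasure_eq_measure)
  moreover have "(\<integral>x. f z / 2 * indicator ?U x \<partial>\<mu>) \<le> (\<integral>x. f x \<partial>\<mu>)"
  proof (rule integral_mono)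
    show "integrable \<mu> f" using f borel_measurable_continuous_onI[OF f(1)]
      by (intro radon_prob_integrable[OF mu, where B=B]) auto
    show "integrable \<mu> (\<lambda>x. f z / 2 * indicator ?U x)" using U D(4)
      by (intro integrable_mult_right integrable_real_indicator) (auto simp: emeasure_eq_measure)
  qed (use f(2) in \<open>auto simp: indicator_def\<close>)
  moreover have "(\<integral>x. f z / 2 * indicator ?U x \<partial>\<mu>) = f z / 2 * measure \<mu> ?U"
    using U D(4) by (subst integral_mult_right_zero) (simp add: D(5))
  ultimately show ?thesis using z(2) by (smt (verit) mult_pos_pos half_gt_zero)
qed

section \<open>Consequences of the hypergroup axioms\<close>

locale haar_hypergroup =
  fixes cv :: "'a::t2_space \<Rightarrow> 'a \<Rightarrow> 'a measure" and e :: 'a and iv :: "'a \<Rightarrow> 'a" and \<omega> :: "'a measure"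
  assumes hg: "hypergroup cv e iv" and haar: "left_haar cv \<omega>"

sublocale haar_hypergroup \<subseteq> locally_compact_type "TYPE('a)"
  using hg by unfold_locales (simp add: hypergroup_def)

context haar_hypergroup begin

lemma cv_radon: "radon_prob (cv x y)"
  using hg by (intro radon_measure_imp_radon_prob) (auto simp: hypergroup_def)

lemma compact_msupp: "compact (msupp (cv x y))"
  using hg by (simp add: hypergroup_def)

lemma cv_kernel: "radon_kernel (\<lambda>p. cv (fst p) (snd p))"
  using hg cv_radon by (simp add: hypergroup_def radon_kernel_def)

lemma supp_usc: "open V \<Longrightarrow> open {p. msupp (cv (fst p) (snd p)) \<subseteq> V}"
  using hg by (simp add: hypergroup_def)

lemma cv_assoc: "f \<in> Cc \<Longrightarrow> (\<integral>u. (\<integral>w. f w \<partial>cv u z) \<partial>cv x y) = (\<integral>v. (\<integral>w. f w \<partial>cv x v) \<partial>cv y z)"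
  using hg by (simp add: hypergroup_def)

lemma cv_unit: "cv e x = return borel x" "cv x e = return borel x"
  using hg by (auto simp: hypergroup_def)

lemma iv_continuous: "continuous_on UNIV iv" and iv_iv [simp]: "iv (iv x) = x"
  and cv_iv: "cv (iv y) (iv x) = distr (cv x y) borel iv" and e_in_msupp: "e \<in> msupp (cv x y) \<longleftrightarrow> x = iv y"
  using hg by (auto simp: hypergroup_def)

lemma iv_measurable: "iv \<in> borel \<rightarrow>\<^sub>M borel"
  by (rule borel_measurable_continuous_onI[OF iv_continuous])

lemma cv_iv_kernel: "radon_kernel (\<lambda>p. cv (iv (fst p)) (snd p))"
proof -
  have "continuous_on UNIV (\<lambda>p. (iv (fst p), snd p) :: 'a \<times> 'a)"
    by (intro continuous_on_Pair continuous_on_snd continuous_on_id continuous_on_compose2[OF iv_continuous] continuous_on_fst) auto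
  from radon_kernel_comp[OF cv_kernel this] show ?thesis by simp
qed

lemma integral_cv_iv:
  fixes f :: "'a \<Rightarrow> 'b::{banach, second_countable_topology}"
  assumes "f \<in> borel_measurable borel"
  shows "(\<integral>w. f w \<partial>cv (iv y) (iv x)) = (\<integral>w. f (iv w) \<partial>cv x y)"
  unfolding cv_iv using assms iv_measurable radon_probD(4)[OF cv_radon]
  by (intro integral_distr) (auto cong: measurable_cong_sets)

lemma msupp_return: fixes x :: 'a shows "msupp (return borel x) = {x}"
proof -
  have "\<exists>U. open U \<and> z \<in> U \<and> x \<notin> U" if "z \<noteq> x" for z using hausdorff[OF that] by blast
  then show ?thesis by (auto simp: msupp_def indicator_def)
qed

lemma iv_e [simp]: "iv e = e"
  using e_in_msupp[of e e] by (simp add: cv_unit msupp_return)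

lemma msupp_iv:
  assumes "z \<in> msupp (cv x y)" shows "iv z \<in> msupp (cv (iv y) (iv x))"
  unfolding msupp_def
proof (intro CollectI allI impI)
  fix U assume U: "open U \<and> iv z \<in> U"
  have o: "open (iv -` U)" using U iv_continuous by (simp add: open_vimage)
  have "emeasure (cv (iv y) (iv x)) U = emeasure (cv x y) (iv -` U)"
    unfolding cv_iv using U iv_measurable radon_probD(4,5)[OF cv_radon]
    by (subst emeasure_distr) (auto cong: measurable_cong_sets)
  moreover have "z \<in> iv -` U" using U by simp
  ultimately show "0 < emeasure (cv (iv y) (iv x)) U" using assms o by (auto simp: msupp_def)
qed

text \<open>The generalised translate usually written \<open>f (x * y)\<close>; the real-valued
  counterpart of \<open>hfun\<close>.\<close>

definition trl :: "('a \<Rightarrow> real) \<Rightarrow> 'a \<Rightarrow> 'a \<Rightarrow> real" where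
  "trl f x y = (\<integral>w. f w \<partial>cv x y)"

lemma trl_continuous: "f \<in> Cc \<Longrightarrow> continuous_on UNIV (\<lambda>p. trl f (fst p) (snd p))"
  unfolding trl_def by (rule radon_kernelD(2)[OF cv_kernel])

lemma trl_iv_continuous: "f \<in> Cc \<Longrightarrow> continuous_on UNIV (\<lambda>p. trl f (iv (fst p)) (snd p))"
  unfolding trl_def by (rule radon_kernelD(2)[OF cv_iv_kernel])

lemma trl_bound:
  assumes "f \<in> Cc" "\<And>x. \<bar>f x\<bar> \<le> B" shows "\<bar>trl f x y\<bar> \<le> B"
  using radon_prob_norm_integral_le[OF cv_radon Cc_measurable[OF assms(1)], of B] assms(2) by (simp add: trl_def)

lemma trl_nonneg: "(\<And>x. 0 \<le> f x) \<Longrightarrow> 0 \<le> trl f x y"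
  unfolding trl_def by (intro Bochner_Integration.integral_nonneg) simp

lemma trl_e: "f \<in> Cc \<Longrightarrow> trl f e x = f x"
  unfolding trl_def cv_unit by (rule integral_return) (auto intro: Cc_measurable)

lemma trl_pos:
  assumes "f \<in> Cc" "\<And>x. 0 \<le> f x" "z \<in> msupp (cv x y)" "0 < f z"
  shows "0 < trl f x y"
proof -
  obtain B where "\<And>x. \<bar>f x\<bar> \<le> B" using Cc_bounded[OF assms(1)] by blast
  then show ?thesis unfolding trl_def using assms
    by (intro integral_pos_msupp[OF cv_radon Cc_continuous, where B=B and z=z]) (auto intro: abs_le_D1)
qed

lemma trl_nonzeroD:
  assumes "trl f x y \<noteq> 0" obtains w where "w \<in> msupp (cv x y)" "f w \<noteq> 0"
proof -
  have "\<exists>w\<in>msupp (cv x y). f w \<noteq> 0"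
  proof (rule ccontr)
    assume "\<not> ?thesis"
    then have "AE w in cv x y. f w = 0" using AE_msupp[OF cv_radon[of x y]] by (auto elim!: eventually_mono)
    then have "trl f x y = 0" unfolding trl_def by (rule integral_eq_zero_AE)
    with assms show False by simp
  qed
  then show ?thesis using that by blast
qed

text \<open>The unit lies in the support of \<open>u * w\<close> only for \<open>u = iv w\<close>,
  so for each \<open>u\<close> in \<open>D\<close> some neighbourhood of \<open>e\<close> is missed.
  Upper semicontinuity of the supports extends this to nearby \<open>u\<close>, and compactness
  leaves a finite intersection.\<close>

lemma e_separated:
  assumes D: "compact D" and w: "iv w \<notin> D"
  obtains V where "open V" "e \<in> V" "\<And>u. u \<in> D \<Longrightarrow> msupp (cv u w) \<inter> V = {}"
proof -
  have "\<exists>V A. open V \<and> e \<in> V \<and> open A \<and> u \<in> A \<and> (\<forall>u'\<in>A. msupp (cv u' w) \<inter> V = {})" if "u \<in> D" for u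
  proof -
    have "e \<notin> msupp (cv u w)" using that w by (auto simp: e_in_msupp)
    then obtain V W where VW: "open V" "open W" "e \<in> V" "msupp (cv u w) \<subseteq> W" "V \<inter> W = {}"
    proof -
      have o: "open (- msupp (cv u w))" using closed_msupp by (simp add: closed_def)
      obtain O' D' where "open O'" "compact D'" "e \<in> O'" "O' \<subseteq> D'" "D' \<subseteq> - msupp (cv u w)"
        by (rule compact_neighbourhood[OF o, of e]) (use \<open>e \<notin> msupp (cv u w)\<close> in auto)
      then show thesis by (intro that[of O' "- D'"]) (auto simp: compact_imp_closed open_Compl)
    qed
    have "open ((\<lambda>u'. (u', w)) -` {p. msupp (cv (fst p) (snd p)) \<subseteq> W})"
      by (intro open_vimage supp_usc VW continuous_on_Pair continuous_on_id continuous_on_const)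
    then show ?thesis using VW by (intro exI[of _ V] exI[of _ "(\<lambda>u'. (u', w)) -` {p. msupp (cv (fst p) (snd p)) \<subseteq> W}"]) auto
  qed
  then obtain V A where VA: "\<And>u. u \<in> D \<Longrightarrow> open (V u) \<and> e \<in> V u \<and> open (A u) \<and> u \<in> A u \<and> (\<forall>u'\<in>A u. msupp (cv u' w) \<inter> V u = {})"
    by metis
  obtain X where X: "X \<subseteq> D" "finite X" "D \<subseteq> (\<Union>u\<in>X. A u)" using compact_cover[OF D, of A] VA by blast
  show ?thesis
  proof (rule that[of "\<Inter>u\<in>X. V u"])
    show "open (\<Inter>u\<in>X. V u)" "e \<in> (\<Inter>u\<in>X. V u)" using X VA by auto
    fix u assume "u \<in> D"
    then obtain x where "x \<in> X" "u \<in> A x" using X by auto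
    then show "msupp (cv u w) \<inter> (\<Inter>u\<in>X. V u) = {}" using VA X(1) by blast
  qed
qed

text \<open>Both sides express that the unit lies in the support of the triple convolution of
  the points \<open>iv z\<close>, \<open>v\<close>, \<open>w\<close>.\<close>
lemma msupp_rotate:
  assumes z: "z \<in> msupp (cv v w)" shows "w \<in> msupp (cv (iv v) z)"
proof (rule ccontr)
  assume "w \<notin> msupp (cv (iv v) z)"
  then have "iv w \<notin> msupp (cv (iv z) v)" using msupp_iv[of "iv w" "iv z" v] by auto
  then obtain V where V: "open V" "e \<in> V" "\<And>u. u \<in> msupp (cv (iv z) v) \<Longrightarrow> msupp (cv u w) \<inter> V = {}"
    using e_separated[OF compact_msupp] by metis
  obtain k where k: "k \<in> urysohn_family V" "k e = 1" using urysohn_Cc[of "{e}" V] V by auto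
  then have kC: "k \<in> Cc" and k0: "\<And>x. 0 \<le> k x" and k1: "\<And>x. k x \<le> 1" and kV: "\<And>x. x \<notin> V \<Longrightarrow> k x = 0"
    by (auto simp: urysohn_family_def)
  have "trl k u w = 0" if "u \<in> msupp (cv (iv z) v)" for u
    using trl_nonzeroD[of k u w] V(3)[OF that] kV by (metis disjoint_iff)
  then have "AE u in cv (iv z) v. trl k u w = 0"
    using AE_msupp[OF cv_radon[of "iv z" v]] by (auto elim!: eventually_mono)
  then have "(\<integral>u. trl k u w \<partial>cv (iv z) v) = 0" by (rule integral_eq_zero_AE)
  \<comment> \<open>The other bracketing of the triple convolution. Its integrand is positive at
    \<open>t = z\<close>, because \<open>e\<close> lies in the support of \<open>iv z * z\<close>,
    and this contradicts the value 0.\<close>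
  then have "(\<integral>t. trl k (iv z) t \<partial>cv v w) = 0" using cv_assoc[OF kC] by (simp add: trl_def)
  moreover have "0 < (\<integral>t. trl k (iv z) t \<partial>cv v w)"
  proof (rule integral_pos_msupp[OF cv_radon _ _ _ z])
    show "continuous_on UNIV (trl k (iv z))" using continuous_on_sections(2)[OF trl_continuous[OF kC]] .
    show "0 < trl k (iv z) z" using k(2) by (intro trl_pos[OF kC k0, of e]) (auto simp: e_in_msupp)
    show "0 \<le> trl k (iv z) x" for x by (rule trl_nonneg[OF k0])
    show "trl k (iv z) x \<le> 1" for x using trl_bound[OF kC, of 1 "iv z" x] k0 k1 by (auto simp: abs_le_iff)
  qed
  ultimately show False by simp
qed

text \<open>Upper semicontinuity of a compact-valued map: finitely many open sets that cover one
  support also cover all nearby supports, so a finite subcover of \<open>P\<close> suffices.\<close>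

lemma compact_UN_msupp:
  assumes P: "compact P" shows "compact (\<Union>p\<in>P. msupp (cv (fst p) (snd p)))"
  unfolding compact_eq_Heine_Borel
proof (intro allI impI, elim conjE)
  fix \<C> assume \<C>: "\<forall>t\<in>\<C>. open t" "(\<Union>p\<in>P. msupp (cv (fst p) (snd p))) \<subseteq> \<Union>\<C>"
  have "\<exists>F. F \<subseteq> \<C> \<and> finite F \<and> msupp (cv (fst p) (snd p)) \<subseteq> \<Union>F" if "p \<in> P" for p
  proof -
    have "msupp (cv (fst p) (snd p)) \<subseteq> \<Union>\<C>" using \<C>(2) that by blast
    from compactE[OF compact_msupp this] show ?thesis using \<C>(1) by metis
  qed
  then obtain F where F: "\<And>p. p \<in> P \<Longrightarrow> F p \<subseteq> \<C> \<and> finite (F p) \<and> msupp (cv (fst p) (snd p)) \<subseteq> \<Union>(F p)" by metis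
  define A where "A q = {p. msupp (cv (fst p) (snd p)) \<subseteq> \<Union>(F q)}" for q
  have A: "open (A q)" "q \<in> A q" if "q \<in> P" for q
    using F[OF that] \<C>(1) unfolding A_def by (auto intro!: supp_usc open_Union)
  obtain X where X: "X \<subseteq> P" "finite X" "P \<subseteq> (\<Union>q\<in>X. A q)" using compact_cover[OF P A] .
  have "(\<Union>p\<in>P. msupp (cv (fst p) (snd p))) \<subseteq> \<Union>(\<Union>q\<in>X. F q)"
  proof
    fix x assume "x \<in> (\<Union>p\<in>P. msupp (cv (fst p) (snd p)))"
    then obtain p where p: "p \<in> P" "x \<in> msupp (cv (fst p) (snd p))" by blast
    then obtain q where "q \<in> X" "p \<in> A q" using X(3) by blast
    then show "x \<in> \<Union>(\<Union>q\<in>X. F q)" using p(2) unfolding A_def by blast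
  qed
  moreover have "finite (\<Union>q\<in>X. F q)" using X F by (intro finite_UN_I) blast+
  moreover have "(\<Union>q\<in>X. F q) \<subseteq> \<C>" using X F by blast
  ultimately show "\<exists>\<C>'\<subseteq>\<C>. finite \<C>' \<and> (\<Union>p\<in>P. msupp (cv (fst p) (snd p))) \<subseteq> \<Union>\<C>'" by blast
qed

text \<open>The set product usually written \<open>X * D\<close>.\<close>

definition msupp_prod :: "'a set \<Rightarrow> 'a set \<Rightarrow> 'a set" where
  "msupp_prod X D = (\<Union>p\<in>X \<times> D. msupp (cv (fst p) (snd p)))"

lemma compact_msupp_prod: "compact X \<Longrightarrow> compact D \<Longrightarrow> compact (msupp_prod X D)"
  unfolding msupp_prod_def by (intro compact_UN_msupp compact_Times)

text \<open>If \<open>w\<close> lies in the support of \<open>x * y\<close>, rotation puts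
  \<open>y\<close> into that of \<open>iv x * w\<close>. Admitting a set \<open>X\<close> around
  \<open>iv x\<close> gives a common compact support for a whole compact family of
  translates.\<close>

lemma trl_support:
  assumes f: "\<And>x. x \<notin> D \<Longrightarrow> f x = 0" and "iv x \<in> X" and "trl f x y \<noteq> 0"
  shows "y \<in> msupp_prod X D"
proof -
  obtain w where w: "w \<in> msupp (cv x y)" "f w \<noteq> 0" using trl_nonzeroD[OF assms(3)] .
  then have "y \<in> msupp (cv (iv x) w)" "w \<in> D" using msupp_rotate f by blast+
  then show ?thesis using assms(2) unfolding msupp_prod_def by force
qed

lemma trl_Cc: assumes f: "f \<in> Cc" shows "trl f x \<in> Cc"
proof -
  obtain D where D: "compact D" "\<And>x. x \<notin> D \<Longrightarrow> f x = 0" using f by (auto simp: Cc_def)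
  have K: "compact (msupp_prod {iv x} D)" by (intro compact_msupp_prod D) simp
  have z: "trl f x y = 0" if "y \<notin> msupp_prod {iv x} D" for y
    using trl_support[of D f x "{iv x}" y] D(2) that by auto
  show ?thesis unfolding Cc_def using continuous_on_sections(2)[OF trl_continuous[OF f]] K z by blast
qed

section \<open>Haar measure\<close>

lemma sets_haar: "sets \<omega> = sets borel" and space_haar: "space \<omega> = UNIV"
  and haar_compact: "compact C \<Longrightarrow> emeasure \<omega> C < \<infinity>"
proof -
  show s: "sets \<omega> = sets borel" using haar by (simp add: left_haar_def radon_measure_def)
  show "space \<omega> = UNIV" using sets_eq_imp_space_eq[OF s] by simp
  show "compact C \<Longrightarrow> emeasure \<omega> C < \<infinity>" using haar by (simp add: left_haar_def radon_measure_def)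
qed

lemma haar_inner_compact:
  assumes U: "open U" "emeasure \<omega> U < \<infinity>" and \<delta>: "0 < (\<delta>::real)"
  obtains C where "compact C" "C \<subseteq> U" "measure \<omega> U - \<delta> < measure \<omega> C"
proof (cases "measure \<omega> U = 0")
  \<comment> \<open>Separated because \<open>ennreal\<close> truncates the negative number
    \<open>measure \<omega> U - \<delta>\<close> to 0, so the strict inequality used below would
    fail.\<close>
  case True
  then show ?thesis using \<delta> by (intro that[of "{}"]) auto
next
  case False
  have "emeasure \<omega> U = (SUP C\<in>{C. compact C \<and> C \<subseteq> U}. emeasure \<omega> C)"
    using haar U(1) unfolding left_haar_def radon_measure_def by blast
  moreover have "ennreal (measure \<omega> U - \<delta>) < emeasure \<omega> U"
    using False \<delta> U(2) by (subst emeasure_eq_ennreal_measure) (auto intro!: ennreal_lessI simp: zero_less_measure_iff)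
  ultimately obtain C where C: "compact C" "C \<subseteq> U" "ennreal (measure \<omega> U - \<delta>) < emeasure \<omega> C"
    by (auto simp: less_SUP_iff)
  have "emeasure \<omega> C = ennreal (measure \<omega> C)"
    using haar_compact[OF C(1)] by (intro emeasure_eq_ennreal_measure) auto
  then have "measure \<omega> U - \<delta> < measure \<omega> C" using C(3) by (metis ennreal_leI not_le)
  then show ?thesis using that C by blast
qed

lemma haar_invariant: "f \<in> Cc \<Longrightarrow> (\<integral>y. trl f x y \<partial>\<omega>) = (\<integral>y. f y \<partial>\<omega>)"
  using haar by (simp add: left_haar_def trl_def)

lemma haar_integrable_compact:
  fixes f :: "'a \<Rightarrow> 'b::{banach, second_countable_topology}"
  assumes "f \<in> borel_measurable borel" "compact D" "\<And>x. x \<notin> D \<Longrightarrow> f x = 0" "\<And>x. norm (f x) \<le> B"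
  shows "integrable \<omega> f"
proof (rule Bochner_Integration.integrable_bound)
  show "integrable \<omega> (\<lambda>x. B * indicator D x)"
    using assms(2) haar_compact[OF assms(2)] sets_haar by (intro integrable_mult_right integrable_real_indicator) (auto simp: borel_compact)
  show "f \<in> borel_measurable \<omega>" using assms(1) sets_haar by (simp cong: measurable_cong_sets)
  show "AE x in \<omega>. norm (f x) \<le> norm (B * indicator D x)"
    using assms(3,4) by (intro AE_I2) (metis abs_ge_self indicator_eq_0_iff indicator_eq_1_iff mult.right_neutral mult_zero_right norm_zero order_trans real_norm_def le_cases)
qed

lemma Cc_haar_integrable: assumes f: "f \<in> Cc" shows "integrable \<omega> f"
proof -
  obtain B where B: "\<And>x. \<bar>f x\<bar> \<le> B" using Cc_bounded[OF f] by blast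
  obtain D where D: "compact D" "\<And>x. x \<notin> D \<Longrightarrow> f x = 0" using f by (auto simp: Cc_def)
  show ?thesis using B by (intro haar_integrable_compact[OF Cc_measurable[OF f] D, of B]) auto
qed

lemma Cc_haar_null:
  assumes f: "f \<in> Cc" "\<And>x. 0 \<le> f x" "(\<integral>x. f x \<partial>\<omega>) = 0"
  shows "emeasure \<omega> {x. 0 < f x} = 0"
proof -
  have "AE x in \<omega>. f x = 0"
    using integral_nonneg_eq_0_iff_AE[OF Cc_haar_integrable[OF f(1)]] f by simp
  moreover have "open {x. 0 < f x}" using Cc_continuous[OF f(1)] by (intro open_Collect_less continuous_on_const)
  then have "{x. 0 < f x} \<in> sets \<omega>" using sets_haar by simp
  moreover have "{x. 0 < f x} = {x \<in> space \<omega>. \<not> f x = 0}"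
    using f(2) space_haar by (auto simp: less_le)
  ultimately show ?thesis using AE_iff_measurable[of "{x. 0 < f x}" \<omega> "\<lambda>x. f x = 0"] by blast
qed

text \<open>If \<open>f\<close> were \<open>\<omega>\<close>-null then, by invariance, every point would have a null neighbourhood of the
  form \<open>{y. 0 < trl f t y}\<close>, hence \<open>\<omega> = 0\<close> by inner regularity.\<close>
lemma haar_pos:
  assumes f: "f \<in> Cc" "\<And>x. 0 \<le> f x" and a: "0 < f a"
  shows "0 < (\<integral>x. f x \<partial>\<omega>)"
proof (rule ccontr)
  assume "\<not> 0 < (\<integral>x. f x \<partial>\<omega>)"
  then have z: "(\<integral>x. f x \<partial>\<omega>) = 0" using Bochner_Integration.integral_nonneg[of \<omega> f, OF f(2)] by linarith
  have "\<exists>U. open U \<and> x \<in> U \<and> emeasure \<omega> U = 0" for x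
  proof -
    \<comment> \<open>Any \<open>t\<close> in the support of \<open>a * iv x\<close> works:
      rotations and an inversion turn this into membership of \<open>a\<close> in the support of
      \<open>t * x\<close>.\<close>
    obtain t where t: "t \<in> msupp (cv a (iv x))" using msupp_nonempty[OF cv_radon] by blast
    have "iv x \<in> msupp (cv (iv a) t)" by (rule msupp_rotate[OF t])
    from msupp_iv[OF this] have "x \<in> msupp (cv (iv t) a)" by simp
    from msupp_rotate[OF this] have "a \<in> msupp (cv t x)" by simp
    then have "0 < trl f t x" using trl_pos[OF f] a by blast
    moreover have "emeasure \<omega> {y. 0 < trl f t y} = 0"
      using haar_invariant[OF f(1), of t] z by (intro Cc_haar_null trl_Cc trl_nonneg f) auto
    moreover have "open {y. 0 < trl f t y}"
      using Cc_continuous[OF trl_Cc[OF f(1)]] by (intro open_Collect_less continuous_on_const)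
    ultimately show ?thesis by blast
  qed
  then have "emeasure \<omega> (UNIV \<inter> C) = 0" if "compact C" for C
    by (intro emeasure_null_on_compact[OF sets_haar that]) auto
  then have "(SUP C\<in>{C. compact C \<and> C \<subseteq> UNIV}. emeasure \<omega> C) \<le> 0" by (intro SUP_least) simp
  moreover have "emeasure \<omega> UNIV = (SUP C\<in>{C. compact C \<and> C \<subseteq> UNIV}. emeasure \<omega> C)"
    using haar unfolding left_haar_def radon_measure_def by blast
  ultimately show False using haar by (simp add: left_haar_def)
qed

section \<open>Compactly supported probability densities\<close>

definition den :: "('a \<Rightarrow> real) \<Rightarrow> 'a measure" where
  "den g = density \<omega> (\<lambda>x. ennreal (g x))"

definition Dens :: "('a \<Rightarrow> real) set" where
  "Dens = {g\<in>Cc. (\<forall>x. 0 \<le> g x) \<and> (\<integral>x. g x \<partial>\<omega>) = 1}"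

lemma DensD: assumes "g \<in> Dens" shows "g \<in> Cc" "0 \<le> g x" "(\<integral>x. g x \<partial>\<omega>) = 1"
  using assms by (auto simp: Dens_def)

lemma haar_measurable: "f \<in> borel_measurable borel \<Longrightarrow> f \<in> borel_measurable \<omega>"
  using sets_haar by (simp cong: measurable_cong_sets)

lemma sets_den: "sets (den g) = sets borel" and space_den: "space (den g) = UNIV"
  by (auto simp: den_def sets_haar space_haar)

lemma integral_den:
  fixes f :: "'a \<Rightarrow> 'b::{banach, second_countable_topology}"
  assumes g: "g \<in> Cc" "\<And>x. 0 \<le> g x" and f: "f \<in> borel_measurable borel"
  shows "(\<integral>x. f x \<partial>den g) = (\<integral>x. g x *\<^sub>R f x \<partial>\<omega>)"
  unfolding den_def using g f by (intro integral_density haar_measurable Cc_measurable) auto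

lemma emeasure_den_UNIV:
  assumes g: "g \<in> Cc" "\<And>x. 0 \<le> g x"
  shows "emeasure (den g) UNIV = ennreal (\<integral>x. g x \<partial>\<omega>)"
proof -
  have "emeasure (den g) UNIV = (\<integral>\<^sup>+x. ennreal (g x) \<partial>\<omega>)"
    unfolding den_def using haar_measurable[OF Cc_measurable[OF g(1)]]
    by (subst emeasure_density) (auto simp: sets_haar space_haar)
  also have "\<dots> = ennreal (\<integral>x. g x \<partial>\<omega>)" using g by (intro nn_integral_eq_integral Cc_haar_integrable) auto
  finally show ?thesis .
qed

lemma finite_radon_den:
  assumes g: "g \<in> Cc" "\<And>x. 0 \<le> g x"
  shows "finite_radon (den g)"
proof -
  obtain B where B: "0 < B" "\<And>x. \<bar>g x\<bar> \<le> B" using Cc_bounded[OF g(1)] by blast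
  obtain D where D: "compact D" "\<And>x. x \<notin> D \<Longrightarrow> g x = 0" using g(1) by (auto simp: Cc_def)
  have fin: "finite_measure (den g)" by (intro finite_measureI) (simp add: space_den emeasure_den_UNIV[OF g])
  interpret finite_measure "den g" by (rule fin)
  have meas: "measure (den g) A = (\<integral>x. g x * indicator A x \<partial>\<omega>)" if "A \<in> sets borel" for A
  proof -
    have "measure (den g) A = (\<integral>x. indicator A x \<partial>den g)" using that by (simp add: sets_den space_den)
    also have "\<dots> = (\<integral>x. g x *\<^sub>R indicator A x \<partial>\<omega>)" by (rule integral_den[OF g]) (use that in simp)
    finally show ?thesis by simp
  qed
  have int: "integrable \<omega> (\<lambda>x. g x * indicator A x)" if "A \<in> sets borel" for A
    using that B D Cc_measurable[OF g(1)]
    by (intro haar_integrable_compact[OF _ D(1), where B=B]) (auto simp: indicator_def)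
  have "\<exists>C. compact C \<and> C \<subseteq> U \<and> r < measure (den g) C" if U: "open U" and r: "r < measure (den g) U" for U r
  proof -
    \<comment> \<open>\<open>U\<close> itself may have infinite Haar measure. The part where
      \<open>g\<close> is positive lies in the compact set \<open>D\<close>, hence has finite
      measure, and carries all the mass of \<open>den g\<close> on \<open>U\<close>.\<close>
    let ?O = "{x. 0 < g x} \<inter> U"
    have O: "open ?O" using U Cc_continuous[OF g(1)] by (intro open_Int open_Collect_less continuous_on_const)
    have "emeasure \<omega> ?O \<le> emeasure \<omega> D"
      using D(1) D(2)[THEN eq_refl] by (intro emeasure_mono) (force simp: sets_haar borel_compact not_less[symmetric])+
    then have Ofin: "emeasure \<omega> ?O < \<infinity>" using haar_compact[OF D(1)] by (rule le_less_trans)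
    \<comment> \<open>Since \<open>g \<le> B\<close>, losing less than \<open>\<epsilon>\<close> in
      Haar measure costs less than \<open>B * \<epsilon>\<close>, exactly the available gap.\<close>
    define \<epsilon> where "\<epsilon> = (measure (den g) U - r) / B"
    have \<epsilon>: "0 < \<epsilon>" using r B by (simp add: \<epsilon>_def)
    obtain C where C: "compact C" "C \<subseteq> ?O" "measure \<omega> ?O - \<epsilon> < measure \<omega> C"
      using haar_inner_compact[OF O Ofin \<epsilon>] .
    have Cb: "C \<in> sets borel" using C(1) by (simp add: borel_compact)
    have iO: "integrable \<omega> (indicat_real ?O)" using O Ofin by (intro integrable_real_indicator) (auto simp: sets_haar)
    have iC: "integrable \<omega> (indicat_real C)" using Cb haar_compact[OF C(1)] by (intro integrable_real_indicator) (auto simp: sets_haar)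
    have "measure (den g) U - measure (den g) C = (\<integral>x. g x * indicator U x - g x * indicator C x \<partial>\<omega>)"
      using int[of U] int[OF Cb] U Cb by (simp add: meas)
    also have "\<dots> \<le> (\<integral>x. B * (indicator ?O x - indicator C x) \<partial>\<omega>)"
    proof (rule integral_mono)
      fix x
      show "g x * indicator U x - g x * indicator C x \<le> B * (indicator ?O x - indicator C x)"
        using B(2)[of x] g(2)[of x] C(2) by (auto simp: indicator_def less_le split: if_splits)
    qed (use int[of U] int[OF Cb] U iO iC in auto)
    also have "\<dots> = B * (measure \<omega> ?O - measure \<omega> C)" using iO iC by (simp add: space_haar)
    also have "\<dots> < B * \<epsilon>" using C(3) B(1) by simp
    also have "\<dots> = measure (den g) U - r" using B(1) by (simp add: \<epsilon>_def)
    finally have "r < measure (den g) C" by simp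
    then show ?thesis using C by blast
  qed
  then show ?thesis using fin sets_den by (auto simp: finite_radon_def)
qed

lemma radon_prob_den: assumes g: "g \<in> Dens" shows "radon_prob (den g)"
proof -
  note G = DensD[OF g]
  have "prob_space (den g)" using emeasure_den_UNIV[OF G(1,2)] G(3) by (intro prob_spaceI) (simp add: space_den)
  then show ?thesis using finite_radon_den[OF G(1,2)] by (simp add: radon_prob_def)
qed

lemma trl_Dens: "g \<in> Dens \<Longrightarrow> trl g x \<in> Dens"
  by (auto simp: Dens_def trl_Cc trl_nonneg haar_invariant)

lemma normalize_Dens:
  assumes f: "f \<in> Cc" "\<And>x. 0 \<le> f x" "0 < f a"
  shows "0 < (\<integral>x. f x \<partial>\<omega>)" "(\<lambda>x. inverse (\<integral>x. f x \<partial>\<omega>) * f x) \<in> Dens"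
proof -
  show p: "0 < (\<integral>x. f x \<partial>\<omega>)" by (rule haar_pos[OF f])
  show "(\<lambda>x. inverse (\<integral>x. f x \<partial>\<omega>) * f x) \<in> Dens"
    unfolding Dens_def using f p by (auto intro!: Cc_scale)
qed

lemma Dens_at: obtains g where "g \<in> Dens" "0 < g a"
proof -
  obtain f where f: "f \<in> urysohn_family UNIV" "\<And>x. x \<in> {a} \<Longrightarrow> f x = 1" using urysohn_Cc[of "{a}" UNIV] by auto
  then have F: "f \<in> Cc" "\<And>x. 0 \<le> f x" "0 < f a" by (auto simp: urysohn_family_def)
  show ?thesis using normalize_Dens[OF F] F by (intro that[of "\<lambda>x. inverse (\<integral>x. f x \<partial>\<omega>) * f x"]) auto
qed

lemma symmetric_Dens:
  assumes V: "open V" "e \<in> V"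
  obtains k where "k \<in> Dens" "\<And>x. k (iv x) = k x" "\<And>x. x \<notin> V \<Longrightarrow> k x = 0"
proof -
  obtain f where f: "f \<in> urysohn_family V" "\<And>x. x \<in> {e} \<Longrightarrow> f x = 1" using urysohn_Cc[of "{e}" V] V by auto
  then have F: "f \<in> Cc" "\<And>x. 0 \<le> f x" "0 < f e" "\<And>x. x \<notin> V \<Longrightarrow> f x = 0" by (auto simp: urysohn_family_def)
  \<comment> \<open>Unlike a sum, the pointwise product with the inverted function still vanishes
    off \<open>V\<close>; it is positive at \<open>e\<close> because
    \<open>iv e = e\<close>.\<close>
  let ?h = "\<lambda>x. f x * f (iv x)"
  obtain D where D: "compact D" "\<And>x. x \<notin> D \<Longrightarrow> f x = 0" using F(1) by (auto simp: Cc_def)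
  have "continuous_on UNIV ?h"
    using Cc_continuous[OF F(1)] by (intro continuous_on_mult continuous_on_compose2[OF _ iv_continuous]) auto
  then have h: "?h \<in> Cc" unfolding Cc_def using D by (auto intro!: exI[of _ D])
  have h': "\<And>x. 0 \<le> ?h x" "0 < ?h e" using F by auto
  show ?thesis
    using normalize_Dens[OF h h'] F(4) by (intro that[of "\<lambda>x. inverse (\<integral>x. ?h x \<partial>\<omega>) * ?h x"]) (auto simp: mult.commute)
qed

lemma trl_symmetric:
  assumes k: "k \<in> Cc" "\<And>x. k (iv x) = k x" shows "trl k (iv v) z = trl k (iv z) v"
  using integral_cv_iv[OF Cc_measurable[OF k(1)], of z "iv v"] k(2) by (simp add: trl_def)

subsection \<open>The adjoint relation\<close>

text \<open>For symmetric \<open>k\<close> this is the convolution of \<open>f\<close> with \<open>k\<close>.\<close>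
definition J :: "('a \<Rightarrow> real) \<Rightarrow> ('a \<Rightarrow> real) \<Rightarrow> 'a \<Rightarrow> real" where
  "J k f v = (\<integral>z. trl k (iv v) z \<partial>den f)"

lemma J_eq: "f \<in> Dens \<Longrightarrow> k \<in> Dens \<Longrightarrow> J k f v = (\<integral>z. f z * trl k (iv v) z \<partial>\<omega>)"
  unfolding J_def by (subst integral_den) (auto dest: DensD intro!: Cc_measurable trl_Cc)

lemma J_continuous:
  assumes "f \<in> Dens" "k \<in> Dens" shows "continuous_on UNIV (J k f)"
proof -
  obtain B where B: "\<And>x. \<bar>k x\<bar> \<le> B" using Cc_bounded DensD(1)[OF assms(2)] by blast
  show ?thesis unfolding J_def
    by (rule continuous_on_integral[OF radon_prob_den[OF assms(1)] trl_iv_continuous[OF DensD(1)[OF assms(2)]], where B=B])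
      (use trl_bound[OF DensD(1)[OF assms(2)] B] in auto)
qed

lemma trl_Cc_times_integrable:
  assumes "f \<in> Cc" "k \<in> Cc" shows "integrable \<omega> (\<lambda>z. f z * trl k x z)"
proof -
  obtain B where B: "\<And>x. \<bar>k x\<bar> \<le> B" using Cc_bounded[OF assms(2)] by blast
  obtain B' where B': "0 < B'" "\<And>x. \<bar>f x\<bar> \<le> B'" using Cc_bounded[OF assms(1)] by blast
  obtain D where D: "compact D" "\<And>x. x \<notin> D \<Longrightarrow> f x = 0" using assms(1) by (auto simp: Cc_def)
  show ?thesis
    using D(2) B' trl_bound[OF assms(2) B] Cc_measurable[OF assms(1)] Cc_measurable[OF trl_Cc[OF assms(2)]]
    by (intro haar_integrable_compact[OF _ D(1), where B="B' * B"]) (auto simp: abs_mult intro!: mult_mono)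
qed

text \<open>By left invariance \<open>trl k (iv v)\<close> is itself a density, so
  \<open>J k f v\<close> is an average of values of \<open>f\<close>.\<close>

lemma J_bound:
  assumes f: "f \<in> Dens" "\<And>x. f x \<le> B" and k: "k \<in> Dens" shows "0 \<le> J k f v" "J k f v \<le> B"
proof -
  show "0 \<le> J k f v" unfolding J_def by (intro Bochner_Integration.integral_nonneg trl_nonneg DensD(2)[OF k])
  note K = DensD[OF trl_Dens[OF k, of "iv v"]]
  have "J k f v \<le> (\<integral>z. B * trl k (iv v) z \<partial>\<omega>)" unfolding J_eq[OF f(1) k]
    using f(2) K(2) by (intro integral_mono trl_Cc_times_integrable integrable_mult_right Cc_haar_integrable DensD(1)[OF f(1)] DensD(1)[OF k] K(1))
      (auto intro!: mult_right_mono)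
  then show "J k f v \<le> B" using K(3) by simp
qed

text \<open>The averaging density \<open>trl k (iv v)\<close> lives on points of
  \<open>v * w\<close> with \<open>k w \<noteq> 0\<close>. The support of \<open>v0 * e\<close> is
  \<open>{v0}\<close>, so upper semicontinuity keeps these points near \<open>v0\<close> for
  \<open>v\<close> near \<open>v0\<close> and \<open>w\<close> near \<open>e\<close>; a finite cover
  makes this uniform on \<open>C\<close>.\<close>

lemma J_approx:
  assumes f: "f \<in> Dens" and C: "compact C" and \<epsilon>: "0 < \<epsilon>"
  obtains V where "open V" "e \<in> V" "\<And>k v. k \<in> Dens \<Longrightarrow> (\<And>x. x \<notin> V \<Longrightarrow> k x = 0) \<Longrightarrow> v \<in> C \<Longrightarrow> \<bar>J k f v - f v\<bar> \<le> \<epsilon>"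
proof -
  note F = DensD[OF f]
  define A where "A v0 = {a. \<bar>f a - f v0\<bar> < \<epsilon> / 2}" for v0
  have A: "open (A v0)" "v0 \<in> A v0" for v0
  proof -
    show "open (A v0)" unfolding A_def
      by (intro open_Collect_less continuous_on_rabs continuous_on_diff continuous_on_const Cc_continuous[OF F(1)])
  qed (use \<epsilon> in \<open>simp add: A_def\<close>)
  have "\<exists>B V. open B \<and> open V \<and> v0 \<in> B \<and> e \<in> V \<and> (\<forall>v\<in>B. \<forall>w\<in>V. msupp (cv v w) \<subseteq> A v0)" for v0
  proof -
    have "(v0, e) \<in> {p. msupp (cv (fst p) (snd p)) \<subseteq> A v0}" using A(2) by (simp add: cv_unit msupp_return)
    then obtain B V where BV: "open B" "open V" "(v0, e) \<in> B \<times> V" "B \<times> V \<subseteq> {p. msupp (cv (fst p) (snd p)) \<subseteq> A v0}"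
      by (rule open_prod_elim[OF supp_usc[OF A(1)]])
    have "msupp (cv v w) \<subseteq> A v0" if "v \<in> B" "w \<in> V" for v w using subsetD[OF BV(4), of "(v, w)"] that by simp
    then show ?thesis using BV(1-3) by blast
  qed
  then obtain B V where BV: "\<And>v0. open (B v0)" "\<And>v0. open (V v0)" "\<And>v0. v0 \<in> B v0" "\<And>v0. e \<in> V v0"
    "\<And>v0 v w. v \<in> B v0 \<Longrightarrow> w \<in> V v0 \<Longrightarrow> msupp (cv v w) \<subseteq> A v0" by metis
  have "\<And>v. open (B v \<inter> A v)" "\<And>v. v \<in> B v \<inter> A v" using BV(1,3) A by auto
  from compact_cover[OF C this] obtain X where X: "X \<subseteq> C" "finite X" "C \<subseteq> (\<Union>v\<in>X. B v \<inter> A v)" .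
  show ?thesis
  proof (rule that[of "\<Inter>v\<in>X. V v"])
    show "open (\<Inter>v\<in>X. V v)" "e \<in> (\<Inter>v\<in>X. V v)" using X BV by auto
    fix k v assume k: "k \<in> Dens" and kV: "\<And>x. x \<notin> (\<Inter>v\<in>X. V v) \<Longrightarrow> k x = 0" and v: "v \<in> C"
    obtain v0 where v0: "v0 \<in> X" "v \<in> B v0" "v \<in> A v0" using X(3) v by blast
    note K = DensD[OF trl_Dens[OF k, of "iv v"]]
    have close: "\<bar>f z - f v\<bar> < \<epsilon>" if nz: "trl k (iv v) z \<noteq> 0" for z
    proof -
      obtain w where w: "w \<in> msupp (cv (iv v) z)" "k w \<noteq> 0" using trl_nonzeroD[OF nz] .
      have "w \<in> V v0" using kV[of w] w(2) v0(1) by blast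
      moreover have "z \<in> msupp (cv v w)" using msupp_rotate[OF w(1)] by simp
      ultimately have "z \<in> A v0" using BV(5)[OF v0(2)] by blast
      then show ?thesis using v0(3) unfolding A_def by (simp add: abs_if split: if_splits)
    qed
    have i1: "integrable \<omega> (\<lambda>z. f z * trl k (iv v) z)" by (intro trl_Cc_times_integrable F(1) DensD(1)[OF k])
    have i2: "integrable \<omega> (trl k (iv v))" by (intro Cc_haar_integrable K(1))
    have eq: "J k f v - f v = (\<integral>z. f z * trl k (iv v) z - f v * trl k (iv v) z \<partial>\<omega>)"
      using i1 i2 K(3) by (simp add: J_eq[OF f k])
    have "norm (J k f v - f v) \<le> (\<integral>z. norm (f z * trl k (iv v) z - f v * trl k (iv v) z) \<partial>\<omega>)"
      unfolding eq by (rule integral_norm_bound)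
    also have "\<dots> \<le> (\<integral>z. \<epsilon> * trl k (iv v) z \<partial>\<omega>)"
    proof (rule integral_mono)
      fix z
      have "norm (f z * trl k (iv v) z - f v * trl k (iv v) z) = \<bar>f z - f v\<bar> * trl k (iv v) z"
        using K(2)[of z] by (simp add: abs_mult flip: left_diff_distrib)
      also have "\<dots> \<le> \<epsilon> * trl k (iv v) z"
        using close[of z] K(2)[of z] by (cases "trl k (iv v) z = 0") (auto intro: mult_right_mono)
      finally show "norm (f z * trl k (iv v) z - f v * trl k (iv v) z) \<le> \<epsilon> * trl k (iv v) z" .
    qed (use i1 i2 in auto)
    also have "\<dots> = \<epsilon>" using K(3) by simp
    finally show "\<bar>J k f v - f v\<bar> \<le> \<epsilon>" by simp
  qed
qed

lemma J_integral_approx: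
  assumes f: "f \<in> Dens" and t: "radon_prob \<tau>" and \<epsilon>: "0 < (\<epsilon>::real)"
  obtains V where "open V" "e \<in> V"
    "\<And>k. k \<in> Dens \<Longrightarrow> (\<And>x. x \<notin> V \<Longrightarrow> k x = 0) \<Longrightarrow> \<bar>(\<integral>v. J k f v \<partial>\<tau>) - (\<integral>v. f v \<partial>\<tau>)\<bar> \<le> \<epsilon>"
proof -
  note F = DensD[OF f]
  obtain B where B: "0 < B" "\<And>x. \<bar>f x\<bar> \<le> B" using Cc_bounded[OF F(1)] by blast
  define \<delta> where "\<delta> = \<epsilon> / (4 * B)"
  have \<delta>: "0 < \<delta>" "2 * B * \<delta> = \<epsilon> / 2" using \<epsilon> B by (auto simp: \<delta>_def)
  obtain C where C: "compact C" "measure \<tau> (- C) < \<delta>" using radon_prob_tight[OF t \<delta>(1)] by blast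
  obtain V where V: "open V" "e \<in> V"
    "\<And>k v. k \<in> Dens \<Longrightarrow> (\<And>x. x \<notin> V \<Longrightarrow> k x = 0) \<Longrightarrow> v \<in> C \<Longrightarrow> \<bar>J k f v - f v\<bar> \<le> \<epsilon> / 2"
    using J_approx[OF f C(1), of "\<epsilon> / 2"] \<epsilon> by (metis half_gt_zero)
  show ?thesis
  proof (rule that[OF V(1,2)])
    fix k assume k: "k \<in> Dens" "\<And>x. x \<notin> V \<Longrightarrow> k x = 0"
    have fB: "\<And>x. f x \<le> B" using B(2) by (auto intro: abs_le_D1)
    have "norm ((\<integral>v. J k f v \<partial>\<tau>) - (\<integral>v. f v \<partial>\<tau>)) \<le> \<epsilon> / 2 + 2 * B * \<delta>"
      using J_bound[OF f fB k(1)] B(2) C(2) V(3)[OF k] \<epsilon>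
      by (intro radon_prob_integral_close[OF t _ _ _ _ C(1)] borel_measurable_continuous_onI J_continuous f k(1) Cc_measurable F(1)) auto
    then show "\<bar>(\<integral>v. J k f v \<partial>\<tau>) - (\<integral>v. f v \<partial>\<tau>)\<bar> \<le> \<epsilon>" using \<delta> by simp
  qed
qed

lemma J_adjoint:
  assumes f: "f \<in> Dens" and g: "g \<in> Dens" and k: "k \<in> Dens" "\<And>x. k (iv x) = k x"
  shows "(\<integral>v. J k f v \<partial>(den g \<bind> cv x)) = (\<integral>v. J k g v \<partial>(den f \<bind> cv (iv x)))"
proof -
  note K = DensD[OF k(1)]
  note cvk = radon_kernel_sections(1)[OF cv_kernel]
  have df: "radon_prob (den f)" and dg: "radon_prob (den g)" by (simp_all add: radon_prob_den f g)
  obtain B where B: "\<And>x. \<bar>k x\<bar> \<le> B" using Cc_bounded[OF K(1)] by blast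
  obtain B' where B': "\<And>x. \<bar>g x\<bar> \<le> B'" using Cc_bounded DensD(1)[OF g] by blast
  have gB: "\<And>x. g x \<le> B'" using B' by (auto intro: abs_le_D1)
  have nu: "radon_prob (den g \<bind> cv x)" by (rule radon_prob_bind[OF dg cvk])
  have Jm: "J k g \<in> borel_measurable borel" by (intro borel_measurable_continuous_onI J_continuous g k(1))
  have "(\<integral>v. J k f v \<partial>(den g \<bind> cv x)) = (\<integral>z. (\<integral>v. trl k (iv v) z \<partial>(den g \<bind> cv x)) \<partial>den f)"
    unfolding J_def by (rule radon_prob_Fubini[OF nu df trl_iv_continuous[OF K(1)], where B=B]) (rule trl_bound[OF K(1) B])
  also have "\<dots> = (\<integral>z. (\<integral>u. J k g u \<partial>cv (iv x) z) \<partial>den f)"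
  proof (rule Bochner_Integration.integral_cong)
    fix z
    have "(\<integral>v. trl k (iv v) z \<partial>(den g \<bind> cv x)) = (\<integral>v. trl k (iv z) v \<partial>(den g \<bind> cv x))"
      using trl_symmetric[OF K(1) k(2)] by simp
    also have "\<dots> = (\<integral>y. (\<integral>v. trl k (iv z) v \<partial>cv x y) \<partial>den g)"
      by (rule integral_bind_Cc[OF dg cvk trl_Cc[OF K(1)]])
    also have "\<dots> = (\<integral>y. (\<integral>u. trl k u y \<partial>cv (iv z) x) \<partial>den g)"
      unfolding trl_def by (simp add: cv_assoc[OF K(1)])
    also have "\<dots> = (\<integral>u. (\<integral>y. trl k u y \<partial>den g) \<partial>cv (iv z) x)"
      by (rule radon_prob_Fubini[OF dg cv_radon continuous_on_sections(3)[OF trl_continuous[OF K(1)]], where B=B]) (rule trl_bound[OF K(1) B])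
    \<comment> \<open>\<open>J\<close> translates by \<open>iv v\<close>, hence the argument
      \<open>iv u\<close>. Inversion then absorbs it by turning \<open>iv z * x\<close> into
      \<open>iv x * z\<close>.\<close>
    also have "\<dots> = (\<integral>u. J k g (iv u) \<partial>cv (iv z) x)" by (simp add: J_def)
    also have "\<dots> = (\<integral>u. J k g u \<partial>cv (iv x) z)" using integral_cv_iv[OF Jm, of x "iv z"] by simp
    finally show "(\<integral>v. trl k (iv v) z \<partial>(den g \<bind> cv x)) = (\<integral>u. J k g u \<partial>cv (iv x) z)" .
  qed simp
  also have "\<dots> = (\<integral>v. J k g v \<partial>(den f \<bind> cv (iv x)))"
    by (rule integral_bind_real[OF df radon_kernel_measurable[OF cvk] Jm, where B=B', symmetric])
      (use J_bound[OF g gB k(1)] in \<open>simp add: abs_le_iff\<close>)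
  finally show ?thesis .
qed

lemma adjoint_Dens:
  assumes f: "f \<in> Dens" and g: "g \<in> Dens"
  shows "(\<integral>v. f v \<partial>(den g \<bind> cv x)) = (\<integral>v. g v \<partial>(den f \<bind> cv (iv x)))" (is "?L = ?R")
proof -
  have "\<bar>?L - ?R\<bar> \<le> 0"
  proof (rule field_le_epsilon)
    fix \<epsilon> :: real assume \<epsilon>: "0 < \<epsilon>"
    have rp: "radon_prob (den h \<bind> cv y)" if "h \<in> Dens" for h y
      using that by (intro radon_prob_bind radon_prob_den radon_kernel_sections(1)[OF cv_kernel])
    have \<epsilon>2: "0 < \<epsilon> / 2" using \<epsilon> by simp
    obtain V1 where V1: "open V1" "e \<in> V1"
      "\<And>k. k \<in> Dens \<Longrightarrow> (\<And>x. x \<notin> V1 \<Longrightarrow> k x = 0) \<Longrightarrow> \<bar>(\<integral>v. J k f v \<partial>(den g \<bind> cv x)) - ?L\<bar> \<le> \<epsilon> / 2"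
      using J_integral_approx[OF f rp[OF g] \<epsilon>2] by metis
    obtain V2 where V2: "open V2" "e \<in> V2"
      "\<And>k. k \<in> Dens \<Longrightarrow> (\<And>x. x \<notin> V2 \<Longrightarrow> k x = 0) \<Longrightarrow> \<bar>(\<integral>v. J k g v \<partial>(den f \<bind> cv (iv x))) - ?R\<bar> \<le> \<epsilon> / 2"
      using J_integral_approx[OF g rp[OF f] \<epsilon>2] by metis
    obtain k where k: "k \<in> Dens" "\<And>x. k (iv x) = k x" "\<And>x. x \<notin> V1 \<inter> V2 \<Longrightarrow> k x = 0"
      using symmetric_Dens[of "V1 \<inter> V2"] V1(1,2) V2(1,2) by (metis IntI open_Int)
    have "\<And>x. x \<notin> V1 \<Longrightarrow> k x = 0" "\<And>x. x \<notin> V2 \<Longrightarrow> k x = 0" using k(3) by blast+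
    from V1(3)[OF k(1) this(1)] V2(3)[OF k(1) this(2)] show "\<bar>?L - ?R\<bar> \<le> 0 + \<epsilon>"
      using J_adjoint[OF f g k(1,2), of x] by linarith
  qed
  then show ?thesis by simp
qed

lemma finite_radon_eqI_Dens:
  assumes mu: "finite_radon \<mu>" and nu: "finite_radon \<nu>"
    and eq: "\<And>f. f \<in> Dens \<Longrightarrow> (\<integral>x. f x \<partial>\<mu>) = (\<integral>x. f x \<partial>\<nu>)"
  shows "\<mu> = \<nu>"
proof (rule finite_radon_eqI[OF mu nu])
  fix f :: "'a \<Rightarrow> real" assume f: "f \<in> Cc" "\<And>x. 0 \<le> f x"
  show "(\<integral>x. f x \<partial>\<mu>) = (\<integral>x. f x \<partial>\<nu>)"
  proof (cases "\<exists>a. 0 < f a")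
    case True
    then obtain a where "0 < f a" by blast
    from normalize_Dens[OF f this] eq[OF normalize_Dens(2)[OF f this]] show ?thesis by simp
  next
    case False
    then have "f x = 0" for x using f(2)[of x] by (auto simp: not_less intro: antisym)
    then show ?thesis by simp
  qed
qed

text \<open>The measure \<open>\<delta>_x * g \<omega>\<close> again has a density, the left
  translate of \<open>g\<close> by \<open>iv x\<close>. All later estimates in \<open>L1\<close> and
  all null set arguments for translations rest on this form of the adjoint relation.\<close>

lemma adjoint:
  assumes g: "g \<in> Dens"
  shows "den g \<bind> cv x = den (trl g (iv x))"
proof (rule finite_radon_eqI_Dens)
  note cvk = radon_kernel_sections(1)[OF cv_kernel]
  show "finite_radon (den g \<bind> cv x)" "finite_radon (den (trl g (iv x)))"
    using radon_prob_bind[OF radon_prob_den[OF g] cvk] radon_prob_den[OF trl_Dens[OF g]] by (auto simp: radon_prob_def)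
  fix f assume f: "f \<in> Dens"
  have "(\<integral>v. f v \<partial>(den g \<bind> cv x)) = (\<integral>z. trl g (iv x) z \<partial>den f)"
    unfolding adjoint_Dens[OF f g] trl_def by (rule integral_bind_Cc[OF radon_prob_den[OF f] cvk DensD(1)[OF g]])
  also have "\<dots> = (\<integral>z. f z *\<^sub>R trl g (iv x) z \<partial>\<omega>)"
    by (rule integral_den) (use DensD[OF f] trl_Cc[OF DensD(1)[OF g]] in \<open>auto intro: Cc_measurable\<close>)
  also have "\<dots> = (\<integral>v. f v \<partial>den (trl g (iv x)))"
    using integral_den[of "trl g (iv x)" f] DensD[OF f] trl_Cc[OF DensD(1)[OF g]] trl_nonneg[OF DensD(2)[OF g]]
    by (simp add: Cc_measurable mult.commute)
  finally show "(\<integral>v. f v \<partial>(den g \<bind> cv x)) = (\<integral>v. f v \<partial>den (trl g (iv x)))" .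
qed

section \<open>Locally null sets\<close>

text \<open>\<open>g\<close> may be negative somewhere, and \<open>ennreal\<close> truncates there;
  hence \<open>g x \<le> 0\<close> instead of \<open>g x = 0\<close>.\<close>

lemma den_null_iff:
  assumes g: "g \<in> Cc" and N: "N \<in> sets borel"
  shows "emeasure (den g) N = 0 \<longleftrightarrow> (AE x in \<omega>. x \<in> N \<longrightarrow> g x \<le> 0)"
proof -
  have gm: "(\<lambda>x. ennreal (g x)) \<in> borel_measurable \<omega>"
    using haar_measurable[OF Cc_measurable[OF g]] by measurable
  have "emeasure (den g) N = 0 \<longleftrightarrow> (\<integral>\<^sup>+x. ennreal (g x) * indicator N x \<partial>\<omega>) = 0"
    unfolding den_def using N gm by (subst emeasure_density) (auto simp: sets_haar)
  also have "\<dots> \<longleftrightarrow> (AE x in \<omega>. ennreal (g x) * indicator N x = 0)"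
  proof (rule nn_integral_0_iff_AE)
    have "N \<in> sets \<omega>" using N by (simp add: sets_haar)
    then show "(\<lambda>x. ennreal (g x) * indicator N x) \<in> borel_measurable \<omega>" using gm by measurable
  qed
  also have "\<dots> \<longleftrightarrow> (AE x in \<omega>. x \<in> N \<longrightarrow> g x \<le> 0)"
    by (intro AE_cong) (auto simp: indicator_def ennreal_eq_0_iff)
  finally show ?thesis .
qed

lemma den_locally_null:
  assumes g: "g \<in> Cc" and N: "locally_null \<omega> N"
  shows "emeasure (den g) N = 0"
proof -
  obtain D where D: "compact D" "\<And>x. x \<notin> D \<Longrightarrow> g x = 0" using g by (auto simp: Cc_def)
  have Nb: "N \<in> sets borel" and "emeasure \<omega> (N \<inter> D) = 0" using N D by (auto simp: locally_null_def)
  moreover have "N \<inter> D \<in> sets \<omega>" using Nb D(1) by (auto simp: sets_haar borel_compact)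
  ultimately have "AE x in \<omega>. x \<notin> N \<inter> D" by (intro AE_not_in null_setsI)
  then show ?thesis unfolding den_null_iff[OF g Nb] using D(2) by (auto elim!: eventually_mono)
qed

lemma locally_nullI_cover:
  assumes N: "N \<in> sets borel" and U: "\<And>x. \<exists>U. open U \<and> x \<in> U \<and> emeasure \<omega> (N \<inter> U) = 0"
  shows "locally_null \<omega> N"
  unfolding locally_null_def using N U by (auto intro!: emeasure_null_on_compact[OF sets_haar])

lemma locally_nullI_Dens:
  assumes N: "N \<in> sets borel" and null: "\<And>g. g \<in> Dens \<Longrightarrow> emeasure (den g) N = 0"
  shows "locally_null \<omega> N"
proof (rule locally_nullI_cover[OF N])
  fix x
  obtain g where g: "g \<in> Dens" "0 < g x" using Dens_at by blast
  have U: "open {y. 0 < g y}" using Cc_continuous[OF DensD(1)[OF g(1)]] by (intro open_Collect_less continuous_on_const)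
  have "AE y in \<omega>. y \<notin> N \<inter> {y. 0 < g y}"
    using null[OF g(1)] unfolding den_null_iff[OF DensD(1)[OF g(1)] N] by (auto elim!: eventually_mono)
  moreover have "N \<inter> {y. 0 < g y} \<in> sets \<omega>" using N U by (auto simp: sets_haar)
  ultimately have "emeasure \<omega> (N \<inter> {y. 0 < g y}) = 0"
    by (subst (asm) AE_iff_measurable[OF _ refl]) (auto simp: space_haar Int_def)
  with U g(2) show "\<exists>U. open U \<and> x \<in> U \<and> emeasure \<omega> (N \<inter> U) = 0" by blast
qed

lemma bind_null_iff:
  fixes \<mu> :: "'b::t2_space measure" and \<kappa> :: "'b \<Rightarrow> 'a measure"
  assumes mu: "radon_prob \<mu>" and k: "radon_kernel \<kappa>" and N: "N \<in> sets borel"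
  shows "emeasure (\<mu> \<bind> \<kappa>) N = 0 \<longleftrightarrow> emeasure \<mu> {x. emeasure (\<kappa> x) N \<noteq> 0} = 0"
    and "{x. emeasure (\<kappa> x) N \<noteq> 0} \<in> sets borel"
proof -
  note D = radon_probD[OF mu]
  have km: "\<kappa> \<in> borel \<rightarrow>\<^sub>M subprob_algebra borel" by (rule radon_kernel_measurable[OF k])
  have k': "\<kappa> \<in> \<mu> \<rightarrow>\<^sub>M subprob_algebra borel" using km D(4) by (simp cong: measurable_cong_sets)
  have m: "(\<lambda>x. emeasure (\<kappa> x) N) \<in> borel_measurable borel"
    by (rule measurable_compose[OF km measurable_emeasure_subprob_algebra[OF N]])
  have "{x \<in> space borel. emeasure (\<kappa> x) N \<noteq> 0} \<in> sets borel" using m by measurable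
  then show s: "{x. emeasure (\<kappa> x) N \<noteq> 0} \<in> sets borel" by simp
  have "emeasure (\<mu> \<bind> \<kappa>) N = (\<integral>\<^sup>+x. emeasure (\<kappa> x) N \<partial>\<mu>)" using D(5) by (intro emeasure_bind[OF _ k' N]) simp
  then have "emeasure (\<mu> \<bind> \<kappa>) N = 0 \<longleftrightarrow> (AE x in \<mu>. emeasure (\<kappa> x) N = 0)"
    using m D(4) by (simp add: nn_integral_0_iff_AE cong: measurable_cong_sets)
  also have "\<dots> \<longleftrightarrow> emeasure \<mu> {x. emeasure (\<kappa> x) N \<noteq> 0} = 0"
    by (rule AE_iff_measurable) (use s D in auto)
  finally show "emeasure (\<mu> \<bind> \<kappa>) N = 0 \<longleftrightarrow> emeasure \<mu> {x. emeasure (\<kappa> x) N \<noteq> 0} = 0" .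
qed

text \<open>Absolute continuity relative to the locally null sets: integration against such a
  measure is well defined on L-infinity classes.\<close>

definition ac :: "'a measure \<Rightarrow> bool" where
  "ac \<nu> \<longleftrightarrow> (\<forall>N. locally_null \<omega> N \<longrightarrow> emeasure \<nu> N = 0)"

lemma ac_den: "g \<in> Cc \<Longrightarrow> ac (den g)"
  by (simp add: ac_def den_locally_null)

text \<open>Tested against densities: by \<open>adjoint\<close> a translated density is a density
  and does not charge \<open>N\<close>, so almost every fibre measure \<open>cv x y\<close> does not
  charge \<open>N\<close> either.\<close>

lemma locally_null_translate:
  assumes N: "locally_null \<omega> N" shows "locally_null \<omega> {y. emeasure (cv x y) N \<noteq> 0}"
proof -
  note cvk = radon_kernel_sections(1)[OF cv_kernel]
  have Nb: "N \<in> sets borel" using N by (simp add: locally_null_def)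
  show ?thesis
  proof (rule locally_nullI_Dens)
    fix g assume g: "g \<in> Dens"
    have "emeasure (den g \<bind> cv x) N = 0"
      unfolding adjoint[OF g] by (intro den_locally_null N trl_Cc DensD(1)[OF g])
    then show "emeasure (den g) {y. emeasure (cv x y) N \<noteq> 0} = 0"
      using bind_null_iff(1)[OF radon_prob_den[OF g] cvk Nb] by simp
  next
    obtain g where "g \<in> Dens" using Dens_at by blast
    from bind_null_iff(2)[OF radon_prob_den[OF this] cvk Nb]
    show "{y. emeasure (cv x y) N \<noteq> 0} \<in> sets borel" .
  qed
qed

lemma ac_bind_cv:
  assumes "radon_prob \<nu>" "ac \<nu>" shows "ac (\<nu> \<bind> cv x)"
  unfolding ac_def
proof (intro allI impI)
  fix N assume N: "locally_null \<omega> N"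
  then show "emeasure (\<nu> \<bind> cv x) N = 0"
    using bind_null_iff(1)[OF assms(1) radon_kernel_sections(1)[OF cv_kernel], of N] locally_null_translate[OF N] assms(2)
    by (simp add: ac_def locally_null_def)
qed

text \<open>After exchanging the mixtures, the measure is a \<open>\<tau>\<close>-average of left
  translates of \<open>\<nu>\<close>, each of which is absolutely continuous; \<open>\<tau>\<close>
  itself may be singular.\<close>

lemma ac_bind_convolution:
  assumes nu: "radon_prob \<nu>" "ac \<nu>" and t: "radon_prob \<tau>"
  shows "ac (\<nu> \<bind> (\<lambda>x. \<tau> \<bind> (\<lambda>y. cv (iv y) x)))"
proof -
  have k: "radon_kernel (\<lambda>y. \<nu> \<bind> cv (iv y))" by (rule radon_kernel_bind[OF cv_iv_kernel nu(1)])
  have eq: "\<nu> \<bind> (\<lambda>x. \<tau> \<bind> (\<lambda>y. cv (iv y) x)) = \<tau> \<bind> (\<lambda>y. \<nu> \<bind> cv (iv y))"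
    by (rule bind_commute[OF radon_kernel_sections(3)[OF cv_iv_kernel] t nu(1)])
  show ?thesis unfolding eq ac_def
  proof (intro allI impI)
    fix N assume N: "locally_null \<omega> N"
    have "emeasure (\<nu> \<bind> cv (iv y)) N = 0" for y using ac_bind_cv[OF nu] N by (simp add: ac_def)
    then show "emeasure (\<tau> \<bind> (\<lambda>y. \<nu> \<bind> cv (iv y))) N = 0"
      using bind_null_iff(1)[OF t k, of N] N by (simp add: locally_null_def)
  qed
qed

text \<open>By Fubini, \<open>{y. trl h x y > 0}\<close> meets \<open>iv -` N\<close> in a null set for almost every \<open>x\<close>, in particular
  for suitable \<open>x\<close> arbitrarily close to \<open>e\<close>, where this set contains a given small neighbourhood.\<close>
lemma locally_null_iv:
  assumes N: "locally_null \<omega> N" shows "locally_null \<omega> (iv -` N)"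
proof -
  have Nb: "N \<in> sets borel" using N by (simp add: locally_null_def)
  have iNb: "iv -` N \<in> sets borel" using measurable_sets[OF iv_measurable Nb] by simp
  show ?thesis
  proof (rule locally_nullI_cover[OF iNb])
    fix y0
    obtain h where h: "h \<in> Dens" "0 < h y0" using Dens_at by blast
    have "open {p. 0 < trl h (fst p) (snd p)}"
      by (intro open_Collect_less continuous_on_const trl_continuous DensD(1)[OF h(1)])
    moreover have "(e, y0) \<in> {p. 0 < trl h (fst p) (snd p)}" using h trl_e[OF DensD(1)[OF h(1)]] by simp
    ultimately obtain A B where AB: "open A" "open B" "(e, y0) \<in> A \<times> B" "A \<times> B \<subseteq> {p. 0 < trl h (fst p) (snd p)}"
      by (rule open_prod_elim)
    obtain k where k: "k \<in> Dens" "\<And>x. x \<notin> A \<Longrightarrow> k x = 0" using symmetric_Dens[of A] AB(1,3) by (metis SigmaD1)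
    have rk: "radon_prob (den k)" and rh: "radon_prob (den h)" by (simp_all add: radon_prob_den k h)
    let ?\<kappa> = "\<lambda>x. den h \<bind> (\<lambda>y. cv (iv y) x)"
    have kap: "radon_kernel ?\<kappa>" by (rule radon_kernel_bind[OF radon_kernel_sections(3)[OF cv_iv_kernel] rh])
    have "emeasure (den k \<bind> ?\<kappa>) N = 0"
      using ac_bind_convolution[OF rk ac_den[OF DensD(1)[OF k(1)]] rh] N by (simp add: ac_def)
    then have n1: "emeasure (den k) {x. emeasure (?\<kappa> x) N \<noteq> 0} = 0" using bind_null_iff(1)[OF rk kap Nb] by simp
    have "emeasure (den k) (- A) = 0"
      using AB(1) k(2) den_null_iff[OF DensD(1)[OF k(1)], of "- A"] by (auto simp: borel_comp)
    then have "emeasure (den k) (- A \<union> {x. emeasure (?\<kappa> x) N \<noteq> 0}) = 0"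
      using n1 AB(1) bind_null_iff(2)[OF rk kap Nb] emeasure_subadditive[of "- A" "den k" "{x. emeasure (?\<kappa> x) N \<noteq> 0}"]
      by (simp add: sets_den borel_comp)
    \<comment> \<open>\<open>den k\<close> is a probability that does not charge the complement of
      \<open>A\<close>, so the exceptional null set leaves a good \<open>x\<close> inside
      \<open>A\<close>.\<close>
    then have "- A \<union> {x. emeasure (?\<kappa> x) N \<noteq> 0} \<noteq> UNIV"
      using prob_space.emeasure_space_1[OF radon_probD(1)[OF rk]] by (auto simp: space_den)
    then obtain x where x: "x \<in> A" "emeasure (?\<kappa> x) N = 0" by blast
    have sec: "radon_kernel (\<lambda>y. cv (iv y) x)" by (rule radon_kernel_sections(2)[OF cv_iv_kernel])
    \<comment> \<open>Inversion exchanges the roles of \<open>x\<close> and \<open>y\<close>, which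
      brings the mixture over \<open>h\<close> into the form that \<open>adjoint\<close> identifies
      with the density \<open>trl h x\<close>.\<close>
    have flip: "emeasure (cv (iv y) x) N = emeasure (cv (iv x) y) (iv -` N)" for y
      using cv_iv[of y "iv x"] Nb iv_measurable radon_probD(4,5)[OF cv_radon]
      by (simp add: emeasure_distr cong: measurable_cong_sets)
    have "emeasure (den h) {y. emeasure (cv (iv x) y) (iv -` N) \<noteq> 0} = 0"
      using bind_null_iff(1)[OF rh sec Nb] x(2) unfolding flip by simp
    then have "emeasure (den h \<bind> cv (iv x)) (iv -` N) = 0"
      using bind_null_iff(1)[OF rh radon_kernel_sections(1)[OF cv_kernel] iNb] by simp
    then have ae: "AE y in \<omega>. y \<in> iv -` N \<longrightarrow> trl h x y \<le> 0"
      unfolding adjoint[OF h(1)] using den_null_iff[OF trl_Cc[OF DensD(1)[OF h(1)]] iNb] by simp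
    have pos: "0 < trl h x y" if "y \<in> B" for y using subsetD[OF AB(4), of "(x, y)"] x(1) that by simp
    have "AE y in \<omega>. \<not> y \<in> iv -` N \<inter> B"
      using ae by (rule eventually_mono) (use pos in \<open>force simp: not_less[symmetric]\<close>)
    moreover have "iv -` N \<inter> B \<in> sets \<omega>" using iNb AB(2) by (auto simp: sets_haar)
    ultimately have "emeasure \<omega> (iv -` N \<inter> B) = 0"
      using AE_iff_measurable[of "iv -` N \<inter> B" \<omega> "\<lambda>y. y \<notin> iv -` N \<inter> B"] by (auto simp: space_haar)
    then show "\<exists>U. open U \<and> y0 \<in> U \<and> emeasure \<omega> (iv -` N \<inter> U) = 0" using AB(2,3) by blast
  qed
qed

end

section \<open>Limits along filters and Cesaro means of Markov operators\<close>

lemma cluster_filter: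
  fixes M :: "nat \<Rightarrow> 'i \<Rightarrow> complex"
  assumes b: "\<And>n i. norm (M n i) \<le> b i"
  obtains F m where "F \<noteq> bot" "F \<le> sequentially" "\<And>i. ((\<lambda>n. M n i) \<longlongrightarrow> m i) F"
proof -
  let ?S = "Pi\<^sub>E UNIV (\<lambda>i. cball (0::complex) (b i))"
  have "compactin (product_topology (\<lambda>i. euclidean) UNIV) ?S" by (simp add: compactin_PiE)
  then have S: "compact ?S" by (simp add: euclidean_product_topology)
  have "filtermap M sequentially \<noteq> bot" by (simp add: filtermap_bot_iff)
  moreover have "M n \<in> ?S" for n using b by (simp add: PiE_iff)
  then have "eventually (\<lambda>x. x \<in> ?S) (filtermap M sequentially)" unfolding eventually_filtermap by (rule always_eventually[OF allI])
  ultimately obtain m where m: "inf (nhds m) (filtermap M sequentially) \<noteq> bot"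
    using S unfolding compact_filter by blast
  \<comment> \<open>The index set may be uncountable, so a subsequence need not converge at all
    indices. Instead the neighbourhood filter of the cluster point \<open>m\<close> is pulled back
    along \<open>M\<close> and intersected with \<open>sequentially\<close>.\<close>
  let ?F = "inf (filtercomap M (nhds m)) sequentially"
  have "?F \<noteq> bot"
  proof
    assume "?F = bot"
    then have "eventually (\<lambda>_. False) ?F" by simp
    then obtain P Q where PQ: "eventually P (filtercomap M (nhds m))" "eventually Q sequentially" "\<And>n. P n \<Longrightarrow> Q n \<Longrightarrow> False"
      unfolding eventually_inf by blast
    obtain P' where P': "eventually P' (nhds m)" "\<And>n. P' (M n) \<Longrightarrow> P n" using PQ(1) unfolding eventually_filtercomap by blast
    have "eventually (\<lambda>x. \<not> P' x) (filtermap M sequentially)"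
      unfolding eventually_filtermap using PQ(2) by (rule eventually_mono) (use PQ(3) P'(2) in blast)
    then have "eventually (\<lambda>_. False) (inf (nhds m) (filtermap M sequentially))"
      unfolding eventually_inf using P'(1) by blast
    then show False using m by (simp add: eventually_False)
  qed
  moreover have "((\<lambda>n. M n i) \<longlongrightarrow> m i) ?F" for i
  proof -
    have "filterlim M (nhds m) ?F" unfolding filterlim_def using filtermap_filtercomap[of M "nhds m"]
      by (meson filtermap_mono inf.cobounded1 order_trans)
    moreover have "continuous_on UNIV (\<lambda>h :: 'i \<Rightarrow> complex. h i)"
      by (rule continuous_on_product_then_coordinatewise) (rule continuous_on_id)
    then have "((\<lambda>h. h i) \<longlongrightarrow> m i) (at m)" unfolding continuous_on_def by simp
    then have "((\<lambda>h. h i) \<longlongrightarrow> m i) (nhds m)"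
      using tendsto_at_iff_tendsto_nhds[of "\<lambda>h. h i" m] by simp
    ultimately show ?thesis by (rule filterlim_compose[rotated])
  qed
  ultimately show ?thesis using that[of ?F m] by simp
qed

text \<open>Functions bounded everywhere rather than L-infinity classes: they can be integrated
  against singular measures such as \<open>cv x y\<close>.\<close>

definition bounded_borel :: "real \<Rightarrow> ('a::topological_space \<Rightarrow> complex) set" where
  "bounded_borel B = {\<phi> \<in> borel_measurable borel. \<forall>x. norm (\<phi> x) \<le> B}"

lemma bounded_borelD:
  assumes "\<phi> \<in> bounded_borel B" shows "\<phi> \<in> borel_measurable borel" "norm (\<phi> x) \<le> B" "0 \<le> B"
proof -
  show "\<phi> \<in> borel_measurable borel" and *: "norm (\<phi> x) \<le> B" for x using assms by (auto simp: bounded_borel_def)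
  show "0 \<le> B" using *[of undefined] norm_ge_zero order_trans by blast
qed

lemma bounded_borel_integrable:
  "radon_prob \<mu> \<Longrightarrow> \<phi> \<in> bounded_borel B \<Longrightarrow> integrable \<mu> \<phi>"
  using radon_prob_integrable bounded_borelD by blast

lemma bounded_borel_integral_le:
  "radon_prob \<mu> \<Longrightarrow> \<phi> \<in> bounded_borel B \<Longrightarrow> norm (\<integral>x. \<phi> x \<partial>\<mu>) \<le> B"
  using radon_prob_norm_integral_le bounded_borelD by blast

text \<open>The Markov operator of the kernel \<open>\<kappa>\<close>.\<close>

definition kint :: "('a \<Rightarrow> 'a measure) \<Rightarrow> ('a \<Rightarrow> complex) \<Rightarrow> 'a \<Rightarrow> complex" where
  "kint \<kappa> \<phi> x = (\<integral>w. \<phi> w \<partial>\<kappa> x)"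

context locally_compact_type begin

lemma kint_bounded_borel:
  fixes \<kappa> :: "'a \<Rightarrow> 'a measure"
  assumes k: "radon_kernel \<kappa>" and p: "\<phi> \<in> bounded_borel B"
  shows "kint \<kappa> \<phi> \<in> bounded_borel B"
  unfolding bounded_borel_def kint_def
  using kernel_integral_measurable[OF radon_kernel_measurable[OF k] bounded_borelD(1)[OF p]]
    bounded_borel_integral_le[OF radon_kernelD(1)[OF k] p] by simp

lemma integral_bind_bounded:
  fixes \<kappa> :: "'a \<Rightarrow> 'a measure"
  assumes "radon_prob \<mu>" and "radon_kernel \<kappa>" and p: "\<phi> \<in> bounded_borel B"
  shows "(\<integral>w. \<phi> w \<partial>(\<mu> \<bind> \<kappa>)) = (\<integral>x. kint \<kappa> \<phi> x \<partial>\<mu>)"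
  unfolding kint_def by (rule integral_bind[OF assms(1,2) bounded_borelD(1)[OF p] bounded_borelD(2)[OF p]])

lemma kint_funpow_bounded_borel:
  fixes \<kappa> :: "'a \<Rightarrow> 'a measure"
  assumes k: "radon_kernel \<kappa>" and p: "\<phi> \<in> bounded_borel B"
  shows "(kint \<kappa> ^^ n) \<phi> \<in> bounded_borel B"
  using p by (induction n) (auto intro: kint_bounded_borel[OF k])

definition avg :: "('a \<Rightarrow> 'a measure) \<Rightarrow> nat \<Rightarrow> ('a \<Rightarrow> complex) \<Rightarrow> 'a \<Rightarrow> complex" where
  "avg \<kappa> n \<phi> x = (\<Sum>k\<le>n. (kint \<kappa> ^^ k) \<phi> x) / of_nat (Suc n)"

lemma avg_bounded_borel:
  fixes \<kappa> :: "'a \<Rightarrow> 'a measure"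
  assumes k: "radon_kernel \<kappa>" and p: "\<phi> \<in> bounded_borel B"
  shows "avg \<kappa> n \<phi> \<in> bounded_borel B"
proof -
  note P = bounded_borelD[OF kint_funpow_bounded_borel[OF k p]]
  have "avg \<kappa> n \<phi> \<in> borel_measurable borel" unfolding avg_def using P(1) by measurable
  moreover have "norm (avg \<kappa> n \<phi> x) \<le> B" for x
  proof -
    have "norm (\<Sum>k\<le>n. (kint \<kappa> ^^ k) \<phi> x) \<le> (\<Sum>k\<le>n. B)" by (intro sum_norm_le P(2))
    then show ?thesis unfolding avg_def by (simp add: norm_divide field_simps del: of_nat_Suc)
  qed
  ultimately show ?thesis by (simp add: bounded_borel_def)
qed

lemma integral_avg:
  fixes \<kappa> :: "'a \<Rightarrow> 'a measure"
  assumes k: "radon_kernel \<kappa>" and p: "\<phi> \<in> bounded_borel B" and m: "radon_prob \<mu>"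
  shows "(\<integral>x. avg \<kappa> n \<phi> x \<partial>\<mu>) = (\<Sum>k\<le>n. (\<integral>x. (kint \<kappa> ^^ k) \<phi> x \<partial>\<mu>)) / of_nat (Suc n)"
  unfolding avg_def using bounded_borel_integrable[OF m kint_funpow_bounded_borel[OF k p]]
  by (simp add: Bochner_Integration.integral_sum del: of_nat_Suc)

text \<open>The sum telescopes to the difference of the iterate \<open>n + 1\<close> and
  \<open>\<phi>\<close>, divided by \<open>n + 1\<close>. This asymptotic invariance becomes exact
  harmonicity in the limit.\<close>

lemma kint_avg_diff:
  fixes \<kappa> :: "'a \<Rightarrow> 'a measure"
  assumes k: "radon_kernel \<kappa>" and p: "\<phi> \<in> bounded_borel B"
  shows "norm (kint \<kappa> (avg \<kappa> n \<phi>) x - avg \<kappa> n \<phi> x) \<le> 2 * B / Suc n"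
proof -
  have "kint \<kappa> (avg \<kappa> n \<phi>) x = (\<Sum>k\<le>n. (kint \<kappa> ^^ Suc k) \<phi> x) / of_nat (Suc n)"
    using integral_avg[OF k p radon_kernelD(1)[OF k]] by (simp add: kint_def del: of_nat_Suc)
  then have "kint \<kappa> (avg \<kappa> n \<phi>) x - avg \<kappa> n \<phi> x
    = (\<Sum>k\<le>n. (kint \<kappa> ^^ Suc k) \<phi> x - (kint \<kappa> ^^ k) \<phi> x) / of_nat (Suc n)"
    unfolding avg_def by (simp only: sum_subtractf diff_divide_distrib)
  also have "(\<Sum>k\<le>n. (kint \<kappa> ^^ Suc k) \<phi> x - (kint \<kappa> ^^ k) \<phi> x) = (kint \<kappa> ^^ Suc n) \<phi> x - \<phi> x"
    using sum_telescope[of "\<lambda>k. - (kint \<kappa> ^^ k) \<phi> x" n] by simp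
  finally have eq: "kint \<kappa> (avg \<kappa> n \<phi>) x - avg \<kappa> n \<phi> x = ((kint \<kappa> ^^ Suc n) \<phi> x - \<phi> x) / of_nat (Suc n)" .
  have "norm ((kint \<kappa> ^^ Suc n) \<phi> x - \<phi> x) \<le> B + B"
    using bounded_borelD(2)[OF kint_funpow_bounded_borel[OF k p, of "Suc n"], of x] bounded_borelD(2)[OF p, of x]
    by (intro order_trans[OF norm_triangle_ineq4] add_mono)
  then show ?thesis unfolding eq norm_divide norm_of_nat by (intro divide_right_mono) auto
qed

end

context haar_hypergroup begin

section \<open>Continuity of translations in L1 and the approximate unit\<close>

lemma den_diff:
  assumes g: "g \<in> Dens" and h: "h \<in> Dens" and p: "\<phi> \<in> bounded_borel B"
  shows "norm ((\<integral>x. \<phi> x \<partial>den g) - (\<integral>x. \<phi> x \<partial>den h)) \<le> B * (\<integral>x. \<bar>g x - h x\<bar> \<partial>\<omega>)"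
proof -
  note P = bounded_borelD[OF p]
  have int: "integrable \<omega> (\<lambda>x. f x *\<^sub>R \<phi> x)" if f: "f \<in> Cc" for f
  proof (rule Bochner_Integration.integrable_bound)
    show "integrable \<omega> (\<lambda>x. B * f x)" by (intro integrable_mult_right Cc_haar_integrable f)
    show "(\<lambda>x. f x *\<^sub>R \<phi> x) \<in> borel_measurable \<omega>"
      using haar_measurable[OF P(1)] haar_measurable[OF Cc_measurable[OF f]] by measurable
    show "AE x in \<omega>. norm (f x *\<^sub>R \<phi> x) \<le> norm (B * f x)"
      using P(2,3) by (intro AE_I2) (simp add: abs_mult mult.commute[of B] mult_left_mono)
  qed
  have gh: "integrable \<omega> (\<lambda>x. \<bar>g x - h x\<bar>)"
    using Cc_haar_integrable DensD(1)[OF g] DensD(1)[OF h] by (intro integrable_abs Bochner_Integration.integrable_diff) auto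
  have eq: "(\<integral>x. \<phi> x \<partial>den g) - (\<integral>x. \<phi> x \<partial>den h) = (\<integral>x. g x *\<^sub>R \<phi> x - h x *\<^sub>R \<phi> x \<partial>\<omega>)"
    using integral_den[OF DensD(1,2)[OF g] P(1)] integral_den[OF DensD(1,2)[OF h] P(1)] int[OF DensD(1)[OF g]] int[OF DensD(1)[OF h]]
    by simp
  have "norm ((\<integral>x. \<phi> x \<partial>den g) - (\<integral>x. \<phi> x \<partial>den h)) \<le> (\<integral>x. norm (g x *\<^sub>R \<phi> x - h x *\<^sub>R \<phi> x) \<partial>\<omega>)"
    unfolding eq by (rule integral_norm_bound)
  also have "\<dots> \<le> (\<integral>x. B * \<bar>g x - h x\<bar> \<partial>\<omega>)"
  proof (rule integral_mono)
    fix x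
    have "norm (g x *\<^sub>R \<phi> x - h x *\<^sub>R \<phi> x) = \<bar>g x - h x\<bar> * norm (\<phi> x)" by (simp flip: scaleR_diff_left)
    then show "norm (g x *\<^sub>R \<phi> x - h x *\<^sub>R \<phi> x) \<le> B * \<bar>g x - h x\<bar>"
      using mult_left_mono[OF P(2)[of x], of "\<bar>g x - h x\<bar>"] by (simp add: mult.commute)
  qed (use int[OF DensD(1)[OF g]] int[OF DensD(1)[OF h]] gh in auto)
  finally show ?thesis by simp
qed

lemma haar_integral_small:
  assumes E: "compact E" and \<epsilon>: "0 < (\<epsilon>::real)"
  obtains \<delta> where "0 < \<delta>" "\<And>f. integrable \<omega> f \<Longrightarrow> (\<And>y. y \<in> E \<Longrightarrow> \<bar>f y\<bar> \<le> \<delta>) \<Longrightarrow> (\<And>y. y \<notin> E \<Longrightarrow> f y = 0)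
    \<Longrightarrow> (\<integral>y. \<bar>f y\<bar> \<partial>\<omega>) \<le> \<epsilon>"
proof -
  define \<delta> where "\<delta> = \<epsilon> / (measure \<omega> E + 1)"
  have mE: "0 < measure \<omega> E + 1" by (simp add: add_nonneg_pos)
  then have \<delta>: "0 < \<delta>" using \<epsilon> by (simp add: \<delta>_def)
  show ?thesis
  proof (rule that[OF \<delta>])
    fix f assume f: "integrable \<omega> f" "\<And>y. y \<in> E \<Longrightarrow> \<bar>f y\<bar> \<le> \<delta>" "\<And>y. y \<notin> E \<Longrightarrow> f y = 0"
    have "integrable \<omega> (\<lambda>y. \<delta> * indicator E y)"
      using E haar_compact[OF E] by (intro integrable_mult_right integrable_real_indicator) (auto simp: sets_haar borel_compact)
    then have "(\<integral>y. \<bar>f y\<bar> \<partial>\<omega>) \<le> (\<integral>y. \<delta> * indicator E y \<partial>\<omega>)"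
      using f by (intro integral_mono) (auto simp: indicator_def)
    also have "\<dots> = \<delta> * measure \<omega> E" using E by (simp add: space_haar)
    also have "\<dots> \<le> \<epsilon>"
      using mult_left_mono[of "measure \<omega> E" "measure \<omega> E + 1" \<delta>] mE \<delta> by (simp add: \<delta>_def)
    finally show "(\<integral>y. \<bar>f y\<bar> \<partial>\<omega>) \<le> \<epsilon>" .
  qed
qed

text \<open>For \<open>x\<close> in a compact neighbourhood of \<open>x0\<close> all translates
  vanish off one compact set \<open>E\<close>; uniform closeness on \<open>E\<close>, from joint
  continuity, is then closeness in \<open>L1\<close>.\<close>

lemma translation_L1_continuous:
  assumes g: "g \<in> Dens" and \<epsilon>: "0 < (\<epsilon>::real)"
  obtains A where "open A" "x0 \<in> A" "\<And>x. x \<in> A \<Longrightarrow> (\<integral>y. \<bar>trl g (iv x) y - trl g (iv x0) y\<bar> \<partial>\<omega>) \<le> \<epsilon>"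
proof -
  note G = DensD[OF g]
  obtain D where D: "compact D" "\<And>x. x \<notin> D \<Longrightarrow> g x = 0" using G(1) by (auto simp: Cc_def)
  obtain O' X where X: "open O'" "compact X" "x0 \<in> O'" "O' \<subseteq> X" using compact_neighbourhood[of UNIV x0] by auto
  define E where "E = msupp_prod X D"
  have E: "compact E" unfolding E_def by (intro compact_msupp_prod X D)
  have zero: "trl g (iv x) y = 0" if "x \<in> X" "y \<notin> E" for x y
    using trl_support[of D g "iv x" X y] D(2) that by (auto simp: E_def)
  obtain \<delta> where \<delta>: "0 < \<delta>" and small: "\<And>f. integrable \<omega> f \<Longrightarrow> (\<And>y. y \<in> E \<Longrightarrow> \<bar>f y\<bar> \<le> \<delta>)
      \<Longrightarrow> (\<And>y. y \<notin> E \<Longrightarrow> f y = 0) \<Longrightarrow> (\<integral>y. \<bar>f y\<bar> \<partial>\<omega>) \<le> \<epsilon>"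
    by (rule haar_integral_small[OF E \<epsilon>]) blast
  obtain A where A: "open A" "x0 \<in> A" "\<And>x y. x \<in> A \<Longrightarrow> y \<in> E \<Longrightarrow> dist (trl g (iv x) y) (trl g (iv x0) y) < \<delta>"
    by (rule continuous_uniform_on_compact[OF trl_iv_continuous[OF G(1)] E \<delta>, of x0]) blast
  show ?thesis
  proof (rule that[of "A \<inter> O'"])
    show "open (A \<inter> O')" "x0 \<in> A \<inter> O'" using A X by auto
    fix x assume x: "x \<in> A \<inter> O'"
    then have "x \<in> X" "x0 \<in> X" using X by blast+
    then show "(\<integral>y. \<bar>trl g (iv x) y - trl g (iv x0) y\<bar> \<partial>\<omega>) \<le> \<epsilon>"
      using A(3)[of x] x zero
      by (intro small Bochner_Integration.integrable_diff Cc_haar_integrable trl_Cc G(1)) (auto simp: dist_real_def less_imp_le)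
  qed
qed

lemma right_kernel: "g \<in> Dens \<Longrightarrow> radon_kernel (\<lambda>x. den g \<bind> cv x)"
  by (rule radon_kernel_bind[OF cv_kernel radon_prob_den])

lemma J_support:
  assumes k: "k \<in> Dens" "\<And>x. k (iv x) = k x" and h: "h \<in> Dens"
    and D: "\<And>x. x \<notin> D \<Longrightarrow> h x = 0" and D': "\<And>x. x \<notin> D' \<Longrightarrow> k x = 0" and v: "v \<notin> msupp_prod D D'"
  shows "J k h v = 0"
proof -
  have "h z * trl k (iv v) z = 0" for z
  proof (cases "z \<in> D")
    case True
    then show ?thesis using trl_support[of D' k "iv z" D v] D' v trl_symmetric[OF DensD(1)[OF k(1)] k(2), of v z] by auto
  qed (simp add: D)
  then show ?thesis unfolding J_eq[OF h k(1)] by (intro integral_eq_zero_AE AE_I2)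
qed

text \<open>The convolution of two densities has a density. That \<open>J k h\<close> has integral
  one is read off from the total mass of the mixed probability measure.\<close>

lemma bind_right_eq_J:
  assumes k: "k \<in> Dens" "\<And>x. k (iv x) = k x" and h: "h \<in> Dens"
  shows "J k h \<in> Dens" "den h \<bind> (\<lambda>x. den k \<bind> cv x) = den (J k h)"
proof -
  note K = DensD[OF k(1)]
  have dh: "radon_prob (den h)" by (rule radon_prob_den[OF h])
  obtain B where B: "\<And>x. \<bar>k x\<bar> \<le> B" using Cc_bounded[OF K(1)] by blast
  obtain D where D: "compact D" "\<And>x. x \<notin> D \<Longrightarrow> h x = 0" using DensD(1)[OF h] by (auto simp: Cc_def)
  obtain D' where D': "compact D'" "\<And>x. x \<notin> D' \<Longrightarrow> k x = 0" using K(1) by (auto simp: Cc_def)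
  have "\<And>v. v \<notin> msupp_prod D D' \<Longrightarrow> J k h v = 0" using J_support[OF k h D(2) D'(2)] by blast
  then have JC: "J k h \<in> Cc"
    unfolding Cc_def using J_continuous[OF h k(1)] compact_msupp_prod[OF D(1) D'(1)] by blast
  have J0: "0 \<le> J k h v" for v unfolding J_def by (intro Bochner_Integration.integral_nonneg trl_nonneg K(2))
  have rp: "radon_prob (den h \<bind> (\<lambda>x. den k \<bind> cv x))" by (rule radon_prob_bind[OF dh right_kernel[OF k(1)]])
  show eq: "den h \<bind> (\<lambda>x. den k \<bind> cv x) = den (J k h)"
  proof (rule finite_radon_eqI_Dens)
    show "finite_radon (den h \<bind> (\<lambda>x. den k \<bind> cv x))" using rp by (simp add: radon_prob_def)
    show "finite_radon (den (J k h))" by (rule finite_radon_den[OF JC J0])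
    fix f assume f: "f \<in> Dens"
    have fm: "f \<in> borel_measurable borel" by (rule Cc_measurable[OF DensD(1)[OF f]])
    have "(\<integral>w. f w \<partial>(den k \<bind> cv x)) = (\<integral>y. trl k (iv x) y \<partial>den f)" for x
      unfolding adjoint[OF k(1)]
      using integral_den[OF DensD(1)[OF f] DensD(2)[OF f] Cc_measurable[OF trl_Cc[OF K(1)]], of "iv x"]
        integral_den[OF trl_Cc[OF K(1)] trl_nonneg[OF K(2)] fm, of "iv x"] by (simp add: mult.commute)
    then have "(\<integral>w. f w \<partial>(den h \<bind> (\<lambda>x. den k \<bind> cv x))) = (\<integral>x. (\<integral>y. trl k (iv x) y \<partial>den f) \<partial>den h)"
      using integral_bind_Cc[OF dh right_kernel[OF k(1)] DensD(1)[OF f]] by simp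
    also have "\<dots> = (\<integral>y. (\<integral>x. trl k (iv x) y \<partial>den h) \<partial>den f)"
      by (rule radon_prob_Fubini[OF dh radon_prob_den[OF f] trl_iv_continuous[OF K(1)], where B=B]) (rule trl_bound[OF K(1) B])
    also have "\<dots> = (\<integral>y. J k h y \<partial>den f)"
      unfolding J_def using trl_symmetric[OF K(1) k(2)] by simp
    also have "\<dots> = (\<integral>y. f y \<partial>den (J k h))"
      using integral_den[OF DensD(1)[OF f] DensD(2)[OF f] Cc_measurable[OF JC]] integral_den[OF JC J0 fm]
      by (simp add: mult.commute)
    finally show "(\<integral>w. f w \<partial>(den h \<bind> (\<lambda>x. den k \<bind> cv x))) = (\<integral>y. f y \<partial>den (J k h))" .
  qed
  have "(\<integral>x. J k h x \<partial>\<omega>) = (\<integral>x. 1 \<partial>den (J k h))" using integral_den[OF JC J0, of "\<lambda>_. 1 :: real"] by simp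
  also have "\<dots> = 1" using radon_probD(6)[OF rp] unfolding eq by (simp add: space_den)
  finally show "J k h \<in> Dens" using JC J0 by (simp add: Dens_def)
qed

lemma J_L1_approx:
  assumes h: "h \<in> Dens" and \<epsilon>: "0 < (\<epsilon>::real)"
  obtains V where "open V" "e \<in> V" "\<And>k. k \<in> Dens \<Longrightarrow> (\<And>x. k (iv x) = k x) \<Longrightarrow> (\<And>x. x \<notin> V \<Longrightarrow> k x = 0)
      \<Longrightarrow> (\<integral>x. \<bar>J k h x - h x\<bar> \<partial>\<omega>) \<le> \<epsilon>"
proof -
  obtain D where D: "compact D" "\<And>x. x \<notin> D \<Longrightarrow> h x = 0" using DensD(1)[OF h] by (auto simp: Cc_def)
  \<comment> \<open>Confining the support of \<open>k\<close> to a fixed compact neighbourhood of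
    \<open>e\<close> keeps the supports of all \<open>J k h\<close> in one compact set, on which
    uniform approximation suffices.\<close>
  obtain O' D' where O': "open O'" "compact D'" "e \<in> O'" "O' \<subseteq> D'" using compact_neighbourhood[of UNIV e] by auto
  define E where "E = msupp_prod D D' \<union> D"
  have E: "compact E" unfolding E_def by (intro compact_Un compact_msupp_prod D O')
  obtain \<delta> where \<delta>: "0 < \<delta>" and small: "\<And>f. integrable \<omega> f \<Longrightarrow> (\<And>y. y \<in> E \<Longrightarrow> \<bar>f y\<bar> \<le> \<delta>)
      \<Longrightarrow> (\<And>y. y \<notin> E \<Longrightarrow> f y = 0) \<Longrightarrow> (\<integral>y. \<bar>f y\<bar> \<partial>\<omega>) \<le> \<epsilon>"
    by (rule haar_integral_small[OF E \<epsilon>]) blast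
  obtain V where V: "open V" "e \<in> V"
    "\<And>k v. k \<in> Dens \<Longrightarrow> (\<And>x. x \<notin> V \<Longrightarrow> k x = 0) \<Longrightarrow> v \<in> E \<Longrightarrow> \<bar>J k h v - h v\<bar> \<le> \<delta>"
    using J_approx[OF h E \<delta>] by metis
  show ?thesis
  proof (rule that[of "V \<inter> O'"])
    show "open (V \<inter> O')" "e \<in> V \<inter> O'" using V O' by auto
    fix k assume k: "k \<in> Dens" "\<And>x. k (iv x) = k x" "\<And>x. x \<notin> V \<inter> O' \<Longrightarrow> k x = 0"
    have kD': "\<And>x. x \<notin> D' \<Longrightarrow> k x = 0" and kV: "\<And>x. x \<notin> V \<Longrightarrow> k x = 0" using k(3) O'(4) by blast+
    show "(\<integral>x. \<bar>J k h x - h x\<bar> \<partial>\<omega>) \<le> \<epsilon>"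
    proof (rule small)
      show "integrable \<omega> (\<lambda>x. J k h x - h x)"
        by (intro Bochner_Integration.integrable_diff Cc_haar_integrable DensD(1) bind_right_eq_J(1) k h)
      show "\<bar>J k h v - h v\<bar> \<le> \<delta>" if "v \<in> E" for v using V(3)[OF k(1) kV that] .
      show "J k h v - h v = 0" if "v \<notin> E" for v
        using that J_support[OF k(1,2) h D(2) kD'] D(2) by (auto simp: E_def)
    qed
  qed
qed

lemma cv_assoc_bind: "cv x y \<bind> (\<lambda>u. cv u z) = cv y z \<bind> cv x"
proof (rule radon_prob_eqI)
  note k = radon_kernel_sections[OF cv_kernel]
  show "radon_prob (cv x y \<bind> (\<lambda>u. cv u z))" "radon_prob (cv y z \<bind> cv x)"
    by (auto intro!: radon_prob_bind cv_radon k)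
  fix f :: "'a \<Rightarrow> real" assume "f \<in> Cc"
  then show "(\<integral>w. f w \<partial>(cv x y \<bind> (\<lambda>u. cv u z))) = (\<integral>w. f w \<partial>(cv y z \<bind> cv x))"
    using cv_assoc by (simp add: integral_bind_Cc[OF cv_radon k(1)] integral_bind_Cc[OF cv_radon k(2)])
qed

end

section \<open>The random walk\<close>

locale liouville_walk = haar_hypergroup cv e iv \<omega>
  for cv :: "'a::t2_space \<Rightarrow> 'a \<Rightarrow> 'a measure" and e iv \<omega> +
  fixes \<sigma> :: "'a measure"
  assumes sigma: "radon_prob \<sigma>"
    and liouville: "\<And>f. f \<in> Hinf_sigma cv iv \<omega> \<sigma> \<Longrightarrow> \<exists>c. loc_ae_eq \<omega> f (\<lambda>_. c)"
begin

text \<open>The convolution of the inverted \<open>\<sigma>\<close> with the point mass at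
  \<open>x\<close>; its Markov operator is \<open>f \<mapsto> \<sigma> * f\<close>, see
  \<open>mconv_eq_kint\<close>.\<close>

definition walk :: "'a \<Rightarrow> 'a measure" where
  "walk x = \<sigma> \<bind> (\<lambda>y. cv (iv y) x)"

abbreviation right :: "('a \<Rightarrow> real) \<Rightarrow> 'a \<Rightarrow> 'a measure" where
  "right g \<equiv> (\<lambda>x. den g \<bind> cv x)"

lemma walk_kernel: "radon_kernel walk"
  unfolding walk_def by (rule radon_kernel_bind[OF radon_kernel_sections(3)[OF cv_iv_kernel] sigma])

text \<open>Both sides are the triple convolution of the inverted \<open>\<sigma>\<close>, the point
  mass at \<open>x\<close> and \<open>den g\<close>: associativity for points, integrated over
  \<open>\<sigma>\<close> and \<open>den g\<close>.\<close>

lemma walk_right_commute: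
  assumes g: "g \<in> Dens" shows "walk x \<bind> right g = right g x \<bind> walk"
proof -
  have dg: "radon_prob (den g)" by (rule radon_prob_den[OF g])
  have wx: "radon_prob (walk x)" by (rule radon_kernelD(1)[OF walk_kernel])
  have inner: "walk x \<bind> (\<lambda>v. cv v t) = cv x t \<bind> walk" for t
  proof -
    have "walk x \<bind> (\<lambda>v. cv v t) = \<sigma> \<bind> (\<lambda>y. cv (iv y) x \<bind> (\<lambda>v. cv v t))"
      unfolding walk_def
      by (rule bind_assoc_radon[OF sigma radon_kernel_measurable[OF radon_kernel_sections(2)[OF cv_iv_kernel]] radon_kernel_sections(2)[OF cv_kernel]])
    also have "\<dots> = \<sigma> \<bind> (\<lambda>y. cv x t \<bind> (\<lambda>a. cv (iv y) a))" by (simp add: cv_assoc_bind)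
    also have "\<dots> = cv x t \<bind> walk"
      unfolding walk_def[abs_def] by (rule bind_commute[OF cv_iv_kernel cv_radon sigma])
    finally show ?thesis .
  qed
  have "walk x \<bind> right g = den g \<bind> (\<lambda>t. walk x \<bind> (\<lambda>v. cv v t))"
    by (rule bind_commute[OF cv_kernel dg wx])
  also have "\<dots> = den g \<bind> (\<lambda>t. cv x t \<bind> walk)" by (simp add: inner)
  also have "\<dots> = right g x \<bind> walk"
    by (rule bind_assoc_radon[OF dg radon_kernel_measurable[OF radon_kernel_sections(1)[OF cv_kernel]] walk_kernel, symmetric])
  finally show ?thesis .
qed

lemma kint_walk_right:
  assumes g: "g \<in> Dens" and p: "\<phi> \<in> bounded_borel B"
  shows "kint walk (kint (right g) \<phi>) = kint (right g) (kint walk \<phi>)"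
proof
  fix x
  have "kint walk (kint (right g) \<phi>) x = (\<integral>w. \<phi> w \<partial>(walk x \<bind> right g))"
    unfolding integral_bind_bounded[OF radon_kernelD(1)[OF walk_kernel] right_kernel[OF g] p] by (rule kint_def)
  also have "\<dots> = kint (right g) (kint walk \<phi>) x"
    unfolding walk_right_commute[OF g] integral_bind_bounded[OF radon_kernelD(1)[OF right_kernel[OF g]] walk_kernel p]
    by (simp add: kint_def[of "right g"])
  finally show "kint walk (kint (right g) \<phi>) x = kint (right g) (kint walk \<phi>) x" .
qed

lemma kint_walk_right_funpow:
  assumes g: "g \<in> Dens" and p: "\<phi> \<in> bounded_borel B"
  shows "(kint walk ^^ k) (kint (right g) \<phi>) = kint (right g) ((kint walk ^^ k) \<phi>)"
  by (induction k) (simp_all add: kint_walk_right[OF g kint_funpow_bounded_borel[OF walk_kernel p]])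

lemma avg_right:
  assumes g: "g \<in> Dens" and p: "\<phi> \<in> bounded_borel B"
  shows "avg walk n (kint (right g) \<phi>) = kint (right g) (avg walk n \<phi>)"
proof
  fix x
  have "kint (right g) (avg walk n \<phi>) x = (\<Sum>k\<le>n. kint (right g) ((kint walk ^^ k) \<phi>) x) / of_nat (Suc n)"
    unfolding kint_def[of "right g"] by (rule integral_avg[OF walk_kernel p radon_kernelD(1)[OF right_kernel[OF g]]])
  then show "avg walk n (kint (right g) \<phi>) x = kint (right g) (avg walk n \<phi>) x"
    unfolding avg_def[of walk n "kint (right g) \<phi>"] kint_walk_right_funpow[OF g p] by simp
qed

lemma kint_right: "g \<in> Dens \<Longrightarrow> kint (right g) \<psi> x = (\<integral>w. \<psi> w \<partial>den (trl g (iv x)))"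
  by (simp add: kint_def adjoint)

lemma mconv_eq_kint:
  assumes "u \<in> bounded_borel B" shows "mconv cv iv \<sigma> u = kint walk u"
proof
  fix x
  show "mconv cv iv \<sigma> u x = kint walk u x"
    unfolding mconv_def hfun_def kint_def[of walk] walk_def
    using integral_bind[OF sigma radon_kernel_sections(2)[OF cv_iv_kernel] bounded_borelD(1)[OF assms] bounded_borelD(2)[OF assms], of x]
    by simp
qed

lemma locally_null_empty: "locally_null \<omega> {}"
  by (simp add: locally_null_def)

lemma bounded_borel_Linf: "u \<in> bounded_borel B \<Longrightarrow> u \<in> Linf \<omega>"
  unfolding Linf_def bounded_borel_def using locally_null_empty by (auto simp: not_less[symmetric] intro!: exI[of _ B] exI[of _ "{}"])

section \<open>Limits of right translates of the Cesaro means\<close>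

context
  fixes \<phi> :: "'a \<Rightarrow> complex" and B :: real and F :: "nat filter" and \<Lambda> :: "('a \<Rightarrow> real) \<Rightarrow> complex"
  assumes p: "\<phi> \<in> bounded_borel B" and F: "F \<noteq> bot" "F \<le> sequentially"
    and lim: "\<And>g. g \<in> Dens \<Longrightarrow> ((\<lambda>n. \<integral>x. avg walk n \<phi> x \<partial>den g) \<longlongrightarrow> \<Lambda> g) F"
begin

lemma avg_bb: "avg walk n \<phi> \<in> bounded_borel B"
  by (rule avg_bounded_borel[OF walk_kernel p])

abbreviation approx :: "('a \<Rightarrow> real) \<Rightarrow> nat \<Rightarrow> 'a \<Rightarrow> complex" where
  "approx g n \<equiv> kint (right g) (avg walk n \<phi>)"

lemma Lambda_diff:
  assumes "g \<in> Dens" "h \<in> Dens"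
  shows "norm (\<Lambda> g - \<Lambda> h) \<le> B * (\<integral>x. \<bar>g x - h x\<bar> \<partial>\<omega>)"
  by (rule Lim_norm_ubound[OF F(1) tendsto_diff[OF lim[OF assms(1)] lim[OF assms(2)]]])
    (simp add: den_diff[OF assms avg_bb])

text \<open>By \<open>adjoint\<close> the argument is the density of
  \<open>\<delta>_x * g \<omega>\<close>. Expressing the limit through \<open>\<Lambda>\<close>
  makes its continuity a consequence of the Lipschitz bound in \<open>L1\<close>.\<close>

definition limfun :: "('a \<Rightarrow> real) \<Rightarrow> 'a \<Rightarrow> complex" where
  "limfun g x = \<Lambda> (trl g (iv x))"

lemma limfun_tendsto: "g \<in> Dens \<Longrightarrow> ((\<lambda>n. approx g n x) \<longlongrightarrow> limfun g x) F"
  unfolding kint_right limfun_def by (rule lim[OF trl_Dens])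

text \<open>The estimate \<open>den_diff\<close> sees the Cesaro mean only through its bound
  \<open>B\<close>, so one neighbourhood serves every \<open>n\<close> and the limit as
  well.\<close>

lemma equicontinuous:
  assumes g: "g \<in> Dens" and \<epsilon>: "0 < (\<epsilon>::real)"
  obtains A where "open A" "x0 \<in> A" "\<And>x. x \<in> A \<Longrightarrow> norm (limfun g x - limfun g x0) \<le> \<epsilon>"
    "\<And>x n. x \<in> A \<Longrightarrow> norm (approx g n x - approx g n x0) \<le> \<epsilon>"
proof -
  have B0: "0 \<le> B" by (rule bounded_borelD(3)[OF p])
  have "0 < \<epsilon> / (B + 1)" using \<epsilon> B0 by simp
  then obtain A where A: "open A" "x0 \<in> A" "\<And>x. x \<in> A \<Longrightarrow> (\<integral>y. \<bar>trl g (iv x) y - trl g (iv x0) y\<bar> \<partial>\<omega>) \<le> \<epsilon> / (B + 1)"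
    using translation_L1_continuous[OF g] by metis
  have le: "B * (\<integral>y. \<bar>trl g (iv x) y - trl g (iv x0) y\<bar> \<partial>\<omega>) \<le> \<epsilon>" if "x \<in> A" for x
  proof -
    have "B * (\<integral>y. \<bar>trl g (iv x) y - trl g (iv x0) y\<bar> \<partial>\<omega>) \<le> (B + 1) * (\<epsilon> / (B + 1))"
      using A(3)[OF that] B0 \<epsilon> by (intro mult_mono) auto
    then show ?thesis using B0 by simp
  qed
  show ?thesis
  proof (rule that[OF A(1,2)])
    fix x assume x: "x \<in> A"
    show "norm (limfun g x - limfun g x0) \<le> \<epsilon>"
      unfolding limfun_def by (rule order_trans[OF Lambda_diff le[OF x]]) (intro trl_Dens g)+
    show "norm (approx g n x - approx g n x0) \<le> \<epsilon>" for n
      unfolding kint_right[OF g] by (rule order_trans[OF den_diff[OF _ _ avg_bb] le[OF x]]) (intro trl_Dens g)+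
  qed
qed

lemma limfun_continuous: assumes g: "g \<in> Dens" shows "continuous_on UNIV (limfun g)"
proof (rule continuous_on_UNIV_approx)
  fix x0 and \<epsilon> :: real assume "0 < \<epsilon>"
  then have "0 < \<epsilon> / 2" by simp
  then obtain A where A: "open A" "x0 \<in> A" "\<And>x. x \<in> A \<Longrightarrow> norm (limfun g x - limfun g x0) \<le> \<epsilon> / 2"
    using equicontinuous[OF g] by metis
  then have "\<forall>x\<in>A. dist (limfun g x) (limfun g x0) < \<epsilon>" using \<open>0 < \<epsilon>\<close> by (force simp: dist_norm)
  then show "\<exists>A. open A \<and> x0 \<in> A \<and> (\<forall>x\<in>A. dist (limfun g x) (limfun g x0) < \<epsilon>)" using A by blast
qed

lemma limfun_bb: assumes g: "g \<in> Dens" shows "limfun g \<in> bounded_borel B"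
proof -
  have "norm (limfun g x) \<le> B" for x
    by (rule Lim_norm_ubound[OF F(1) limfun_tendsto[OF g]])
      (simp add: bounded_borelD(2)[OF kint_bounded_borel[OF right_kernel[OF g] avg_bb]])
  then show ?thesis using borel_measurable_continuous_onI[OF limfun_continuous[OF g]] by (simp add: bounded_borel_def)
qed

text \<open>The argument of Ascoli: convergence at finitely many centres, with equicontinuity
  between them, is uniform on compact sets.\<close>

lemma limfun_uniform:
  assumes g: "g \<in> Dens" and C: "compact C" and \<epsilon>: "0 < (\<epsilon>::real)"
  shows "eventually (\<lambda>n. \<forall>x\<in>C. norm (approx g n x - limfun g x) \<le> \<epsilon>) F"
proof -
  let ?u = "\<lambda>n x. approx g n x"
  have \<epsilon>3: "0 < \<epsilon> / 3" using \<epsilon> by simp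
  have "\<exists>A. open A \<and> x0 \<in> A \<and> (\<forall>x\<in>A. norm (limfun g x - limfun g x0) \<le> \<epsilon> / 3) \<and> (\<forall>x\<in>A. \<forall>n. norm (?u n x - ?u n x0) \<le> \<epsilon> / 3)" for x0
    by (rule equicontinuous[OF g \<epsilon>3, of x0]) blast
  then obtain A where A: "\<And>x0. open (A x0)" "\<And>x0. x0 \<in> A x0" "\<And>x0 x. x \<in> A x0 \<Longrightarrow> norm (limfun g x - limfun g x0) \<le> \<epsilon> / 3"
    "\<And>x0 x n. x \<in> A x0 \<Longrightarrow> norm (?u n x - ?u n x0) \<le> \<epsilon> / 3" by metis
  obtain X where X: "X \<subseteq> C" "finite X" "C \<subseteq> (\<Union>x\<in>X. A x)" using compact_cover[OF C A(1,2)] .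
  have "eventually (\<lambda>n. norm (?u n x0 - limfun g x0) \<le> \<epsilon> / 3) F" for x0
    using tendstoD[OF limfun_tendsto[OF g] \<epsilon>3, of x0] by (rule eventually_mono) (simp add: dist_norm)
  then have "eventually (\<lambda>n. \<forall>x0\<in>X. norm (?u n x0 - limfun g x0) \<le> \<epsilon> / 3) F"
    using X(2) by (intro eventually_ball_finite) auto
  then show ?thesis
  proof (rule eventually_mono, intro ballI)
    fix n x assume n: "\<forall>x0\<in>X. norm (?u n x0 - limfun g x0) \<le> \<epsilon> / 3" and "x \<in> C"
    then obtain x0 where x0: "x0 \<in> X" "x \<in> A x0" using X(3) by blast
    have "norm (?u n x - limfun g x) = norm ((?u n x - ?u n x0) + (?u n x0 - limfun g x0) - (limfun g x - limfun g x0))" by simp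
    also have "\<dots> \<le> norm (?u n x - ?u n x0) + norm (?u n x0 - limfun g x0) + norm (limfun g x - limfun g x0)"
      by (rule order_trans[OF norm_triangle_ineq4 add_right_mono[OF norm_triangle_ineq]])
    also have "\<dots> \<le> \<epsilon> / 3 + \<epsilon> / 3 + \<epsilon> / 3" using A(3)[OF x0(2)] A(4)[OF x0(2)] n x0(1) by (intro add_mono) auto
    finally show "norm (?u n x - limfun g x) \<le> \<epsilon>" by simp
  qed
qed

lemma limfun_integral_tendsto:
  assumes g: "g \<in> Dens" and t: "radon_prob \<tau>"
  shows "((\<lambda>n. \<integral>x. approx g n x \<partial>\<tau>) \<longlongrightarrow> (\<integral>x. limfun g x \<partial>\<tau>)) F"
proof (rule tendstoI)
  fix \<epsilon> :: real assume \<epsilon>: "0 < \<epsilon>"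
  have B0: "0 \<le> B" by (rule bounded_borelD(3)[OF p])
  define \<delta> where "\<delta> = \<epsilon> / (4 * (B + 1))"
  have \<delta>: "0 < \<delta>" using \<epsilon> B0 by (simp add: \<delta>_def)
  have "4 * (B + 1) * \<delta> = \<epsilon>" using B0 by (simp add: \<delta>_def)
  then have \<delta>': "2 * B * \<delta> < \<epsilon> / 2" using \<delta> by (simp add: algebra_simps)
  obtain C where C: "compact C" "measure \<tau> (- C) < \<delta>" using radon_prob_tight[OF t \<delta>] by blast
  have \<epsilon>2: "0 < \<epsilon> / 2" using \<epsilon> by simp
  note bb = bounded_borelD[OF kint_bounded_borel[OF right_kernel[OF g] avg_bb]]
  note bu = bounded_borelD[OF limfun_bb[OF g]]
  from limfun_uniform[OF g C(1) \<epsilon>2]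
  show "eventually (\<lambda>n. dist (\<integral>x. approx g n x \<partial>\<tau>) (\<integral>x. limfun g x \<partial>\<tau>) < \<epsilon>) F"
  proof (rule eventually_mono)
    fix n assume n: "\<forall>x\<in>C. norm (approx g n x - limfun g x) \<le> \<epsilon> / 2"
    have "norm ((\<integral>x. approx g n x \<partial>\<tau>) - (\<integral>x. limfun g x \<partial>\<tau>)) \<le> \<epsilon> / 2 + 2 * B * \<delta>"
      using n C(2) \<epsilon> by (intro radon_prob_integral_close[OF t bb(1) bu(1) bb(2) bu(2) C(1)]) auto
    then show "dist (\<integral>x. approx g n x \<partial>\<tau>) (\<integral>x. limfun g x \<partial>\<tau>) < \<epsilon>"
      using \<delta>' by (simp add: dist_norm)
  qed
qed

text \<open>The walk operator passes to the limit by tightness of \<open>walk x\<close>. It commutes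
  with \<open>right g\<close>, so it moves \<open>approx g n\<close> by at most
  \<open>2 * B / (n + 1)\<close>, which tends to 0 along \<open>F\<close> because \<open>F\<close>
  refines \<open>sequentially\<close>.\<close>

lemma limfun_harmonic: assumes g: "g \<in> Dens" shows "kint walk (limfun g) = limfun g"
proof
  fix x
  let ?u = "\<lambda>n. approx g n"
  note rp = radon_kernelD(1)[OF right_kernel[OF g], of x]
  have *: "((\<lambda>n. kint walk (?u n) x) \<longlongrightarrow> kint walk (limfun g) x) F"
    unfolding kint_def[of walk] by (rule limfun_integral_tendsto[OF g radon_kernelD(1)[OF walk_kernel]])
  have diff: "norm (kint walk (?u n) x - ?u n x) \<le> 2 * B / Suc n" for n
  proof -
    have k: "kint walk (avg walk n \<phi>) \<in> bounded_borel B" by (rule kint_bounded_borel[OF walk_kernel avg_bb])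
    have "kint walk (?u n) x - ?u n x = (\<integral>w. kint walk (avg walk n \<phi>) w - avg walk n \<phi> w \<partial>right g x)"
      unfolding kint_walk_right[OF g avg_bb] unfolding kint_def[of "right g"]
      by (rule Bochner_Integration.integral_diff[symmetric]) (rule bounded_borel_integrable[OF rp k] bounded_borel_integrable[OF rp avg_bb])+
    moreover have "norm (\<integral>w. kint walk (avg walk n \<phi>) w - avg walk n \<phi> w \<partial>right g x) \<le> 2 * B / Suc n"
      using bounded_borelD(1)[OF k] bounded_borelD(1)[OF avg_bb[of n]]
      by (intro radon_prob_norm_integral_le[OF rp] kint_avg_diff[OF walk_kernel p]) measurable
    ultimately show ?thesis by simp
  qed
  have "(\<lambda>n. 2 * B / real (Suc n)) \<longlonglongrightarrow> 0"
    using tendsto_mult[OF tendsto_const LIMSEQ_inverse_real_of_nat, of "2 * B"] by (simp add: divide_inverse)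
  then have "((\<lambda>n. kint walk (?u n) x - ?u n x) \<longlongrightarrow> 0) sequentially"
    by (rule Lim_null_comparison[rotated]) (rule always_eventually, rule allI, rule diff)
  then have "((\<lambda>n. kint walk (?u n) x - ?u n x) \<longlongrightarrow> 0) F" by (rule tendsto_mono[OF F(2)])
  from Lim_transform[OF limfun_tendsto[OF g] this] * show "kint walk (limfun g) x = limfun g x"
    using tendsto_unique[OF F(1)] by blast
qed

text \<open>The Liouville property gives a constant only locally almost everywhere; integrating
  against a density removes the exceptional set, so the same \<open>c\<close> serves every
  \<open>h\<close>.\<close>

lemma limfun_const:
  assumes g: "g \<in> Dens"
  obtains c where "\<And>h. h \<in> Dens \<Longrightarrow> ((\<lambda>n. \<integral>x. approx g n x \<partial>den h) \<longlongrightarrow> c) F"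
proof -
  have "mconv cv iv \<sigma> (limfun g) = limfun g"
    using mconv_eq_kint[OF limfun_bb[OF g]] limfun_harmonic[OF g] by simp
  then have "limfun g \<in> Hinf_sigma cv iv \<omega> \<sigma>"
    using bounded_borel_Linf[OF limfun_bb[OF g]] locally_null_empty by (auto simp: Hinf_sigma_def loc_ae_eq_def)
  then obtain c N where N: "locally_null \<omega> N" "{x. limfun g x \<noteq> c} \<subseteq> N"
    using liouville unfolding loc_ae_eq_def by blast
  show ?thesis
  proof (rule that[of c])
    fix h assume h: "h \<in> Dens"
    have rp: "radon_prob (den h)" by (rule radon_prob_den[OF h])
    have "emeasure (den h) N = 0" by (rule den_locally_null[OF DensD(1)[OF h] N(1)])
    moreover have "N \<in> sets (den h)" using N(1) by (simp add: locally_null_def sets_den)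
    ultimately have "AE x in den h. x \<notin> N" by (intro AE_not_in null_setsI)
    then have ae: "AE x in den h. limfun g x = c" using N(2) by (auto elim!: eventually_mono)
    have "limfun g \<in> borel_measurable (den h)"
      using bounded_borelD(1)[OF limfun_bb[OF g]] sets_den by (simp cong: measurable_cong_sets)
    then have "(\<integral>x. limfun g x \<partial>den h) = (\<integral>x. c \<partial>den h)" using ae by (intro integral_cong_AE) auto
    also have "\<dots> = c" using radon_probD(5,6)[OF rp] by simp
    finally show "((\<lambda>n. \<integral>x. approx g n x \<partial>den h) \<longlongrightarrow> c) F"
      using limfun_integral_tendsto[OF g rp] by simp
  qed
qed

lemma Lambda_const:
  assumes g: "g \<in> Dens" and h: "h \<in> Dens" shows "\<Lambda> g = \<Lambda> h"
proof -
  have B0: "0 \<le> B" by (rule bounded_borelD(3)[OF p])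
  have "norm (\<Lambda> g - \<Lambda> h) \<le> 0"
  proof (rule field_le_epsilon)
    fix \<epsilon> :: real assume \<epsilon>: "0 < \<epsilon>"
    define \<delta> where "\<delta> = \<epsilon> / (2 * (B + 1))"
    have \<delta>: "0 < \<delta>" using \<epsilon> B0 by (simp add: \<delta>_def)
    have "2 * (B + 1) * \<delta> = \<epsilon>" using B0 by (simp add: \<delta>_def)
    then have \<delta>': "B * \<delta> \<le> \<epsilon> / 2" using \<delta> by (simp add: algebra_simps)
    obtain V1 where V1: "open V1" "e \<in> V1" "\<And>k. k \<in> Dens \<Longrightarrow> (\<And>x. k (iv x) = k x) \<Longrightarrow> (\<And>x. x \<notin> V1 \<Longrightarrow> k x = 0)
      \<Longrightarrow> (\<integral>x. \<bar>J k g x - g x\<bar> \<partial>\<omega>) \<le> \<delta>" using J_L1_approx[OF g \<delta>] by metis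
    obtain V2 where V2: "open V2" "e \<in> V2" "\<And>k. k \<in> Dens \<Longrightarrow> (\<And>x. k (iv x) = k x) \<Longrightarrow> (\<And>x. x \<notin> V2 \<Longrightarrow> k x = 0)
      \<Longrightarrow> (\<integral>x. \<bar>J k h x - h x\<bar> \<partial>\<omega>) \<le> \<delta>" using J_L1_approx[OF h \<delta>] by metis
    obtain k where k: "k \<in> Dens" "\<And>x. k (iv x) = k x" "\<And>x. x \<notin> V1 \<inter> V2 \<Longrightarrow> k x = 0"
      using symmetric_Dens[of "V1 \<inter> V2"] V1(1,2) V2(1,2) by (metis IntI open_Int)
    have kV: "\<And>x. x \<notin> V1 \<Longrightarrow> k x = 0" "\<And>x. x \<notin> V2 \<Longrightarrow> k x = 0" using k(3) by blast+
    obtain c where c: "\<And>h. h \<in> Dens \<Longrightarrow> ((\<lambda>n. \<integral>x. approx k n x \<partial>den h) \<longlongrightarrow> c) F"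
      using limfun_const[OF k(1)] by metis
    have close: "norm (c - \<Lambda> f) \<le> \<epsilon> / 2" if f: "f \<in> Dens" and "(\<integral>x. \<bar>J k f x - f x\<bar> \<partial>\<omega>) \<le> \<delta>" for f
    proof (rule Lim_norm_ubound[OF F(1) tendsto_diff[OF c[OF f] lim[OF f]]], rule always_eventually, rule allI)
      fix n
      \<comment> \<open>Integrating the right translate against \<open>f\<close> amounts to
        integrating the Cesaro mean against the convolution \<open>J k f\<close>, which is close to
        \<open>f\<close> in \<open>L1\<close> uniformly in \<open>n\<close>.\<close>
      have "(\<integral>x. approx k n x \<partial>den f) = (\<integral>x. avg walk n \<phi> x \<partial>den (J k f))"
        unfolding bind_right_eq_J(2)[OF k(1,2) f, symmetric]
        by (rule integral_bind_bounded[OF radon_prob_den[OF f] right_kernel[OF k(1)] avg_bb, symmetric])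
      then have "norm ((\<integral>x. approx k n x \<partial>den f) - (\<integral>x. avg walk n \<phi> x \<partial>den f)) \<le> B * (\<integral>x. \<bar>J k f x - f x\<bar> \<partial>\<omega>)"
        using den_diff[OF bind_right_eq_J(1)[OF k(1,2) f] f avg_bb[of n]] by simp
      also have "\<dots> \<le> B * \<delta>" using that(2) B0 by (rule mult_left_mono)
      finally show "norm ((\<integral>x. approx k n x \<partial>den f) - (\<integral>x. avg walk n \<phi> x \<partial>den f)) \<le> \<epsilon> / 2"
        using \<delta>' by simp
    qed
    have "norm (\<Lambda> g - \<Lambda> h) = norm ((c - \<Lambda> h) - (c - \<Lambda> g))" by simp
    also have "\<dots> \<le> norm (c - \<Lambda> h) + norm (c - \<Lambda> g)" by (rule norm_triangle_ineq4)
    also have "\<dots> \<le> \<epsilon> / 2 + \<epsilon> / 2"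
      by (intro add_mono close g h V1(3)[OF k(1,2) kV(1)] V2(3)[OF k(1,2) kV(2)])
    finally show "norm (\<Lambda> g - \<Lambda> h) \<le> 0 + \<epsilon>" by simp
  qed
  then show ?thesis by simp
qed

text \<open>All translates of \<open>g\<close> are densities, so \<open>Lambda_const\<close> makes
  \<open>limfun g\<close> constant at every point. This is the invariance of the mean, still in
  terms of the inverted function.\<close>

lemma right_limit:
  assumes g: "g \<in> Dens" and h: "h \<in> Dens"
  shows "((\<lambda>n. \<integral>x. avg walk n (kint (right g) \<phi>) x \<partial>den h) \<longlongrightarrow> \<Lambda> h) F"
proof -
  have "limfun g = (\<lambda>_. \<Lambda> h)" unfolding limfun_def using Lambda_const[OF trl_Dens[OF g] h] by auto
  then have "(\<integral>x. limfun g x \<partial>den h) = \<Lambda> h" using radon_probD(5,6)[OF radon_prob_den[OF h]] by simp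
  then show ?thesis using limfun_integral_tendsto[OF g radon_prob_den[OF h]] unfolding avg_right[OF g p] by simp
qed

end

end

context haar_hypergroup begin

section \<open>Density of compactly supported functions in \<open>L\<^sup>1\<close>\<close>

text \<open>Inner regularity is given for open sets, so the compact set is chosen inside an open
  \<open>U\<close> around \<open>A\<close> rather than inside \<open>A\<close>; each of the two
  approximations costs \<open>\<delta>\<close>.\<close>

lemma haar_approx_set:
  assumes A: "A \<in> sets borel" "emeasure \<omega> A < \<infinity>" and \<delta>: "0 < (\<delta>::real)"
  obtains h where "h \<in> Cc" "(\<integral>x. \<bar>indicator A x - h x\<bar> \<partial>\<omega>) < 2 * \<delta>"
proof -
  have Afin: "emeasure \<omega> A = ennreal (measure \<omega> A)" using A(2) by (intro emeasure_eq_ennreal_measure) auto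
  have "emeasure \<omega> A = (INF U\<in>{U. open U \<and> A \<subseteq> U}. emeasure \<omega> U)"
    using haar A(1) unfolding left_haar_def radon_measure_def by blast
  moreover have "emeasure \<omega> A < ennreal (measure \<omega> A + \<delta>)" unfolding Afin using \<delta> by (intro ennreal_lessI) (auto intro: add_nonneg_pos)
  ultimately obtain U where U: "open U" "A \<subseteq> U" "emeasure \<omega> U < ennreal (measure \<omega> A + \<delta>)"
    by (auto simp: INF_less_iff)
  have Ufin': "emeasure \<omega> U < \<infinity>" using U(3) by (auto intro: less_le_trans)
  have Ufin: "emeasure \<omega> U = ennreal (measure \<omega> U)" using Ufin' by (intro emeasure_eq_ennreal_measure) auto
  have mU: "measure \<omega> U < measure \<omega> A + \<delta>" using U(3) unfolding Ufin by (metis ennreal_leI not_le)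
  obtain C where C: "compact C" "C \<subseteq> U" "measure \<omega> U - \<delta> < measure \<omega> C"
    using haar_inner_compact[OF U(1) Ufin' \<delta>] .
  obtain h where h: "h \<in> urysohn_family U" "\<And>x. x \<in> C \<Longrightarrow> h x = 1" using urysohn_Cc[OF C(1) U(1) C(2)] by blast
  have H: "h \<in> Cc" "\<And>x. 0 \<le> h x" "\<And>x. h x \<le> 1" "\<And>x. x \<notin> U \<Longrightarrow> h x = 0" using h by (auto simp: urysohn_family_def)
  have iA: "integrable \<omega> (indicat_real A)" using A by (intro integrable_real_indicator) (auto simp: sets_haar)
  have iU: "integrable \<omega> (indicat_real U)" using U Ufin' by (intro integrable_real_indicator) (auto simp: sets_haar)
  have iC: "integrable \<omega> (indicat_real C)" using C(1) haar_compact[OF C(1)] by (intro integrable_real_indicator) (auto simp: sets_haar borel_compact)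
  have "(\<integral>x. \<bar>indicator A x - h x\<bar> \<partial>\<omega>) \<le> (\<integral>x. (indicator U x - indicator A x) + (indicator U x - indicator C x) \<partial>\<omega>)"
  proof (rule integral_mono)
    fix x
    show "\<bar>indicator A x - h x\<bar> \<le> (indicator U x - indicator A x) + (indicator U x - indicat_real C x)"
    proof (cases "x \<in> C")
      case True
      then show ?thesis using h(2) U(2) C(2) by (auto simp: indicator_def)
    next
      case False
      then show ?thesis using H(2,3,4)[of x] U(2) by (auto simp: indicator_def)
    qed
  qed (use iA iU iC Cc_haar_integrable[OF H(1)] in auto)
  also have "\<dots> = (measure \<omega> U - measure \<omega> A) + (measure \<omega> U - measure \<omega> C)"
    using iA iU iC by (simp add: space_haar)
  also have "\<dots> < 2 * \<delta>" using mU C(3) by simp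
  finally show ?thesis using that H(1) by blast
qed

abbreviation cplx :: "('a \<Rightarrow> real) \<Rightarrow> ('a \<Rightarrow> real) \<Rightarrow> 'a \<Rightarrow> complex" where
  "cplx a b x \<equiv> of_real (a x) + \<i> * of_real (b x)"

lemma Complex_Cc_integrable: "h1 \<in> Cc \<Longrightarrow> h2 \<in> Cc \<Longrightarrow> integrable \<omega> (\<lambda>x. cplx h1 h2 x)"
  by (intro Bochner_Integration.integrable_add integrable_of_real integrable_mult_right Cc_haar_integrable)

lemma Cc_dense_L1:
  fixes g :: "'a \<Rightarrow> complex"
  assumes "integrable \<omega> g"
  shows "\<forall>\<epsilon>>0. \<exists>h1\<in>Cc. \<exists>h2\<in>Cc. (\<integral>x. norm (g x - cplx h1 h2 x) \<partial>\<omega>) < \<epsilon>"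
  using assms
proof (induction g rule: integrable_induct)
  case (base A c)
  show ?case
  proof (intro allI impI)
    fix \<epsilon> :: real assume \<epsilon>: "0 < \<epsilon>"
    define \<delta> where "\<delta> = \<epsilon> / (2 * (norm c + 1))"
    have "0 < 2 * (norm c + 1)" by (simp add: add_nonneg_pos)
    then have \<delta>: "0 < \<delta>" "2 * (norm c + 1) * \<delta> = \<epsilon>" using \<epsilon> by (auto simp: \<delta>_def)
    obtain h where h: "h \<in> Cc" "(\<integral>x. \<bar>indicator A x - h x\<bar> \<partial>\<omega>) < 2 * \<delta>"
      using haar_approx_set[OF _ _ \<delta>(1), of A] base by (auto simp: sets_haar)
    have "norm (indicator A x *\<^sub>R c - (of_real (Re c * h x) + \<i> * of_real (Im c * h x))) = norm c * \<bar>indicator A x - h x\<bar>" for x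
    proof -
      have "indicator A x *\<^sub>R c - (of_real (Re c * h x) + \<i> * of_real (Im c * h x)) = (indicator A x - h x) *\<^sub>R c"
        by (simp add: complex_eq_iff algebra_simps)
      then show ?thesis by simp
    qed
    then have "(\<integral>x. norm (indicator A x *\<^sub>R c - (of_real (Re c * h x) + \<i> * of_real (Im c * h x))) \<partial>\<omega>)
        = norm c * (\<integral>x. \<bar>indicator A x - h x\<bar> \<partial>\<omega>)" by simp
    also have "\<dots> \<le> norm c * (2 * \<delta>)" using h(2) by (intro mult_left_mono) auto
    also have "\<dots> < \<epsilon>" using \<delta> by (simp add: algebra_simps)
    finally show "\<exists>h1\<in>Cc. \<exists>h2\<in>Cc. (\<integral>x. norm (indicator A x *\<^sub>R c - cplx h1 h2 x) \<partial>\<omega>) < \<epsilon>"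
      by (intro bexI[of _ "\<lambda>x. Re c * h x"] bexI[of _ "\<lambda>x. Im c * h x"] Cc_scale[OF h(1)])
  qed
next
  case (add f g)
  show ?case
  proof (intro allI impI)
    fix \<epsilon> :: real assume "0 < \<epsilon>"
    then have "0 < \<epsilon> / 2" by simp
    from add(3)[rule_format, OF this] add(4)[rule_format, OF this]
    obtain a b a' b' where ab: "a \<in> Cc" "b \<in> Cc" "(\<integral>x. norm (f x - cplx a b x) \<partial>\<omega>) < \<epsilon> / 2"
      and ab': "a' \<in> Cc" "b' \<in> Cc" "(\<integral>x. norm (g x - cplx a' b' x) \<partial>\<omega>) < \<epsilon> / 2" by blast
    note i = Complex_Cc_integrable[OF ab(1,2)] Complex_Cc_integrable[OF ab'(1,2)] Complex_Cc_integrable[OF Cc_add[OF ab(1) ab'(1)] Cc_add[OF ab(2) ab'(2)]]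
    have "(\<integral>x. norm (f x + g x - (of_real (a x + a' x) + \<i> * of_real (b x + b' x))) \<partial>\<omega>)
      \<le> (\<integral>x. norm (f x - cplx a b x) + norm (g x - cplx a' b' x) \<partial>\<omega>)"
    proof (rule integral_mono)
      fix x
      have "f x + g x - (of_real (a x + a' x) + \<i> * of_real (b x + b' x))
        = (f x - cplx a b x) + (g x - cplx a' b' x)" by (simp add: algebra_simps)
      then show "norm (f x + g x - (of_real (a x + a' x) + \<i> * of_real (b x + b' x)))
        \<le> norm (f x - cplx a b x) + norm (g x - cplx a' b' x)"
        by (simp only: norm_triangle_ineq)
    qed (use i add(1,2) in \<open>auto intro!: integrable_norm Bochner_Integration.integrable_add Bochner_Integration.integrable_diff simp del: of_real_add\<close>)
    also have "\<dots> = (\<integral>x. norm (f x - cplx a b x) \<partial>\<omega>) + (\<integral>x. norm (g x - cplx a' b' x) \<partial>\<omega>)"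
      using i add(1,2) by (intro Bochner_Integration.integral_add integrable_norm Bochner_Integration.integrable_diff)
    also have "\<dots> < \<epsilon>" using ab(3) ab'(3) by simp
    finally show "\<exists>h1\<in>Cc. \<exists>h2\<in>Cc. (\<integral>x. norm (f x + g x - cplx h1 h2 x) \<partial>\<omega>) < \<epsilon>"
      by (intro bexI[of _ "\<lambda>x. a x + a' x"] bexI[of _ "\<lambda>x. b x + b' x"] Cc_add ab ab')
  qed
next
  case (lim f s)
  show ?case
  proof (intro allI impI)
    fix \<epsilon> :: real assume "0 < \<epsilon>"
    then have \<epsilon>2: "0 < \<epsilon> / 2" by simp
    have "(\<lambda>i. \<integral>x. norm (f x - s i x) \<partial>\<omega>) \<longlonglongrightarrow> (\<integral>x. 0 \<partial>\<omega>)"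
    \<comment> \<open>The approximants of the induction rule satisfy
      \<open>norm (s i x) \<le> 2 * norm (f x)\<close>, hence the factor 3.\<close>
    proof (rule integral_dominated_convergence[where w="\<lambda>x. 3 * norm (f x)"])
      show "AE x in \<omega>. (\<lambda>i. norm (f x - s i x)) \<longlonglongrightarrow> 0"
      proof (rule AE_I2)
        fix x assume "x \<in> space \<omega>"
        from tendsto_diff[OF tendsto_const lim.hyps(2)[OF this], of "f x"] show "(\<lambda>i. norm (f x - s i x)) \<longlonglongrightarrow> 0"
          by (intro tendsto_norm_zero) simp
      qed
      show "AE x in \<omega>. norm (norm (f x - s i x)) \<le> 3 * norm (f x)" for i
      proof (rule AE_I2)
        fix x assume "x \<in> space \<omega>"
        from lim.hyps(3)[OF this, of i] norm_triangle_ineq4[of "f x" "s i x"] show "norm (norm (f x - s i x)) \<le> 3 * norm (f x)" by simp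
      qed
    qed (use lim.hyps(1,4) in \<open>auto intro!: borel_measurable_norm borel_measurable_diff borel_measurable_integrable\<close>)
    then have "(\<lambda>i. \<integral>x. norm (f x - s i x) \<partial>\<omega>) \<longlonglongrightarrow> 0" by simp
    then have "eventually (\<lambda>i. (\<integral>x. norm (f x - s i x) \<partial>\<omega>) < \<epsilon> / 2) sequentially" using \<epsilon>2 by (rule order_tendstoD)
    then obtain i where i: "(\<integral>x. norm (f x - s i x) \<partial>\<omega>) < \<epsilon> / 2" by (auto simp: eventually_sequentially)
    from lim.IH[of i, rule_format, OF \<epsilon>2]
    obtain a b where ab: "a \<in> Cc" "b \<in> Cc" "(\<integral>x. norm (s i x - cplx a b x) \<partial>\<omega>) < \<epsilon> / 2" by blast
    note I = Complex_Cc_integrable[OF ab(1,2)]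
    have "(\<integral>x. norm (f x - cplx a b x) \<partial>\<omega>)
      \<le> (\<integral>x. norm (f x - s i x) + norm (s i x - cplx a b x) \<partial>\<omega>)"
    proof (rule integral_mono)
      fix x
      show "norm (f x - cplx a b x) \<le> norm (f x - s i x) + norm (s i x - cplx a b x)"
        using dist_triangle[of "f x" "cplx a b x" "s i x"] unfolding dist_norm .
    qed (use I lim.hyps(1,4) in \<open>auto intro!: integrable_norm Bochner_Integration.integrable_add Bochner_Integration.integrable_diff\<close>)
    also have "\<dots> = (\<integral>x. norm (f x - s i x) \<partial>\<omega>) + (\<integral>x. norm (s i x - cplx a b x) \<partial>\<omega>)"
      using I lim.hyps(1,4) by (intro Bochner_Integration.integral_add integrable_norm Bochner_Integration.integrable_diff)
    also have "\<dots> < \<epsilon>" using i ab(3) by simp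
    finally show "\<exists>h1\<in>Cc. \<exists>h2\<in>Cc. (\<integral>x. norm (f x - cplx h1 h2 x) \<partial>\<omega>) < \<epsilon>"
      using ab(1,2) by (intro bexI[of _ a] bexI[of _ b])
  qed
qed

lemma Cc_locally_null_AE:
  assumes h: "h \<in> Cc" and N: "locally_null \<omega> N" shows "AE x in \<omega>. x \<in> N \<longrightarrow> h x = 0"
proof -
  have Nb: "N \<in> sets borel" using N by (simp add: locally_null_def)
  \<comment> \<open>\<open>den\<close> only sees the positive part of a function; the negative part
    is reached through \<open>- h\<close>.\<close>
  have "(\<lambda>x. - 1 * h x) \<in> Cc" by (rule Cc_scale[OF h])
  from den_locally_null[OF this N] den_locally_null[OF h N]
  have "AE x in \<omega>. x \<in> N \<longrightarrow> - 1 * h x \<le> 0" "AE x in \<omega>. x \<in> N \<longrightarrow> h x \<le> 0"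
    using den_null_iff[OF _ Nb] h \<open>(\<lambda>x. - 1 * h x) \<in> Cc\<close> by auto
  then show ?thesis by eventually_elim auto
qed

text \<open>On \<open>N\<close> the approximants from \<open>Cc\<close> vanish almost everywhere, so
  the mass of \<open>g\<close> on \<open>N\<close> is bounded by the approximation error. This
  bridges locally null and null sets.\<close>

lemma integrable_locally_null_AE:
  fixes g :: "'a \<Rightarrow> complex"
  assumes g: "integrable \<omega> g" and N: "locally_null \<omega> N"
  shows "AE x in \<omega>. x \<in> N \<longrightarrow> g x = 0"
proof -
  have Ns: "N \<in> sets \<omega>" using N by (simp add: locally_null_def sets_haar)
  have int: "integrable \<omega> (\<lambda>x. norm (g x) * indicator N x)"
    using integrable_mult_indicator[OF Ns integrable_norm[OF g]] by (simp add: mult.commute)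
  have "(\<integral>x. norm (g x) * indicator N x \<partial>\<omega>) \<le> 0"
  proof (rule field_le_epsilon)
    fix \<epsilon> :: real assume "0 < \<epsilon>"
    with Cc_dense_L1[OF g] obtain a b where ab: "a \<in> Cc" "b \<in> Cc" "(\<integral>x. norm (g x - cplx a b x) \<partial>\<omega>) < \<epsilon>"
      by blast
    have "(\<integral>x. norm (g x) * indicator N x \<partial>\<omega>) \<le> (\<integral>x. norm (g x - cplx a b x) \<partial>\<omega>)"
    proof (rule integral_mono_AE[OF int])
      show "integrable \<omega> (\<lambda>x. norm (g x - cplx a b x))"
        by (intro integrable_norm Bochner_Integration.integrable_diff g Complex_Cc_integrable ab)
      show "AE x in \<omega>. norm (g x) * indicator N x \<le> norm (g x - cplx a b x)"
        using Cc_locally_null_AE[OF ab(1) N] Cc_locally_null_AE[OF ab(2) N] by eventually_elim (auto simp: indicator_def)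
    qed
    then show "(\<integral>x. norm (g x) * indicator N x \<partial>\<omega>) \<le> 0 + \<epsilon>" using ab(3) by simp
  qed
  moreover have "0 \<le> (\<integral>x. norm (g x) * indicator N x \<partial>\<omega>)" by (intro Bochner_Integration.integral_nonneg) simp
  ultimately have "AE x in \<omega>. norm (g x) * indicator N x = 0"
    using integral_nonneg_eq_0_iff_AE[OF int] by simp
  then show ?thesis by eventually_elim (auto simp: indicator_def)
qed

lemma Cc_Dens_decomp:
  assumes h: "h \<in> Cc"
  obtains a b g1 g2 where "g1 \<in> Dens" "g2 \<in> Dens" "h = (\<lambda>x. a * g1 x - b * g2 x)"
proof -
  have nonneg: "\<exists>a g. g \<in> Dens \<and> f = (\<lambda>x. a * g x)" if f: "f \<in> Cc" "\<And>x. 0 \<le> f x" for f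
  proof (cases "\<exists>x. 0 < f x")
    case True
    then obtain x where "0 < f x" by blast
    note n = normalize_Dens[OF f this]
    then have "f = (\<lambda>x. (\<integral>x. f x \<partial>\<omega>) * (inverse (\<integral>x. f x \<partial>\<omega>) * f x))" by (auto simp: field_simps)
    then show ?thesis using n(2) by blast
  next
    case False
    \<comment> \<open>The zero function cannot be normalised; it is written as 0 times an arbitrary
      density.\<close>
    obtain g where "g \<in> Dens" using Dens_at by blast
    moreover have "f = (\<lambda>x. 0 * g x)" using False f(2) by (auto simp: fun_eq_iff not_less intro!: antisym)
    ultimately show ?thesis by blast
  qed
  have z: "(\<lambda>_. 0) \<in> Cc" by (auto simp: Cc_def intro: exI[of _ "{}"])
  obtain a g1 where 1: "g1 \<in> Dens" "(\<lambda>x. max (h x) 0) = (\<lambda>x. a * g1 x)" using nonneg[OF Cc_max[OF h z]] by auto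
  obtain b g2 where 2: "g2 \<in> Dens" "(\<lambda>x. max (- 1 * h x) 0) = (\<lambda>x. b * g2 x)" using nonneg[OF Cc_max[OF Cc_scale[OF h, of "- 1"] z]] by auto
  have "h = (\<lambda>x. max (h x) 0 - max (- 1 * h x) 0)" by (auto simp: max_def)
  then have "h = (\<lambda>x. a * g1 x - b * g2 x)" using fun_cong[OF 1(2)] fun_cong[OF 2(2)] by (simp add: fun_eq_iff)
  then show ?thesis using that 1(1) 2(1) by blast
qed

section \<open>Convolution with integrable functions\<close>

abbreviation conv :: "('a \<Rightarrow> complex) \<Rightarrow> ('a \<Rightarrow> complex) \<Rightarrow> 'a \<Rightarrow> complex" where
  "conv \<equiv> fconv cv iv \<omega>"

lemma hfun_measurable:
  assumes f: "f \<in> borel_measurable borel" shows "(\<lambda>y. hfun cv f (iv y) x) \<in> borel_measurable borel"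
  unfolding hfun_def by (rule kernel_integral_measurable[OF radon_kernel_measurable[OF radon_kernel_sections(2)[OF cv_iv_kernel]] f])

lemma fconv_integrable:
  assumes g: "integrable \<omega> g" and f: "f \<in> bounded_borel B"
  shows "integrable \<omega> (\<lambda>y. g y * hfun cv f (iv y) x)" "norm (conv g f x) \<le> B * (\<integral>y. norm (g y) \<partial>\<omega>)"
proof -
  note f' = bounded_borelD[OF f]
  have b: "norm (hfun cv f (iv y) x) \<le> B" for y
    unfolding hfun_def by (rule bounded_borel_integral_le[OF cv_radon f])
  have le: "norm (g y * hfun cv f (iv y) x) \<le> B * norm (g y)" for y
    using mult_left_mono[OF b[of y], of "norm (g y)"] by (simp add: norm_mult mult.commute)
  show i: "integrable \<omega> (\<lambda>y. g y * hfun cv f (iv y) x)"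
  proof (rule Bochner_Integration.integrable_bound)
    show "integrable \<omega> (\<lambda>y. B * norm (g y))" using g by simp
    show "(\<lambda>y. g y * hfun cv f (iv y) x) \<in> borel_measurable \<omega>"
      using borel_measurable_integrable[OF g] haar_measurable[OF hfun_measurable[OF f'(1)]] by measurable
    show "AE y in \<omega>. norm (g y * hfun cv f (iv y) x) \<le> norm (B * norm (g y))"
      using le f'(3) by (intro AE_I2) simp
  qed
  have "norm (conv g f x) \<le> (\<integral>y. norm (g y * hfun cv f (iv y) x) \<partial>\<omega>)" unfolding fconv_def by (rule integral_norm_bound)
  also have "\<dots> \<le> (\<integral>y. B * norm (g y) \<partial>\<omega>)" using i g le by (intro integral_mono) auto
  finally show "norm (conv g f x) \<le> B * (\<integral>y. norm (g y) \<partial>\<omega>)" by simp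
qed

lemma fconv_lin:
  assumes "integrable \<omega> g" "integrable \<omega> h" and f: "f \<in> bounded_borel B"
  shows "conv (\<lambda>y. a * g y + b * h y) f x = a * conv g f x + b * conv h f x"
proof -
  note i = fconv_integrable(1)[OF assms(1) f, of x] fconv_integrable(1)[OF assms(2) f, of x]
  have "conv (\<lambda>y. a * g y + b * h y) f x = (\<integral>y. a * (g y * hfun cv f (iv y) x) + b * (h y * hfun cv f (iv y) x) \<partial>\<omega>)"
    unfolding fconv_def by (simp add: algebra_simps)
  also have "\<dots> = a * conv g f x + b * conv h f x"
    unfolding fconv_def using i by simp
  finally show ?thesis .
qed

text \<open>For fixed \<open>x\<close>, the \<open>y\<close> for which \<open>cv (iv y) x\<close>
  charges \<open>N\<close> form a translate of the inverted set and so are locally null; an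
  integrable \<open>g\<close> does not see them. Hence the convolutions agree at every
  point.\<close>

lemma fconv_locally_null:
  assumes g: "integrable \<omega> g" and f: "f \<in> borel_measurable borel" "f' \<in> borel_measurable borel"
    and N: "locally_null \<omega> N" and eq: "\<And>x. x \<notin> N \<Longrightarrow> f x = f' x"
  shows "conv g f = conv g f'"
proof
  fix x
  have Nb: "N \<in> sets borel" using N by (simp add: locally_null_def)
  have flip: "emeasure (cv (iv y) x) N = emeasure (cv (iv x) y) (iv -` N)" for y
    using cv_iv[of y "iv x"] Nb iv_measurable radon_probD(4,5)[OF cv_radon]
    by (simp add: emeasure_distr cong: measurable_cong_sets)
  have Z: "locally_null \<omega> {y. emeasure (cv (iv y) x) N \<noteq> 0}"
    unfolding flip by (rule locally_null_translate[OF locally_null_iv[OF N]])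
  have h: "hfun cv f (iv y) x = hfun cv f' (iv y) x" if "emeasure (cv (iv y) x) N = 0" for y
  proof -
    have "AE w in cv (iv y) x. w \<notin> N"
      using that Nb radon_probD(4)[OF cv_radon] by (intro AE_not_in null_setsI) auto
    then have "AE w in cv (iv y) x. f w = f' w" by eventually_elim (rule eq)
    then show ?thesis unfolding hfun_def using f radon_probD(4)[OF cv_radon]
      by (intro integral_cong_AE) (auto cong: measurable_cong_sets)
  qed
  show "conv g f x = conv g f' x"
    unfolding fconv_def
  proof (rule integral_cong_AE)
    show "AE y in \<omega>. g y * hfun cv f (iv y) x = g y * hfun cv f' (iv y) x"
      using integrable_locally_null_AE[OF g Z] by eventually_elim (use h in auto)
    show "(\<lambda>y. g y * hfun cv f (iv y) x) \<in> borel_measurable \<omega>" "(\<lambda>y. g y * hfun cv f' (iv y) x) \<in> borel_measurable \<omega>"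
      using borel_measurable_integrable[OF g] haar_measurable[OF hfun_measurable[OF f(1)]] haar_measurable[OF hfun_measurable[OF f(2)]]
      by measurable
  qed
qed

lemma bounded_borel_iv: "f \<in> bounded_borel B \<Longrightarrow> (\<lambda>x. f (iv x)) \<in> bounded_borel B"
  unfolding bounded_borel_def using measurable_compose[OF iv_measurable] by auto

text \<open>Inversion turns left convolution by \<open>g\<close> into the Markov operator of the
  right kernel, the one that commutes with the walk.\<close>

lemma fconv_Dens:
  assumes g: "g \<in> Dens" and f: "f \<in> bounded_borel B"
  shows "(\<lambda>x. conv (\<lambda>y. of_real (g y)) f (iv x)) = kint (\<lambda>x. den g \<bind> cv x) (\<lambda>x. f (iv x))"
    "conv (\<lambda>y. of_real (g y)) f \<in> bounded_borel B"
proof -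
  note f' = bounded_borelD[OF f]
  note fi = bounded_borel_iv[OF f]
  show eq: "(\<lambda>x. conv (\<lambda>y. of_real (g y)) f (iv x)) = kint (\<lambda>x. den g \<bind> cv x) (\<lambda>x. f (iv x))"
  proof
    fix x
    have "conv (\<lambda>y. of_real (g y)) f (iv x) = (\<integral>y. hfun cv f (iv y) (iv x) \<partial>den g)"
      unfolding fconv_def integral_den[OF DensD(1,2)[OF g] hfun_measurable[OF f'(1)]] by (simp add: scaleR_conv_of_real)
    also have "\<dots> = (\<integral>y. (\<integral>w. f (iv w) \<partial>cv x y) \<partial>den g)" unfolding hfun_def by (simp add: integral_cv_iv[OF f'(1)])
    also have "\<dots> = kint (\<lambda>x. den g \<bind> cv x) (\<lambda>x. f (iv x)) x"
      unfolding kint_def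
      by (rule integral_bind[OF radon_prob_den[OF g] radon_kernel_sections(1)[OF cv_kernel] bounded_borelD(1)[OF fi] bounded_borelD(2)[OF fi], symmetric])
    finally show "conv (\<lambda>y. of_real (g y)) f (iv x) = kint (\<lambda>x. den g \<bind> cv x) (\<lambda>x. f (iv x)) x" .
  qed
  have "(\<lambda>x. conv (\<lambda>y. of_real (g y)) f (iv (iv x))) \<in> bounded_borel B"
    unfolding fun_cong[OF eq] by (rule bounded_borel_iv[OF kint_bounded_borel[OF right_kernel[OF g] fi]])
  then show "conv (\<lambda>y. of_real (g y)) f \<in> bounded_borel B" by simp
qed

end

section \<open>The invariant mean\<close>

context liouville_walk begin

text \<open>The law of the walk after \<open>k\<close> steps with initial density \<open>g\<close>.
  These laws are absolutely continuous, so they integrate functions that are unbounded on a locally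
  null set; \<open>walk x\<close> offers no such guarantee.\<close>

definition nu :: "('a \<Rightarrow> real) \<Rightarrow> nat \<Rightarrow> 'a measure" where
  "nu g k = ((\<lambda>\<mu>. \<mu> \<bind> walk) ^^ k) (den g)"

lemma nu_radon_ac: assumes "g \<in> Dens" shows "radon_prob (nu g k) \<and> ac (nu g k)"
proof (induction k)
  case 0
  then show ?case using radon_prob_den[OF assms] ac_den[OF DensD(1)[OF assms]] by (simp add: nu_def)
next
  case (Suc k)
  then have "radon_prob (nu g k \<bind> walk)" "ac (nu g k \<bind> walk)"
    using radon_prob_bind[OF _ walk_kernel] ac_bind_convolution[OF _ _ sigma] unfolding walk_def[abs_def] by auto
  then show ?case by (simp add: nu_def)
qed

lemma nu_integral:
  assumes g: "g \<in> Dens" and p: "\<phi> \<in> bounded_borel B"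
  shows "(\<integral>x. (kint walk ^^ k) \<phi> x \<partial>den g) = (\<integral>x. \<phi> x \<partial>nu g k)"
  using p
proof (induction k arbitrary: \<phi>)
  case 0
  then show ?case by (simp add: nu_def)
next
  case (Suc k)
  have "(\<integral>x. (kint walk ^^ Suc k) \<phi> x \<partial>den g) = (\<integral>x. kint walk \<phi> x \<partial>nu g k)"
    unfolding funpow_Suc_right o_apply by (rule Suc.IH[OF kint_bounded_borel[OF walk_kernel Suc.prems]])
  also have "\<dots> = (\<integral>x. \<phi> x \<partial>(nu g k \<bind> walk))"
    using nu_radon_ac[OF g] by (intro integral_bind_bounded[OF _ walk_kernel Suc.prems, symmetric]) simp
  finally show ?case by (simp add: nu_def)
qed

lemma ac_integral_iv:
  fixes f :: "'a \<Rightarrow> complex"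
  assumes nu: "radon_prob \<nu>" "ac \<nu>" and f: "f \<in> borel_measurable borel"
    and N: "locally_null \<omega> N" and c: "\<And>x. x \<notin> N \<Longrightarrow> norm (f x) \<le> c"
  shows "integrable \<nu> (\<lambda>x. f (iv x))" "norm (\<integral>x. f (iv x) \<partial>\<nu>) \<le> c"
proof -
  note D = radon_probD[OF nu(1)]
  interpret prob_space \<nu> by (rule D)
  have N': "locally_null \<omega> (iv -` N)" by (rule locally_null_iv[OF N])
  have "AE x in \<nu>. x \<notin> iv -` N"
    using N' nu(2) D(4) by (intro AE_not_in null_setsI) (auto simp: ac_def locally_null_def)
  then have ae: "AE x in \<nu>. norm (f (iv x)) \<le> c" by eventually_elim (simp add: c)
  have "(\<lambda>x. f (iv x)) \<in> borel_measurable borel" by (rule measurable_compose[OF iv_measurable f])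
  then have m: "(\<lambda>x. f (iv x)) \<in> borel_measurable \<nu>" using D(4) by (simp cong: measurable_cong_sets)
  show i: "integrable \<nu> (\<lambda>x. f (iv x))" by (rule integrable_const_bound[OF ae m])
  have "norm (\<integral>x. f (iv x) \<partial>\<nu>) \<le> (\<integral>x. norm (f (iv x)) \<partial>\<nu>)" by (rule integral_norm_bound)
  also have "\<dots> \<le> c" using i ae by (intro integral_le_const) auto
  finally show "norm (\<integral>x. f (iv x) \<partial>\<nu>) \<le> c" .
qed

lemma LinfE:
  assumes "f \<in> Linf \<omega>"
  obtains c N where "f \<in> borel_measurable borel" "0 \<le> c" "locally_null \<omega> N" "\<And>x. x \<notin> N \<Longrightarrow> norm (f x) \<le> c"
proof -
  obtain c N where N: "f \<in> borel_measurable borel" "locally_null \<omega> N" "{x. norm (f x) > c} \<subseteq> N"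
    using assms by (auto simp: Linf_def)
  have "norm (f x) \<le> max 0 c" if "x \<notin> N" for x
  proof -
    have "\<not> norm (f x) > c" using N(3) that by blast
    then show ?thesis by simp
  qed
  then show ?thesis using that[of "max 0 c" N] N by simp
qed

lemma ess_norm_ge:
  assumes f: "f \<in> Linf \<omega>" and r: "\<And>c N. 0 \<le> c \<Longrightarrow> locally_null \<omega> N \<Longrightarrow> (\<And>x. x \<notin> N \<Longrightarrow> norm (f x) \<le> c) \<Longrightarrow> r \<le> c"
  shows "r \<le> ess_norm \<omega> f"
  unfolding ess_norm_def
proof (rule cInf_greatest)
  obtain c N where "0 \<le> c" "locally_null \<omega> N" "\<And>x. x \<notin> N \<Longrightarrow> norm (f x) \<le> c" using LinfE[OF f] by metis
  then have "c \<in> {c. 0 \<le> c \<and> (\<exists>N. locally_null \<omega> N \<and> {x. norm (f x) > c} \<subseteq> N)}" by (auto simp: not_le[symmetric])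
  then show "{c. 0 \<le> c \<and> (\<exists>N. locally_null \<omega> N \<and> {x. norm (f x) > c} \<subseteq> N)} \<noteq> {}" by blast
next
  fix c assume "c \<in> {c. 0 \<le> c \<and> (\<exists>N. locally_null \<omega> N \<and> {x. norm (f x) > c} \<subseteq> N)}"
  then obtain N where "0 \<le> c" "locally_null \<omega> N" "{x. norm (f x) > c} \<subseteq> N" by blast
  then show "r \<le> c" by (intro r[of c N]) (auto simp: not_le[symmetric])
qed

lemma ess_norm_le:
  assumes "0 \<le> c" "locally_null \<omega> N" "\<And>x. x \<notin> N \<Longrightarrow> norm (f x) \<le> c"
  shows "ess_norm \<omega> f \<le> c"
  unfolding ess_norm_def
  by (rule cInf_lower) (use assms in \<open>auto simp: not_le[symmetric] intro!: bdd_belowI[of _ 0] exI[of _ N]\<close>)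

lemma locally_null_Un: "locally_null \<omega> N \<Longrightarrow> locally_null \<omega> N' \<Longrightarrow> locally_null \<omega> (N \<union> N')"
  unfolding locally_null_def
proof (elim conjE, intro conjI allI impI)
  fix C :: "'a set" assume N: "N \<in> sets borel" "N' \<in> sets borel"
    "\<forall>C. compact C \<longrightarrow> emeasure \<omega> (N \<inter> C) = 0" "\<forall>C. compact C \<longrightarrow> emeasure \<omega> (N' \<inter> C) = 0" and C: "compact C"
  have "emeasure \<omega> ((N \<inter> C) \<union> (N' \<inter> C)) \<le> emeasure \<omega> (N \<inter> C) + emeasure \<omega> (N' \<inter> C)"
    using N(1,2) C by (intro emeasure_subadditive) (auto simp: sets_haar borel_compact)
  then show "emeasure \<omega> ((N \<union> N') \<inter> C) = 0" using N(3,4) C by (simp add: Int_Un_distrib2)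
qed auto

lemma Linf_lin:
  assumes f: "f \<in> Linf \<omega>" and g: "g \<in> Linf \<omega>" shows "(\<lambda>x. a * f x + b * g x) \<in> Linf \<omega>"
proof -
  obtain c N where c: "f \<in> borel_measurable borel" "locally_null \<omega> N" "\<And>x. x \<notin> N \<Longrightarrow> norm (f x) \<le> c" using LinfE[OF f] by metis
  obtain d M where d: "g \<in> borel_measurable borel" "locally_null \<omega> M" "\<And>x. x \<notin> M \<Longrightarrow> norm (g x) \<le> d" using LinfE[OF g] by metis
  have "norm (a * f x + b * g x) \<le> norm a * c + norm b * d" if "x \<notin> N \<union> M" for x
    using that c(3)[of x] d(3)[of x] by (intro order_trans[OF norm_triangle_ineq] add_mono) (auto simp: norm_mult intro!: mult_left_mono)
  then have "{x. norm (a * f x + b * g x) > norm a * c + norm b * d} \<subseteq> N \<union> M" by (auto simp: not_le[symmetric])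
  moreover have "(\<lambda>x. a * f x + b * g x) \<in> borel_measurable borel" using c(1) d(1) by measurable
  ultimately show ?thesis unfolding Linf_def using locally_null_Un[OF c(2) d(2)] by blast
qed

text \<open>Density and function form one index, so that a single filter serves all pairs; the value
  0 elsewhere keeps the family bounded on the whole index type.\<close>

definition means :: "nat \<Rightarrow> ('a \<Rightarrow> real) \<times> ('a \<Rightarrow> complex) \<Rightarrow> complex" where
  "means n = (\<lambda>(g, f). if g \<in> Dens \<and> f \<in> Linf \<omega> then (\<Sum>k\<le>n. (\<integral>x. f (iv x) \<partial>nu g k)) / of_nat (Suc n) else 0)"

lemma norm_avg_le:
  fixes z :: "nat \<Rightarrow> complex"
  assumes "\<And>k. norm (z k) \<le> r" shows "norm ((\<Sum>k\<le>n. z k) / of_nat (Suc n)) \<le> r"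
proof -
  have "norm (\<Sum>k\<le>n. z k) \<le> (\<Sum>k\<le>n. r)" by (intro sum_norm_le assms)
  then show ?thesis by (simp add: norm_divide field_simps del: of_nat_Suc)
qed

lemma means_bound:
  assumes g: "g \<in> Dens" and f: "f \<in> Linf \<omega>" shows "norm (means n (g, f)) \<le> ess_norm \<omega> f"
proof (rule ess_norm_ge[OF f])
  fix c N assume "locally_null \<omega> N" "\<And>x. x \<notin> N \<Longrightarrow> norm (f x) \<le> c"
  moreover have "f \<in> borel_measurable borel" using f by (simp add: Linf_def)
  ultimately have "norm (\<integral>x. f (iv x) \<partial>nu g k) \<le> c" for k
    using nu_radon_ac[OF g] by (intro ac_integral_iv(2)[where N=N]) auto
  then show "norm (means n (g, f)) \<le> c" unfolding means_def using g f by (simp add: norm_avg_le del: of_nat_Suc)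
qed

lemma means_avg:
  assumes g: "g \<in> Dens" and f: "f \<in> bounded_borel B"
  shows "means n (g, f) = (\<integral>x. avg walk n (\<lambda>x. f (iv x)) x \<partial>den g)"
  unfolding integral_avg[OF walk_kernel bounded_borel_iv[OF f] radon_prob_den[OF g]] nu_integral[OF g bounded_borel_iv[OF f]]
  using g bounded_borel_Linf[OF f] by (simp add: means_def)

lemma means_lin:
  assumes g: "g \<in> Dens" and f: "f \<in> Linf \<omega>" "f' \<in> Linf \<omega>"
  shows "means n (g, \<lambda>x. a * f x + b * f' x) = a * means n (g, f) + b * means n (g, f')"
proof -
  have int: "integrable (nu g k) (\<lambda>x. h (iv x))" if "h \<in> Linf \<omega>" for h k
    by (rule LinfE[OF that], rule ac_integral_iv(1)) (use nu_radon_ac[OF g] in auto)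
  have "(\<integral>x. a * f (iv x) + b * f' (iv x) \<partial>nu g k) = a * (\<integral>x. f (iv x) \<partial>nu g k) + b * (\<integral>x. f' (iv x) \<partial>nu g k)" for k
    using int[OF f(1)] int[OF f(2)] by simp
  then show ?thesis using g f Linf_lin[OF f]
    by (simp add: means_def sum.distrib add_divide_distrib flip: sum_distrib_left del: of_nat_Suc)
qed

lemma Linf_truncate:
  assumes "f \<in> Linf \<omega>"
  obtains f' B N where "f' \<in> bounded_borel B" "locally_null \<omega> N" "\<And>x. x \<notin> N \<Longrightarrow> f x = f' x" "f \<in> borel_measurable borel"
proof -
  obtain c N where c: "f \<in> borel_measurable borel" "0 \<le> c" "locally_null \<omega> N" "\<And>x. x \<notin> N \<Longrightarrow> norm (f x) \<le> c" using LinfE[OF assms] by metis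
  have "{x \<in> space borel. norm (f x) \<le> c} \<in> sets borel" using c(1) by measurable
  then have "(\<lambda>x. if norm (f x) \<le> c then f x else 0) \<in> borel_measurable borel" using c(1) by (intro measurable_If) auto
  then have "(\<lambda>x. if norm (f x) \<le> c then f x else 0) \<in> bounded_borel c" using c(2) by (simp add: bounded_borel_def)
  then show ?thesis using that[of _ c N] c by simp
qed

theorem liouville_amenable: "amenable cv iv \<omega>"
proof -
  define b where "b = (\<lambda>(g, f). if g \<in> Dens \<and> f \<in> Linf \<omega> then ess_norm \<omega> f else 0)"
  have "norm (means n i) \<le> b i" for n i
    using means_bound by (cases i) (auto simp: b_def means_def simp del: of_nat_Suc)
  then obtain F m2 where F: "F \<noteq> bot" "F \<le> sequentially" and lim: "\<And>i. ((\<lambda>n. means n i) \<longlongrightarrow> m2 i) F"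
    using cluster_filter[of means b] by metis
  \<comment> \<open>On bounded Borel functions any other density gives the same limit by
    \<open>Lambda_const\<close>; fixing one defines \<open>m\<close> on all of
    \<open>Linf \<omega>\<close> at once.\<close>
  obtain g0 where g0: "g0 \<in> Dens" using Dens_at by blast
  define m where "m f = m2 (g0, f)" for f
  have m_lim: "((\<lambda>n. means n (g0, f)) \<longlongrightarrow> m f) F" for f unfolding m_def by (rule lim)
  have m_lin: "m (\<lambda>x. a * f x + b * f' x) = a * m f + b * m f'" if "f \<in> Linf \<omega>" "f' \<in> Linf \<omega>" for f f' a b
  proof (rule tendsto_unique[OF F(1) m_lim])
    show "((\<lambda>n. means n (g0, \<lambda>x. a * f x + b * f' x)) \<longlongrightarrow> a * m f + b * m f') F"
      unfolding means_lin[OF g0 that] by (intro tendsto_intros m_lim)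
  qed
  have m_bound: "norm (m f) \<le> ess_norm \<omega> f" if "f \<in> Linf \<omega>" for f
    by (rule Lim_norm_ubound[OF F(1) m_lim]) (simp add: means_bound[OF g0 that])
  have one: "(\<lambda>_. 1) \<in> Linf \<omega>" by (rule bounded_borel_Linf[of _ 1]) (simp add: bounded_borel_def)
  have m_one: "m (\<lambda>_. 1) = 1"
  proof (rule tendsto_unique[OF F(1) m_lim])
    have "(\<integral>x. 1 \<partial>nu g0 k) = (1::complex)" for k using radon_probD(5,6)[of "nu g0 k"] nu_radon_ac[OF g0, of k] by simp
    then have "means n (g0, \<lambda>_. 1) = 1" for n using g0 one by (simp add: means_def del: of_nat_Suc)
    then show "((\<lambda>n. means n (g0, \<lambda>_. 1)) \<longlongrightarrow> 1) F" by simp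
  qed
  have m_Dens: "m (conv (\<lambda>y. of_real (g y)) f) = m f" if g: "g \<in> Dens" and f: "f \<in> bounded_borel B" for g f B
  proof (rule tendsto_unique[OF F(1) m_lim])
    \<comment> \<open>The functional \<open>\<Lambda>\<close> of the limit construction is realised
      here as \<open>h \<mapsto> m2 (h, f)\<close>.\<close>
    have L: "((\<lambda>n. \<integral>x. avg walk n (\<lambda>x. f (iv x)) x \<partial>den h) \<longlongrightarrow> m2 (h, f)) F" if "h \<in> Dens" for h
      using lim[of "(h, f)"] unfolding means_avg[OF that f] .
    show "((\<lambda>n. means n (g0, conv (\<lambda>y. of_real (g y)) f)) \<longlongrightarrow> m f) F"
      unfolding means_avg[OF g0 fconv_Dens(2)[OF g f]] fconv_Dens(1)[OF g f] m_def
      by (rule right_limit[OF bounded_borel_iv[OF f] F L g g0])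
  qed
  have m_fconv: "conv g f \<in> borel_measurable borel \<and> m (conv g f) = (\<integral>y. g y \<partial>\<omega>) * m f"
    if f: "f \<in> bounded_borel B" and g: "integrable \<omega> g" for f B g
  proof -
    \<comment> \<open>Borel measurability of \<open>conv g f\<close> is carried along with the
      identity, because \<open>m_lin\<close> and \<open>m_bound\<close> apply only to members of
      \<open>Linf \<omega>\<close>.\<close>
    define Q where "Q g \<longleftrightarrow> integrable \<omega> g \<and> conv g f \<in> borel_measurable borel
      \<and> m (conv g f) = (\<integral>y. g y \<partial>\<omega>) * m f" for g
    have B0: "0 \<le> B" by (rule bounded_borelD(3)[OF f])
    have Linf': "conv g f \<in> Linf \<omega>" "norm (m (conv g f)) \<le> B * (\<integral>y. norm (g y) \<partial>\<omega>)"
      if "integrable \<omega> g" "conv g f \<in> borel_measurable borel" for g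
    proof -
      show L: "conv g f \<in> Linf \<omega>"
        by (rule bounded_borel_Linf) (use that fconv_integrable(2)[OF that(1) f] in \<open>auto simp: bounded_borel_def\<close>)
      have "ess_norm \<omega> (conv g f) \<le> B * (\<integral>y. norm (g y) \<partial>\<omega>)"
        by (rule ess_norm_le[OF _ locally_null_empty fconv_integrable(2)[OF that(1) f]]) (simp add: B0)
      then show "norm (m (conv g f)) \<le> B * (\<integral>y. norm (g y) \<partial>\<omega>)" using m_bound[OF L] by simp
    qed
    have Q_lin: "Q (\<lambda>y. a * g y + b * h y)" if "Q g" "Q h" for g h a b
    proof -
      have gh: "integrable \<omega> g" "integrable \<omega> h" "conv g f \<in> borel_measurable borel" "conv h f \<in> borel_measurable borel"
        using that by (auto simp: Q_def)
      have eq: "conv (\<lambda>y. a * g y + b * h y) f = (\<lambda>x. a * conv g f x + b * conv h f x)"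
        using fconv_lin[OF gh(1,2) f] by blast
      have "(\<lambda>x. a * conv g f x + b * conv h f x) \<in> borel_measurable borel" using gh(3,4) by measurable
      moreover have "m (\<lambda>x. a * conv g f x + b * conv h f x) = a * m (conv g f) + b * m (conv h f)"
        by (rule m_lin[OF Linf'(1)[OF gh(1,3)] Linf'(1)[OF gh(2,4)]])
      ultimately show ?thesis unfolding Q_def eq using that gh by (simp add: Q_def algebra_simps)
    qed
    have Q_Dens: "Q (\<lambda>y. of_real (g y))" if "g \<in> Dens" for g
      unfolding Q_def using m_Dens[OF that f] bounded_borelD(1)[OF fconv_Dens(2)[OF that f]] DensD[OF that]
      by (simp add: Cc_haar_integrable)
    have Q_Cc: "Q (\<lambda>y. of_real (h y))" if h: "h \<in> Cc" for h
    proof -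
      obtain a b g1 g2 where "g1 \<in> Dens" "g2 \<in> Dens" "h = (\<lambda>x. a * g1 x - b * g2 x)" by (rule Cc_Dens_decomp[OF h])
      then show ?thesis using Q_lin[OF Q_Dens[of g1] Q_Dens[of g2], of "of_real a" "- of_real b"] by simp
    qed
    have Q_Complex: "Q (\<lambda>y. of_real (h1 y) + \<i> * of_real (h2 y))" if "h1 \<in> Cc" "h2 \<in> Cc" for h1 h2
      using Q_lin[OF Q_Cc[OF that(1)] Q_Cc[OF that(2)], of 1 \<i>] by simp
    \<comment> \<open>A sequence of approximants, so that measurability of \<open>conv g f\<close>
      follows from pointwise convergence; the error \<open>1 / (j + 1)\<close> in \<open>L1\<close>
      controls the convolutions uniformly.\<close>
    have "\<exists>h. Q h \<and> (\<integral>y. norm (g y - h y) \<partial>\<omega>) < inverse (real (Suc j))" for j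
      using Cc_dense_L1[OF g, rule_format, of "inverse (real (Suc j))"] Q_Complex by (auto simp del: of_nat_Suc)
    then obtain h where h: "\<And>j. Q (h j)" "\<And>j. (\<integral>y. norm (g y - h j y) \<partial>\<omega>) < inverse (real (Suc j))" by metis
    have hi: "integrable \<omega> (h j)" "conv (h j) f \<in> borel_measurable borel" "m (conv (h j) f) = (\<integral>y. h j y \<partial>\<omega>) * m f" for j
      using h(1)[of j] by (auto simp: Q_def)
    have gd: "integrable \<omega> (\<lambda>y. g y - h j y)" for j using g hi(1) by (rule Bochner_Integration.integrable_diff)
    have lin: "conv (\<lambda>y. g y - h j y) f x = conv g f x - conv (h j) f x" for j x
      using fconv_lin[OF g hi(1) f, of 1 "- 1"] by simp
    have inv0: "(\<lambda>j. C * inverse (real (Suc j))) \<longlonglongrightarrow> 0" for C :: real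
      using tendsto_mult[OF tendsto_const LIMSEQ_inverse_real_of_nat, of C] by simp
    have Bi: "B * (\<integral>y. norm (g y - h j y) \<partial>\<omega>) \<le> B * inverse (real (Suc j))" for j
      using h(2)[of j] B0 by (intro mult_left_mono) auto
    have "(\<lambda>j. conv (h j) f x) \<longlonglongrightarrow> conv g f x" for x
    proof -
      have "norm (conv (h j) f x - conv g f x) \<le> B * inverse (real (Suc j))" for j
        using fconv_integrable(2)[OF gd f, of j x] Bi[of j] unfolding lin by (simp add: norm_minus_commute)
      then have "(\<lambda>j. conv (h j) f x - conv g f x) \<longlonglongrightarrow> 0"
        by (intro Lim_null_comparison[OF _ inv0[of B]] always_eventually allI)
      then show ?thesis by (simp add: LIM_zero_iff)
    qed
    then have gm: "conv g f \<in> borel_measurable borel" by (intro borel_measurable_LIMSEQ_metric[OF hi(2)])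
    have m_close: "norm (m (conv (h j) f) - m (conv g f)) \<le> B * inverse (real (Suc j))" for j
    proof -
      have lm: "conv (\<lambda>y. g y - h j y) f \<in> borel_measurable borel"
        using gm hi(2)[of j] unfolding lin[abs_def] by measurable
      have "m (conv (\<lambda>y. g y - h j y) f) = m (conv g f) - m (conv (h j) f)"
        using m_lin[OF Linf'(1)[OF g gm] Linf'(1)[OF hi(1,2)[of j]], of 1 "- 1"] unfolding lin[abs_def] by simp
      then show ?thesis using Linf'(2)[OF gd lm] Bi[of j] by (simp add: norm_minus_commute)
    qed
    have l1: "(\<lambda>j. m (conv (h j) f)) \<longlonglongrightarrow> m (conv g f)"
      by (rule LIM_zero_cancel, rule Lim_null_comparison[OF _ inv0[of B]]) (intro always_eventually allI m_close)
    have "norm ((\<integral>y. h j y \<partial>\<omega>) - (\<integral>y. g y \<partial>\<omega>)) \<le> 1 * inverse (real (Suc j))" for j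
    proof -
      have "norm ((\<integral>y. g y \<partial>\<omega>) - (\<integral>y. h j y \<partial>\<omega>)) = norm (\<integral>y. g y - h j y \<partial>\<omega>)" using g hi(1) by simp
      also have "\<dots> \<le> (\<integral>y. norm (g y - h j y) \<partial>\<omega>)" by (rule integral_norm_bound)
      finally show ?thesis using h(2)[of j] by (simp add: norm_minus_commute)
    qed
    then have "(\<lambda>j. \<integral>y. h j y \<partial>\<omega>) \<longlonglongrightarrow> (\<integral>y. g y \<partial>\<omega>)"
      by (intro LIM_zero_cancel[OF Lim_null_comparison[OF _ inv0[of 1]]] always_eventually allI)
    then have "(\<lambda>j. (\<integral>y. h j y \<partial>\<omega>) * m f) \<longlonglongrightarrow> (\<integral>y. g y \<partial>\<omega>) * m f" by (intro tendsto_mult tendsto_const)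
    then have "m (conv g f) = (\<integral>y. g y \<partial>\<omega>) * m f"
      using l1 unfolding hi(3) by (rule LIMSEQ_unique[rotated])
    then show ?thesis using gm by simp
  qed
  have "m (conv g f) = (\<integral>y. g y \<partial>\<omega>) * m f" if f: "f \<in> Linf \<omega>" and g: "integrable \<omega> g" for f g
  proof -
    obtain f' B N where f': "f' \<in> bounded_borel B" "locally_null \<omega> N" "\<And>x. x \<notin> N \<Longrightarrow> f x = f' x" "f \<in> borel_measurable borel"
      using Linf_truncate[OF f] by metis
    have L': "f' \<in> Linf \<omega>" by (rule bounded_borel_Linf[OF f'(1)])
    \<comment> \<open>The truncation differs from \<open>f\<close> by a function of essential norm
      0, which the bounded functional \<open>m\<close> annihilates.\<close>
    have "ess_norm \<omega> (\<lambda>x. 1 * f x + (- 1) * f' x) \<le> 0" by (rule ess_norm_le[OF _ f'(2)]) (simp_all add: f'(3))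
    then have "norm (m (\<lambda>x. 1 * f x + (- 1) * f' x)) \<le> 0"
      using m_bound[OF Linf_lin[OF f L', of 1 "- 1"]] by (rule order_trans[rotated])
    then have "m (\<lambda>x. 1 * f x + (- 1) * f' x) = 0" by (simp only: norm_le_zero_iff)
    then have "m f = m f'" unfolding m_lin[OF f L'] by simp
    moreover have "conv g f = conv g f'"
      by (rule fconv_locally_null[OF g f'(4) bounded_borelD(1)[OF f'(1)] f'(2,3)])
    ultimately show ?thesis using m_fconv[OF f'(1) g] by simp
  qed
  then show ?thesis unfolding amenable_def using m_lin m_bound m_one by blast
qed

end

theorem theorem3p3:
  fixes cv :: "'a::t2_space \<Rightarrow> 'a \<Rightarrow> 'a measure" and e :: 'a and iv :: "'a \<Rightarrow> 'a"
    and \<omega> :: "'a measure" and \<sigma> :: "'a measure"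
  assumes "hypergroup cv e iv"
    and "left_haar cv \<omega>"
    and "radon_measure \<sigma>" and "prob_space \<sigma>"
    and "\<forall>f. f \<in> Hinf_sigma cv iv \<omega> \<sigma> \<longleftrightarrow> (f \<in> Linf \<omega> \<and> (\<exists>c. loc_ae_eq \<omega> f (\<lambda>_. c)))"
  shows "amenable cv iv \<omega>"
proof -
  interpret liouville_walk cv e iv \<omega> \<sigma>
    using assms radon_measure_imp_radon_prob by unfold_locales auto
  show ?thesis by (rule liouville_amenable)
qed

end
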